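(* Let $n,s\ge 1$, $h>0$, $a_{ij},b_i\in\mathbb{R}$ ($1\le i,j\le s$), and let $L\colon SO(n)\times \mathrm{Skew}(n)\to\mathbb{R}$, $(U,\Omega)\mapsto L(U,\Omega)$, be a smooth (left-trivialized) Lagrangian. Then there is a neighborhood $V$ of the identity $I$ in $\mathbb{R}^{n\times n}$, depending only on $n$, such that the following holds. Let $g_0,g_1\in SO(n)$, $\Omega_1,\dots,\Omega_s\in\mathrm{Skew}(n)$, $\Lambda\in \mathrm{Skew}(n)$, $p_0,p_1\in\mathrm{Skew}(n)$ and $U_1,\dots,U_s\in SO(n)$ be such that each $A_i:=g_0+h\sum_{j=1}^s a_{ij}U_j\Omega_j$ has positive determinant, $U_i=\mathbb{P}(A_i)$ for all $i$, the linear map $\tilde\phi$ (defined in the context) is invertible, and $g_1^T\big(g_0+h\sum_{i=1}^s b_iU_i\Omega_i\big)\in V$. Let $$\tilde F(g_0,g_1,\{\Omega_i\}_{i=1}^s,\Lambda)=h\sum_{i=1}^s b_iL(U_i,\Omega_i)+\Big\langle \Lambda,\ \mathrm{Asym}\Big(g_1^T\big(g_0+h\sum_{i=1}^s b_iU_i\Omega_i\big)\Big)\Big\rangle ,$$ where the $U_i$ are regarded as functions of $(g_0,\{\Omega_j\})$ through $U_i=\mathbb{P}(g_0+h\sum_j a_{ij}U_j\Omega_j)$. Then the system $$\frac{\partial\tilde F}{\partial\Omega_k}=0\ (k=1,\dots,s),\qquad \frac{\partial\tilde F}{\partial\Lambda}=0,\qquad -p_0=\frac{\partial\tilde F}{\partial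 g_0},\qquad p_1=\frac{\partial\tilde F}{\partial g_1}$$ is equivalent to the system (1) for every $k=1,\dots,s$, $$0=h\sum_{i=1}^s b_i(\tilde\pi_i\circ\tilde\phi^{-1}\circ\tilde\psi_k)^*\Big(\frac{\partial L}{\partial U}(U_i,\Omega_i)+\mathrm{Asym}(U_i^Tg_1\Lambda\Omega_i^T)\Big)+b_k\Big(\frac{\partial L}{\partial\Omega}(U_k,\Omega_k)+\mathrm{Asym}(U_k^Tg_1\Lambda)\Big);$$ (2) $g_1=\mathbb{P}\big(g_0+h\sum_{i=1}^s b_iU_i\Omega_i\big)$; (3) $-p_0=h\sum_{i=1}^s b_i(\tilde\pi_i\circ\tilde\phi^{-1}\circ\tilde\varphi)^*\Big(\frac{\partial L}{\partial U}(U_i,\Omega_i)+\mathrm{Asym}(U_i^Tg_1\Lambda\Omega_i^T)\Big)+\mathrm{Asym}(g_0^Tg_1\Lambda)$; (4) $p_1=\mathrm{Asym}\Big(g_1^T\big(g_0+h\sum_{i=1}^s b_iU_i\Omega_i\big)\Lambda^T\Big)$. Moreover, for $S\in\mathrm{Skew}(n)$ and $1\le i,k\le s$ the adjoint maps in (1) and (3) are computed as follows: if $(S_1,\dots,S_s)\in\mathrm{Skew}(n)^s$ is the unique solution of $$S_j-\mathrm{Asym}\Big(hU_j^T\sum_{l=1}^s a_{lj}\,d\mathbb{P}_{A_l}^*(S_l)\,\Omega_j^T\Big)=\delta_{ij}S,\qquad j=1,\dots,s,$$ then $$(\tilde\pi_i\circ\tilde\phi^{-1}\circ\tilde\psi_k)^*(S)=\mathrm{Asym}\Big(U_k^T\sum_{l=1}^s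 a_{lk}\,d\mathbb{P}_{A_l}^*(S_l)\Big),\qquad (\tilde\pi_i\circ\tilde\phi^{-1}\circ\tilde\varphi)^*(S)=\mathrm{Asym}\Big(g_0^T\sum_{l=1}^s d\mathbb{P}_{A_l}^*(S_l)\Big),$$ where, for $A_l=U_lP_l$ the polar decomposition, $d\mathbb{P}_{A_l}^*(S)=U_lX$ with $X$ the unique solution of $P_lX+XP_l=S$.
   Context: $\mathrm{Skew}(n)$ is the space of real skew-symmetric $n\times n$ matrices, with inner product $\langle\Omega,\tilde\Omega\rangle=\sum_{i<j}\Omega_{ij}\tilde\Omega_{ij}=\tfrac12\mathrm{tr}(\Omega\tilde\Omega^T)$; $\mathbb{R}^{n\times n}$ carries the inner product $\mathrm{tr}(AB^T)$; $\mathrm{Skew}(n)^s$ carries the sum of the inner products of its factors. Dual spaces are identified with the spaces themselves via these inner products, and $^*$ denotes the adjoint with respect to them. $\mathrm{Asym}(A)=A-A^T$. Polar projection: every $A\in\mathbb{R}^{n\times n}$ with $\det A>0$ is uniquely $A=UP$ with $U\in SO(n)$ and $P$ symmetric positive-definite; $\mathbb{P}(A):=U$. Its left-trivialized tangent map $d\mathbb{P}_A\colon\mathbb{R}^{n\times n}\to\mathrm{Skew}(n)$ is defined by: if $A(t)$ is a curve with $A(0)=A$, $\dot A(0)=B$, and $U(t)=\mathbb{P}(A(t))$, then $\dot U(0)=U\,d\mathbb{P}_A(B)$. Its adjoint $d\mathbb{P}_A^*\colon\mathrm{Skew}(n)\to\mathbb{R}^{n\times n}$ satisfies $\mathrm{tr}(d\mathbb{P}_A^*(\Omega)B^T)=\langle\Omega,d\mathbb{P}_A(B)\rangle$.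 Linear maps (with $A_i=g_0+h\sum_j a_{ij}U_j\Omega_j$): - $\tilde\psi_k\colon\mathrm{Skew}(n)\to\mathrm{Skew}(n)^s$, $\tilde\psi_k(\delta)=\{d\mathbb{P}_{A_i}(a_{ik}U_k\delta)\}_{i=1}^s$; - $\tilde\phi\colon\mathrm{Skew}(n)^s\to\mathrm{Skew}(n)^s$, $\tilde\phi(\{X_i\})=\{X_i-d\mathbb{P}_{A_i}(h\sum_{j=1}^s a_{ij}U_jX_j\Omega_j)\}_{i=1}^s$; - $\tilde\pi_i\colon\mathrm{Skew}(n)^s\to\mathrm{Skew}(n)$, the $i$-th coordinate projection; - $\tilde\varphi\colon\mathrm{Skew}(n)\to\mathrm{Skew}(n)^s$, $\tilde\varphi(\delta)=\{d\mathbb{P}_{A_i}(g_0\delta)\}_{i=1}^s$. Since $\tilde\phi$ is invertible, the implicit function theorem makes $(U_1,\dots,U_s)$ a smooth function of $(g_0,\Omega_1,\dots,\Omega_s)$ near the given data, determined by $U_i=\mathbb{P}(g_0+h\sum_ja_{ij}U_j\Omega_j)$; this is the dependence used in $\tilde F$. Derivatives: $\partial/\partial\Omega$, $\partial/\partial\Omega_k$, $\partial/\partial\Lambda$ are gradients in $\mathrm{Skew}(n)$ with respect to $\langle\cdot,\cdot\rangle$. Derivatives with respect to a group variable are left-trivialized: for a function $f$ on $SO(n)$, $\partial f/\partial g\in\mathrm{Skew}(n)$ is defined by $\frac{d}{dt}\big|_{t=0}f(g(t))=\langle\partial f/\partial g,\eta\rangle$ for $g(0)=g$, $\dot g(0)=g\eta$,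 $\eta\in\mathrm{Skew}(n)$; this applies to $\partial L/\partial U$, $\partial\tilde F/\partial g_0$, $\partial\tilde F/\partial g_1$. *)

theory Defs
  imports "HOL-Analysis.Analysis"
begin

section \<open>Skew-symmetric matrices and the rotation group\<close>

definition skew :: "(real^'n^'n) set" where
  "skew = {A. transpose A = - A}"

definition SO :: "(real^'n^'n) set" where
  "SO = {Q. rotation_matrix Q}"

definition mat_inner :: "real^'n^'n \<Rightarrow> real^'n^'n \<Rightarrow> real" where
  "mat_inner A B = trace (A ** transpose B)"

definition skew_inner :: "real^'n^'n \<Rightarrow> real^'n^'n \<Rightarrow> real" where
  "skew_inner A B = trace (A ** transpose B) / 2"

definition Asym :: "real^'n^'n \<Rightarrow> real^'n^'n" where
  "Asym A = A - transpose A"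

text \<open>An \<open>s\<close>-tuple is a function on \<open>nat\<close> with indices \<open>{1..s}\<close> and the value \<open>undefined\<close>
  at all other arguments, so that tuples are equal iff they agree on \<open>{1..s}\<close>. The number
  of stages is a natural number, not a type, because the neighbourhood in the main
  theorem must not depend on it.\<close>

definition skew_pow :: "nat \<Rightarrow> (nat \<Rightarrow> real^'n^'n) set" where
  "skew_pow s = (\<Pi>\<^sub>E i\<in>{1..s}. skew)"

text \<open>Adjoint of \<open>f\<close>, a linear map from the subspace \<open>V\<close> with inner product \<open>ipV\<close> to a space
  with inner product \<open>ipW\<close>. The library constant \<open>adjoint\<close> is tied to \<open>inner\<close> on whole
  types.\<close>

definition adjoint_on ::
  "'v set \<Rightarrow> ('v \<Rightarrow> 'v \<Rightarrow> real) \<Rightarrow> ('w \<Rightarrow> 'w \<Rightarrow> real) \<Rightarrow> ('v \<Rightarrow> 'w) \<Rightarrow> 'w \<Rightarrow> 'v" where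
  "adjoint_on V ipV ipW f w = (THE x. x \<in> V \<and> (\<forall>v\<in>V. ipV x v = ipW w (f v)))"

abbreviation skew_adjoint ::
  "(real^'n^'n \<Rightarrow> real^'n^'n) \<Rightarrow> real^'n^'n \<Rightarrow> real^'n^'n" where
  "skew_adjoint \<equiv> adjoint_on skew skew_inner skew_inner"


section \<open>Smooth functions\<close>

primrec Ck_on :: "nat \<Rightarrow> 'a::real_normed_vector set \<Rightarrow> ('a \<Rightarrow> 'b::real_normed_vector) \<Rightarrow> bool" where
  "Ck_on 0 T f \<longleftrightarrow> continuous_on T f"
| "Ck_on (Suc k) T f \<longleftrightarrow> (\<forall>x\<in>T. f differentiable (at x)) \<and>
     (\<forall>v. Ck_on k T (\<lambda>x. frechet_derivative f (at x) v))"

text \<open>Smoothness of a function on an arbitrary subset \<open>M\<close> means existence of local smooth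
  extensions to the ambient space. On an embedded submanifold such as \<open>SO \<times> skew\<close>
  this is the usual notion.\<close>

definition smooth_on :: "'a::real_normed_vector set \<Rightarrow> ('a \<Rightarrow> 'b::real_normed_vector) \<Rightarrow> bool" where
  "smooth_on M f \<longleftrightarrow>
     (\<forall>x\<in>M. \<exists>T f'. open T \<and> x \<in> T \<and> (\<forall>k. Ck_on k T f') \<and> (\<forall>y\<in>M \<inter> T. f' y = f y))"


section \<open>Gradients\<close>

definition has_skew_gradient ::
  "(real^'n^'n \<Rightarrow> real) \<Rightarrow> real^'n^'n \<Rightarrow> real^'n^'n \<Rightarrow> bool" where
  "has_skew_gradient f D x \<longleftrightarrow>
     D \<in> skew \<and> (f has_derivative skew_inner D) (at x within skew)"

definition skew_gradient :: "(real^'n^'n \<Rightarrow> real) \<Rightarrow> real^'n^'n \<Rightarrow> real^'n^'n" where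
  "skew_gradient f x = (THE D. has_skew_gradient f D x)"

text \<open>Left-trivialized gradient of a function on \<open>SO\<close>\<close>

definition has_lt_gradient ::
  "(real^'n^'n \<Rightarrow> real) \<Rightarrow> real^'n^'n \<Rightarrow> real^'n^'n \<Rightarrow> bool" where
  "has_lt_gradient f D g \<longleftrightarrow>
     D \<in> skew \<and>
     (\<forall>\<gamma> \<eta>. \<eta> \<in> skew \<longrightarrow> (\<forall>t. \<gamma> t \<in> SO) \<longrightarrow> \<gamma> 0 = g \<longrightarrow>
        (\<gamma> has_vector_derivative g ** \<eta>) (at 0) \<longrightarrow>
        ((\<lambda>t. f (\<gamma> t)) has_real_derivative skew_inner D \<eta>) (at 0))"

definition lt_gradient :: "(real^'n^'n \<Rightarrow> real) \<Rightarrow> real^'n^'n \<Rightarrow> real^'n^'n" where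
  "lt_gradient f g = (THE D. has_lt_gradient f D g)"


section \<open>Polar decomposition\<close>

definition sym_pos_def :: "real^'n^'n \<Rightarrow> bool" where
  "sym_pos_def P \<longleftrightarrow> transpose P = P \<and> (\<forall>x. x \<noteq> 0 \<longrightarrow> 0 < x \<bullet> (P *v x))"

definition polar_decomp :: "real^'n^'n \<Rightarrow> real^'n^'n \<Rightarrow> real^'n^'n \<Rightarrow> bool" where
  "polar_decomp A U P \<longleftrightarrow> U \<in> SO \<and> sym_pos_def P \<and> A = U ** P"

text \<open>The next three constants are meaningful for \<open>det A > 0\<close> only.\<close>

definition polar_proj :: "real^'n^'n \<Rightarrow> real^'n^'n" where
  "polar_proj A = (THE U. \<exists>P. polar_decomp A U P)"

definition dpolar :: "real^'n^'n \<Rightarrow> real^'n^'n \<Rightarrow> real^'n^'n" where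
  "dpolar A B = (THE D. D \<in> skew \<and>
     (\<forall>\<gamma>. \<gamma> 0 = A \<longrightarrow> (\<gamma> has_vector_derivative B) (at 0) \<longrightarrow>
        ((\<lambda>t. polar_proj (\<gamma> t)) has_vector_derivative polar_proj A ** D) (at 0)))"

definition dpolar_adj :: "real^'n^'n \<Rightarrow> real^'n^'n \<Rightarrow> real^'n^'n" where
  "dpolar_adj A = adjoint_on UNIV mat_inner skew_inner (dpolar A)"


section \<open>Internal stages\<close>

definition stage_mat ::
  "nat \<Rightarrow> real \<Rightarrow> (nat \<Rightarrow> nat \<Rightarrow> real) \<Rightarrow> real^'n^'n \<Rightarrow> (nat \<Rightarrow> real^'n^'n) \<Rightarrow>
   (nat \<Rightarrow> real^'n^'n) \<Rightarrow> nat \<Rightarrow> real^'n^'n" where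
  "stage_mat s h a g \<Omega> U i = g + h *\<^sub>R (\<Sum>j=1..s. a i j *\<^sub>R (U j ** \<Omega> j))"

definition end_mat ::
  "nat \<Rightarrow> real \<Rightarrow> (nat \<Rightarrow> real) \<Rightarrow> real^'n^'n \<Rightarrow> (nat \<Rightarrow> real^'n^'n) \<Rightarrow>
   (nat \<Rightarrow> real^'n^'n) \<Rightarrow> real^'n^'n" where
  "end_mat s h b g \<Omega> U = g + h *\<^sub>R (\<Sum>i=1..s. b i *\<^sub>R (U i ** \<Omega> i))"

definition psi_map ::
  "nat \<Rightarrow> real \<Rightarrow> (nat \<Rightarrow> nat \<Rightarrow> real) \<Rightarrow> real^'n^'n \<Rightarrow> (nat \<Rightarrow> real^'n^'n) \<Rightarrow>
   (nat \<Rightarrow> real^'n^'n) \<Rightarrow> nat \<Rightarrow> real^'n^'n \<Rightarrow> (nat \<Rightarrow> real^'n^'n)" where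
  "psi_map s h a g \<Omega> U k \<delta> =
     (\<lambda>i\<in>{1..s}. dpolar (stage_mat s h a g \<Omega> U i) (a i k *\<^sub>R (U k ** \<delta>)))"

definition phi_map ::
  "nat \<Rightarrow> real \<Rightarrow> (nat \<Rightarrow> nat \<Rightarrow> real) \<Rightarrow> real^'n^'n \<Rightarrow> (nat \<Rightarrow> real^'n^'n) \<Rightarrow>
   (nat \<Rightarrow> real^'n^'n) \<Rightarrow> (nat \<Rightarrow> real^'n^'n) \<Rightarrow> (nat \<Rightarrow> real^'n^'n)" where
  "phi_map s h a g \<Omega> U X =
     (\<lambda>i\<in>{1..s}. X i - dpolar (stage_mat s h a g \<Omega> U i)
                            (h *\<^sub>R (\<Sum>j=1..s. a i j *\<^sub>R (U j ** X j ** \<Omega> j))))"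

definition varphi_map ::
  "nat \<Rightarrow> real \<Rightarrow> (nat \<Rightarrow> nat \<Rightarrow> real) \<Rightarrow> real^'n^'n \<Rightarrow> (nat \<Rightarrow> real^'n^'n) \<Rightarrow>
   (nat \<Rightarrow> real^'n^'n) \<Rightarrow> real^'n^'n \<Rightarrow> (nat \<Rightarrow> real^'n^'n)" where
  "varphi_map s h a g \<Omega> U \<delta> =
     (\<lambda>i\<in>{1..s}. dpolar (stage_mat s h a g \<Omega> U i) (g ** \<delta>))"

abbreviation phi_inv ::
  "nat \<Rightarrow> real \<Rightarrow> (nat \<Rightarrow> nat \<Rightarrow> real) \<Rightarrow> real^'n^'n \<Rightarrow> (nat \<Rightarrow> real^'n^'n) \<Rightarrow>
   (nat \<Rightarrow> real^'n^'n) \<Rightarrow> (nat \<Rightarrow> real^'n^'n) \<Rightarrow> (nat \<Rightarrow> real^'n^'n)" where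
  "phi_inv s h a g \<Omega> U \<equiv> inv_into (skew_pow s) (phi_map s h a g \<Omega> U)"

definition pi_map :: "nat \<Rightarrow> (nat \<Rightarrow> real^'n^'n) \<Rightarrow> real^'n^'n" where
  "pi_map i X = X i"

text \<open>\<open>\<U>\<close> is a solution of the stage equations, as a function of \<open>(g, \<Omega>)\<close> near
  \<open>(g0, \<Omega>0)\<close>, with value \<open>U0\<close> there. Continuity is enough to single out one germ: when
  \<open>phi_map\<close> is invertible, a continuous solution agrees near \<open>(g0, \<Omega>0)\<close> with the smooth
  one given by the implicit function theorem.\<close>

definition stage_solution ::
  "nat \<Rightarrow> real \<Rightarrow> (nat \<Rightarrow> nat \<Rightarrow> real) \<Rightarrow> real^'n^'n \<Rightarrow> (nat \<Rightarrow> real^'n^'n) \<Rightarrow>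
   (nat \<Rightarrow> real^'n^'n) \<Rightarrow> (real^'n^'n \<Rightarrow> (nat \<Rightarrow> real^'n^'n) \<Rightarrow> nat \<Rightarrow> real^'n^'n) \<Rightarrow> bool" where
  "stage_solution s h a g0 \<Omega>0 U0 \<U> \<longleftrightarrow>
     (\<forall>i\<in>{1..s}. \<U> g0 \<Omega>0 i = U0 i) \<and>
     (\<exists>N. open N \<and> (g0, \<Omega>0) \<in> N \<and>
        (\<forall>i\<in>{1..s}. continuous_on (N \<inter> SO \<times> skew_pow s) (\<lambda>(g, \<Omega>). \<U> g \<Omega> i)) \<and>
        (\<forall>(g, \<Omega>) \<in> N \<inter> SO \<times> skew_pow s. \<forall>i\<in>{1..s}.
           0 < det (stage_mat s h a g \<Omega> (\<U> g \<Omega>) i) \<and>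
           \<U> g \<Omega> i = polar_proj (stage_mat s h a g \<Omega> (\<U> g \<Omega>) i)))"

definition F_tilde ::
  "nat \<Rightarrow> real \<Rightarrow> (nat \<Rightarrow> real) \<Rightarrow> (real^'n^'n \<Rightarrow> real^'n^'n \<Rightarrow> real) \<Rightarrow>
   (real^'n^'n \<Rightarrow> (nat \<Rightarrow> real^'n^'n) \<Rightarrow> nat \<Rightarrow> real^'n^'n) \<Rightarrow>
   real^'n^'n \<Rightarrow> real^'n^'n \<Rightarrow> (nat \<Rightarrow> real^'n^'n) \<Rightarrow> real^'n^'n \<Rightarrow> real" where
  "F_tilde s h b L \<U> g0 g1 \<Omega> \<Lambda> =
     h * (\<Sum>i=1..s. b i * L (\<U> g0 \<Omega> i) (\<Omega> i)) +
     skew_inner \<Lambda> (Asym (transpose g1 ** end_mat s h b g0 \<Omega> (\<U> g0 \<Omega>)))"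

end

(* The polar factors of A = U P and B = V Q satisfy the exact Sylvester equation
   P Z + Z Q = U^T (B - A) - (B - A)^T V with Z = U^T (V - U). Since X |-> P X + X Q is coercive, this
   gives uniqueness, the Lipschitz bound and strict differentiability of the polar projection at
   once; existence follows by maximizing tr(U^T A) over the orthogonal group. Strict
   differentiability makes the simplified Newton map of the stage equations a contraction, uniformly
   in (g, Omega): this yields a continuous solution, and shows that every continuous solution is
   differentiable with derivative phi^-1 of the partial derivative in the parameters. The
   equivalence is then the chain rule, with the adjoints found by transposing phi. *)
theory Submission
  imports Defs
begin

section \<open>The Frobenius inner product\<close>

text \<open>The theorem speaks about every continuous solution of the stage equations, so
  differentiability in (g, Omega) must be derived from continuity alone. The unknowns are sought
  among arbitrary matrices: this puts the contraction argument into a linear space without charts of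
  the rotation group, and the solutions are still rotations, being values of
  \<open>polar_proj\<close>. The price is that \<open>phi_map\<close>, which acts on tangent
  vectors, has to be promoted to an invertible map on all matrix tuples. Strictness, with both
  points of the difference moving and the derivative frozen at the base point, takes the place of
  continuity of the tangent map. The multiplier equation only yields symmetry of g1^T E, where E is
  the end matrix. Other rotations also make this product symmetric, but not positive definite.
  \<open>V\<close> is the unit ball about the identity, on which the quadratic form is positive, and
  this excludes them.\<close>

lemma inner_matrix_trace: "(A::real^'n^'n) \<bullet> B = trace (A ** transpose B)"
  by (simp add: inner_vec_def trace_def matrix_matrix_mult_def transpose_def)

lemma mat_inner_eq: "mat_inner A B = A \<bullet> B"
  by (simp add: mat_inner_def inner_matrix_trace)

lemma skew_inner_eq: "skew_inner A B = (A \<bullet> B) / 2"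
  by (simp add: skew_inner_def inner_matrix_trace)

lemma inner_mult_left: "(A ** B) \<bullet> C = B \<bullet> (transpose A ** C)"
  for A B C :: "real^'n^'n"
proof -
  have "(A ** B) \<bullet> C = trace (A ** (B ** transpose C))"
    by (simp add: inner_matrix_trace matrix_mul_assoc)
  also have "\<dots> = trace (B ** transpose C ** A)" by (rule trace_mul_sym)
  also have "\<dots> = B \<bullet> (transpose A ** C)"
    by (simp add: inner_matrix_trace matrix_transpose_mul matrix_mul_assoc)
  finally show ?thesis .
qed

lemma inner_mult_right: "(A ** B) \<bullet> C = A \<bullet> (C ** transpose B)"
  for A B C :: "real^'n^'n"
  by (simp add: inner_matrix_trace matrix_transpose_mul matrix_mul_assoc)

lemma inner_transpose: "transpose A \<bullet> transpose B = A \<bullet> B" for A B :: "real^'n^'n"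
  by (metis inner_commute inner_matrix_trace trace_mul_sym transpose_transpose)

lemma norm_transpose [simp]: "norm (transpose A) = norm A" for A :: "real^'n^'n"
  by (simp add: norm_eq_sqrt_inner inner_transpose)

lemma matrix_power2_norm: "(norm (A::real^'n^'m))\<^sup>2 = (\<Sum>i\<in>UNIV. (norm (A $ i))\<^sup>2)"
  by (simp add: power2_norm_eq_inner inner_vec_def)

text \<open>Each entry of the product pairs a row of \<open>A\<close> with a column of
  \<open>B\<close>, so Cauchy-Schwarz applies entrywise. The constant 1 keeps the explicit estimates
  for the polar projection free of dimensional factors.\<close>

lemma norm_matrix_mult_le: "norm (A ** B) \<le> norm A * norm B" for A B :: "real^'n^'n"
proof (rule power2_le_imp_le)
  have "(norm (A ** B))\<^sup>2 = (\<Sum>i\<in>UNIV. \<Sum>j\<in>UNIV. (A $ i \<bullet> transpose B $ j)\<^sup>2)"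
    unfolding matrix_power2_norm
    by (simp add: power2_norm_eq_inner) (simp add: inner_vec_def matrix_matrix_mult_def
        transpose_def power2_eq_square)
  also have "\<dots> \<le> (\<Sum>i\<in>UNIV. \<Sum>j\<in>UNIV. (norm (A $ i))\<^sup>2 * (norm (transpose B $ j))\<^sup>2)"
    by (intro sum_mono) (metis Cauchy_Schwarz_ineq power2_norm_eq_inner)
  also have "\<dots> = (norm A)\<^sup>2 * (norm (transpose B))\<^sup>2"
    by (simp only: matrix_power2_norm sum_product)
  also have "\<dots> = (norm A * norm B)\<^sup>2" by (simp add: power_mult_distrib)
  finally show "(norm (A ** B))\<^sup>2 \<le> (norm A * norm B)\<^sup>2" .
qed simp

lemma scaleR_matrix_mult: "(r *\<^sub>R A) ** B = r *\<^sub>R (A ** B)"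
  "A ** (r *\<^sub>R B) = r *\<^sub>R (A ** B)" for A B :: "real^'n^'n"
  by (simp_all add: vec_eq_iff matrix_matrix_mult_def sum_distrib_left ac_simps)

lemma matrix_add_rdistrib: "(A + B) ** C = A ** C + B ** C" for A B C :: "real^'n^'n"
  by (simp add: vec_eq_iff matrix_matrix_mult_def sum.distrib ring_distribs)

lemma bounded_bilinear_matrix_mult: "bounded_bilinear ((**) :: real^'n^'n \<Rightarrow> real^'n^'n \<Rightarrow> real^'n^'n)"
proof
  show "\<exists>K. \<forall>(a :: real^'n^'n) (b :: real^'n^'n). norm (a ** b) \<le> norm a * norm b * K"
    by (rule exI[of _ 1]) (simp add: norm_matrix_mult_le)
qed (auto simp: scaleR_matrix_mult matrix_add_ldistrib matrix_add_rdistrib)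

interpretation matmul: bounded_bilinear "(**) :: real^'n^'n \<Rightarrow> real^'n^'n \<Rightarrow> real^'n^'n"
  by (rule bounded_bilinear_matrix_mult)

lemma bounded_linear_transpose: "bounded_linear (transpose :: real^'n^'n \<Rightarrow> real^'n^'n)"
  by (rule bounded_linear_intro[where K = 1])
    (simp_all add: vec_eq_iff transpose_def norm_transpose[unfolded transpose_def])

lemmas transpose_add = linear_add[OF bounded_linear.linear[OF bounded_linear_transpose]]
lemmas transpose_diff = linear_diff[OF bounded_linear.linear[OF bounded_linear_transpose]]
lemmas transpose_0 = linear_0[OF bounded_linear.linear[OF bounded_linear_transpose]]

section \<open>Multiplication by rotations\<close>

lemma SO_transpose_mult:
  assumes "U \<in> SO" shows "transpose U ** U = mat 1" "U ** transpose U = mat 1"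
  using assms by (auto simp: SO_def rotation_matrix_def orthogonal_matrix_def)

lemma SO_cancel:
  assumes "U \<in> SO" shows "transpose U ** (U ** A) = A" "U ** (transpose U ** A) = A"
  using assms by (simp_all add: matrix_mul_assoc SO_transpose_mult)

lemma norm_SO_mult: "U \<in> SO \<Longrightarrow> norm (U ** A) = norm A" for A :: "real^'n^'n"
  by (simp add: norm_eq_sqrt_inner inner_mult_left SO_cancel)

lemma transpose_SO: "U \<in> SO \<Longrightarrow> transpose U \<in> SO"
  by (simp add: SO_def rotation_matrix_def)

lemma det_SO: "U \<in> SO \<Longrightarrow> det U = 1"
  by (simp add: SO_def rotation_matrix_def)


section \<open>Skew-symmetric matrices\<close>

lemma subspace_skew: "subspace skew"
  by (auto simp: subspace_def skew_def transpose_add transpose_scalar transpose_0)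

lemmas skew_0 [simp] = subspace_0[OF subspace_skew]
lemmas skew_add = subspace_add[OF subspace_skew]
lemmas skew_diff = subspace_diff[OF subspace_skew]
lemmas skew_scaleR = subspace_scale[OF subspace_skew]
lemmas skew_sum = subspace_sum[OF subspace_skew]

lemma Asym_skew [simp]: "Asym A \<in> skew"
  by (simp add: skew_def Asym_def transpose_diff)

lemma bounded_linear_Asym: "bounded_linear Asym"
  unfolding Asym_def by (intro bounded_linear_sub bounded_linear_ident bounded_linear_transpose)

lemmas Asym_add = linear_add[OF bounded_linear.linear[OF bounded_linear_Asym]]
lemmas Asym_scaleR = linear_scale[OF bounded_linear.linear[OF bounded_linear_Asym]]

lemma skew_transpose: "X \<in> skew \<Longrightarrow> transpose X = - X"
  by (simp add: skew_def)

lemma Asym_on_skew: "X \<in> skew \<Longrightarrow> Asym X = 2 *\<^sub>R X"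
  by (simp add: Asym_def skew_transpose scaleR_2)

lemma inner_transpose_skew: "X \<in> skew \<Longrightarrow> transpose A \<bullet> X = - (A \<bullet> X)"
  by (metis inner_minus_right inner_transpose skew_transpose transpose_transpose)

text \<open>The half in \<open>skew_inner\<close> cancels the doubling by \<open>Asym\<close>, which
  makes \<open>Asym\<close> the adjoint of the inclusion of \<open>skew\<close> into all matrices.
  The \<open>Asym\<close> terms in the gradients and in the adjoint formulas arise this way.\<close>

lemma skew_inner_Asym: "X \<in> skew \<Longrightarrow> skew_inner (Asym A) X = A \<bullet> X"
  by (simp add: skew_inner_eq Asym_def inner_diff_left inner_transpose_skew)

lemma skew_inner_commute: "skew_inner A B = skew_inner B A"
  by (simp add: skew_inner_eq inner_commute)

lemma bounded_bilinear_skew_inner: "bounded_bilinear skew_inner"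
proof
  show "\<exists>K. \<forall>a b. norm (skew_inner a b) \<le> norm a * norm b * K"
    by (rule exI[of _ "1/2"]) (auto simp: skew_inner_eq Cauchy_Schwarz_ineq2)
qed (auto simp: skew_inner_eq inner_add_left inner_add_right add_divide_distrib)

interpretation skew_inner: bounded_bilinear skew_inner
  by (rule bounded_bilinear_skew_inner)

lemma skew_inner_nondegenerate:
  assumes "X \<in> skew" "Y \<in> skew" "\<And>Z. Z \<in> skew \<Longrightarrow> skew_inner X Z = skew_inner Y Z"
  shows "X = Y"
proof -
  have "skew_inner (X - Y) (X - Y) = 0"
    using assms(3)[OF skew_diff[OF assms(1,2)]] by (simp add: skew_inner.diff_left)
  then show ?thesis by (simp add: skew_inner_eq)
qed


section \<open>Positive definite matrices and the Sylvester equation\<close>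

text \<open>Symmetry is kept separate because the final step receives the two halves of
  \<open>sym_pos_def\<close> from different sources: positivity from the neighbourhood
  \<open>V\<close>, symmetry from the multiplier equation.\<close>

definition posdef :: "real^'n^'n \<Rightarrow> bool" where
  "posdef M \<longleftrightarrow> (\<forall>x. x \<noteq> 0 \<longrightarrow> 0 < x \<bullet> (M *v x))"

lemma sym_pos_def_iff: "sym_pos_def P \<longleftrightarrow> transpose P = P \<and> posdef P"
  by (simp add: sym_pos_def_def posdef_def)

lemma posdef_det_nonzero:
  assumes "posdef M" shows "det M \<noteq> 0"
proof -
  have "M *v x = 0 \<Longrightarrow> x = 0" for x
    using assms unfolding posdef_def by (metis inner_zero_right less_irrefl)
  then show ?thesis
    by (metis invertible_det_nz invertible_left_inverse matrix_left_invertible_ker)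
qed

lemma continuous_on_det: "continuous_on S (det :: real^'n^'n \<Rightarrow> real)"
  unfolding det_def by (intro continuous_intros)

text \<open>The segment from the identity to a positive definite matrix avoids singular matrices.\<close>
lemma posdef_det_pos:
  assumes "posdef (M :: real^'n^'n)" shows "0 < det M"
proof (rule ccontr)
  assume neg: "\<not> 0 < det M"
  define c where "c t = (1 - t) *\<^sub>R (mat 1 :: real^'n^'n) + t *\<^sub>R M" for t :: real
  have "continuous_on {0..1} (\<lambda>t. det (c t))"
    unfolding c_def by (intro continuous_on_compose2[OF continuous_on_det[of UNIV]] continuous_intros) auto
  moreover have "det (c 0) = 1" "det (c 1) = det M" by (simp_all add: c_def)
  ultimately obtain t where t: "0 \<le> t" "t \<le> 1" "det (c t) = 0"
    using IVT2'[of "\<lambda>t. det (c t)" 1 0 0] neg by auto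
  have "posdef (c t)"
    unfolding posdef_def
  proof (intro allI impI)
    fix x :: "real^'n" assume "x \<noteq> 0"
    then have pos: "0 < x \<bullet> x" "0 < x \<bullet> (M *v x)"
      using assms by (auto simp: posdef_def)
    have eq: "x \<bullet> (c t *v x) = (1 - t) * (x \<bullet> x) + t * (x \<bullet> (M *v x))"
      by (simp add: c_def matrix_vector_mult_add_rdistrib inner_add_right
          scaleR_matrix_vector_assoc[symmetric])
    show "0 < x \<bullet> (c t *v x)"
    proof (cases "t = 0")
      case False
      then have "0 < t * (x \<bullet> (M *v x))" using t pos by simp
      moreover have "0 \<le> (1 - t) * (x \<bullet> x)" using t by simp
      ultimately show ?thesis unfolding eq by linarith
    qed (use pos eq in simp)
  qed
  then show False using t(3) posdef_det_nonzero by blast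
qed

text \<open>The Frobenius norm dominates the operator norm, so the perturbation E changes the form
  by less than |x|^2. The unit ball found here becomes the neighbourhood \<open>V\<close>, which
  therefore depends on the dimension only.\<close>

lemma near_identity_posdef:
  assumes "norm (M - mat 1) < 1" shows "posdef (M :: real^'n^'n)"
  unfolding posdef_def
proof (intro allI impI)
  fix x :: "real^'n" assume x: "x \<noteq> 0"
  define E where "E = M - mat 1"
  have "norm (E *v x) \<le> norm E * norm x"
  proof (rule power2_le_imp_le)
    have "(norm (E *v x))\<^sup>2 = (\<Sum>i\<in>UNIV. (E $ i \<bullet> x)\<^sup>2)"
      by (simp add: power2_norm_eq_inner) (simp add: inner_vec_def power2_eq_square matrix_vector_mult_def)
    also have "\<dots> \<le> (\<Sum>i\<in>UNIV. (norm (E $ i))\<^sup>2 * (norm x)\<^sup>2)"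
      by (intro sum_mono) (metis Cauchy_Schwarz_ineq power2_norm_eq_inner)
    also have "\<dots> = (norm E * norm x)\<^sup>2"
      by (simp add: matrix_power2_norm power_mult_distrib sum_distrib_right)
    finally show "(norm (E *v x))\<^sup>2 \<le> (norm E * norm x)\<^sup>2" .
  qed simp
  then have "\<bar>x \<bullet> (E *v x)\<bar> \<le> norm x * (norm E * norm x)"
    by (meson Cauchy_Schwarz_ineq2 mult_left_mono norm_ge_zero order_trans)
  also have "\<dots> < norm x * (1 * norm x)"
    using x assms by (intro mult_strict_left_mono mult_strict_right_mono) (auto simp: E_def)
  finally have "\<bar>x \<bullet> (E *v x)\<bar> < x \<bullet> x" by (simp add: norm_eq_sqrt_inner)
  moreover have "x \<bullet> (M *v x) = x \<bullet> x + x \<bullet> (E *v x)"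
    by (simp add: E_def matrix_vector_mult_diff_rdistrib inner_diff_right)
  ultimately show "0 < x \<bullet> (M *v x)" by linarith
qed

text \<open>By homogeneity c can be the minimum of the quadratic form over the compact unit
  sphere.\<close>

lemma posdef_lower_bound:
  assumes "posdef (P :: real^'n^'n)"
  obtains c where "0 < c" "\<And>x. c * (x \<bullet> x) \<le> x \<bullet> (P *v x)"
proof -
  have "continuous_on (sphere 0 1) (\<lambda>x::real^'n. x \<bullet> (P *v x))"
    by (intro continuous_intros linear_continuous_on linear_linear[THEN iffD2] matrix_vector_mul_linear)
  moreover obtain i :: 'n where "True" by blast
  have "axis i 1 \<in> sphere (0::real^'n) 1" by simp
  then have "sphere (0::real^'n) 1 \<noteq> {}" by blast
  ultimately obtain u where u: "u \<in> sphere 0 1" "\<And>x. x \<in> sphere 0 1 \<Longrightarrow> u \<bullet> (P *v u) \<le> x \<bullet> (P *v x)"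
    using continuous_attains_inf[OF compact_sphere, of "0::real^'n" 1 "\<lambda>x. x \<bullet> (P *v x)"] by blast
  show ?thesis
  proof
    have "u \<noteq> 0" using u(1) by auto
    then show "0 < u \<bullet> (P *v u)" using assms by (simp add: posdef_def)
    fix x :: "real^'n"
    show "u \<bullet> (P *v u) * (x \<bullet> x) \<le> x \<bullet> (P *v x)"
    proof (cases "x = 0")
      case False
      have "u \<bullet> (P *v u) \<le> ((1 / norm x) *\<^sub>R x) \<bullet> (P *v ((1 / norm x) *\<^sub>R x))"
        using False by (intro u(2)) simp
      also have "\<dots> = (x \<bullet> (P *v x)) / (norm x)\<^sup>2"
        by (simp add: matrix_vector_mult_scaleR power2_eq_square)
      finally show ?thesis using False by (simp add: field_simps power2_norm_eq_inner)
    qed simp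
  qed
qed

text \<open>Left multiplication acts on each column separately; this lifts bounds for vectors to the
  Frobenius product.\<close>

lemma inner_mult_columns: "X \<bullet> (P ** X) = (\<Sum>j\<in>UNIV. column j X \<bullet> (P *v column j X))"
  for X P :: "real^'n^'n"
proof -
  have "X \<bullet> (P ** X) = (\<Sum>i\<in>UNIV. \<Sum>j\<in>UNIV. X $ i $ j * (P *v column j X) $ i)"
    by (simp add: inner_vec_def matrix_matrix_mult_def matrix_vector_mult_def column_def)
  also have "\<dots> = (\<Sum>j\<in>UNIV. \<Sum>i\<in>UNIV. X $ i $ j * (P *v column j X) $ i)" by (rule sum.swap)
  finally show ?thesis by (simp add: inner_vec_def column_def)
qed

lemma posdef_inner_mult_left:
  fixes X P :: "real^'n^'n"
  assumes "\<And>x. c * (x \<bullet> x) \<le> x \<bullet> (P *v x)"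
  shows "c * (X \<bullet> X) \<le> X \<bullet> (P ** X)"
proof -
  have "X \<bullet> X = (\<Sum>j\<in>UNIV. column j X \<bullet> column j X)"
    using inner_mult_columns[of X "mat 1"] by simp
  then show ?thesis
    unfolding inner_mult_columns[of X P] by (simp add: sum_distrib_left sum_mono assms)
qed

lemma posdef_inner_mult_right:
  fixes X P :: "real^'n^'n"
  assumes "\<And>x. c * (x \<bullet> x) \<le> x \<bullet> (P *v x)" "transpose P = P"
  shows "c * (X \<bullet> X) \<le> X \<bullet> (X ** P)"
proof -
  have "X \<bullet> (X ** P) = transpose X \<bullet> (P ** transpose X)"
    by (metis assms(2) inner_transpose matrix_transpose_mul)
  then show ?thesis
    using posdef_inner_mult_left[OF assms(1), of "transpose X"] by (simp add: inner_transpose)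
qed

section \<open>The Sylvester operator and its inverse\<close>

definition sylvester :: "real^'n^'n \<Rightarrow> real^'n^'n \<Rightarrow> real^'n^'n" where
  "sylvester P X = P ** X + X ** P"

text \<open>Pairing \<open>PX + XQ\<close> with \<open>X\<close> leaves \<open>\<langle>X, PX\<rangle> \<ge> c |X|\<^sup>2\<close> and \<open>\<langle>X, XQ\<rangle> \<ge> 0\<close>.\<close>
lemma sylvester_bound:
  fixes X P Q :: "real^'n^'n"
  assumes "\<And>x. c * (x \<bullet> x) \<le> x \<bullet> (P *v x)" "sym_pos_def Q"
  shows "c * norm X \<le> norm (P ** X + X ** Q)"
proof (cases "X = 0")
  case False
  obtain d where d: "0 < d" "\<And>x. d * (x \<bullet> x) \<le> x \<bullet> (Q *v x)"
    using posdef_lower_bound assms(2) sym_pos_def_iff by metis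
  have "0 \<le> X \<bullet> (X ** Q)"
  proof -
    have "0 \<le> d * (X \<bullet> X)" using d by simp
    also have "\<dots> \<le> X \<bullet> (X ** Q)"
      using posdef_inner_mult_right[OF d(2)] assms(2) by (simp add: sym_pos_def_iff)
    finally show ?thesis .
  qed
  then have "c * (X \<bullet> X) \<le> X \<bullet> (P ** X + X ** Q)"
    using posdef_inner_mult_left[OF assms(1), of X] by (simp add: inner_add_right)
  also have "\<dots> \<le> norm X * norm (P ** X + X ** Q)" by (rule norm_cauchy_schwarz)
  finally have "norm X * (c * norm X) \<le> norm X * norm (P ** X + X ** Q)"
    by (simp add: power2_norm_eq_inner[symmetric] power2_eq_square ac_simps)
  then show ?thesis using False by simp
qed simp

lemma linear_sylvester: "linear (sylvester P)"
  by (rule linearI) (simp_all add: sylvester_def matmul.add_left matmul.add_right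
      scaleR_matrix_mult scaleR_add_right)

lemma inj_sylvester:
  assumes "sym_pos_def P" shows "inj (sylvester P)"
proof -
  obtain c where c: "0 < c" "\<And>x. c * (x \<bullet> x) \<le> x \<bullet> (P *v x)"
    using posdef_lower_bound assms sym_pos_def_iff by metis
  have "X = 0" if "sylvester P X = 0" for X
    using sylvester_bound[OF c(2) assms, of X] that c(1)
    by (auto simp: sylvester_def mult_le_0_iff)
  then show ?thesis using linear_injective_0[OF linear_sylvester] by blast
qed

lemma bij_sylvester: "sym_pos_def P \<Longrightarrow> bij (sylvester P)"
  using inj_sylvester linear_injective_imp_surjective linear_sylvester by (blast intro: bijI)

definition sylvester_inv :: "real^'n^'n \<Rightarrow> real^'n^'n \<Rightarrow> real^'n^'n" where
  "sylvester_inv P = inv (sylvester P)"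

lemma sylvester_inv:
  assumes "sym_pos_def P"
  shows "sylvester P (sylvester_inv P S) = S" "sylvester_inv P (sylvester P X) = X"
  using bij_sylvester[OF assms] unfolding sylvester_inv_def
  by (simp_all add: bij_is_surj surj_f_inv_f bij_is_inj)

lemma linear_sylvester_inv:
  assumes "sym_pos_def P" shows "linear (sylvester_inv P)"
  by (metis assms bij_sylvester linear_sylvester sylvester_inv_def bij_is_inj bij_is_surj
      linear_inj_imp_surj inj_linear_imp_inv_linear)

text \<open>Transposing P X + X P = S negates the right-hand side, so the transpose of X and -X
  solve the same uniquely solvable equation.\<close>

lemma sylvester_inv_skew:
  assumes "sym_pos_def P" "S \<in> skew" shows "sylvester_inv P S \<in> skew"
proof -
  define X where "X = sylvester_inv P S"
  have "sylvester P (transpose X) = transpose (sylvester P X)"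
    using assms(1) by (simp add: sylvester_def transpose_add matrix_transpose_mul sym_pos_def_iff)
  also have "\<dots> = - sylvester P X"
    using assms by (simp add: X_def sylvester_inv skew_transpose)
  also have "\<dots> = sylvester P (- X)" by (simp add: linear_neg[OF linear_sylvester])
  finally have "transpose X = - X" using inj_sylvester[OF assms(1)] by (simp add: inj_eq)
  then show ?thesis by (simp add: X_def skew_def)
qed

lemma sylvester_self_adjoint:
  assumes "transpose P = P" shows "sylvester P X \<bullet> Y = X \<bullet> sylvester P Y"
  by (simp add: sylvester_def inner_add_left inner_add_right inner_mult_left[of P X]
      inner_mult_right[of X P] assms)


section \<open>Existence and uniqueness of the polar decomposition\<close>

definition outer :: "real^'n \<Rightarrow> real^'n \<Rightarrow> real^'n^'n" where
  "outer u v = (\<chi> i j. u $ i * v $ j)"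

lemma inner_outer: "outer u v \<bullet> S = u \<bullet> (S *v v)"
  by (simp add: outer_def inner_vec_def matrix_vector_mult_def sum_distrib_left ac_simps)

lemma outer_mult_outer: "outer u v ** outer w z = (v \<bullet> w) *\<^sub>R outer u z"
  by (simp add: vec_eq_iff outer_def inner_vec_def matrix_matrix_mult_def
      sum_distrib_left sum_distrib_right ac_simps)

lemma transpose_outer: "transpose (outer u v) = outer v u"
  by (simp add: vec_eq_iff outer_def transpose_def)

text \<open>For a unit vector u this is the reflection in the hyperplane orthogonal to u.\<close>

definition householder :: "real^'n \<Rightarrow> real^'n^'n" where
  "householder u = mat 1 - 2 *\<^sub>R outer u u"

lemma householder_mult:
  "householder u ** householder v
     = mat 1 - 2 *\<^sub>R outer u u - 2 *\<^sub>R outer v v + (4 * (u \<bullet> v)) *\<^sub>R outer u v"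
  by (simp add: householder_def matmul.diff_left matmul.diff_right scaleR_matrix_mult
      outer_mult_outer scaleR_diff_right)

lemma orthogonal_householder:
  assumes "norm u = 1" shows "orthogonal_matrix (householder u)"
proof -
  have "transpose (householder u) = householder u"
    by (simp add: householder_def transpose_diff transpose_scalar transpose_outer)
  moreover have "u \<bullet> u = 1" using assms by (simp add: dot_square_norm)
  then have "householder u ** householder u = mat 1"
    by (simp add: householder_mult vec_eq_iff)
  ultimately show ?thesis by (simp add: orthogonal_matrix)
qed

lemma linear_term_zero:
  fixes a b :: real
  assumes "\<And>t. 0 \<le> t * a + t\<^sup>2 * b" shows "a = 0"
proof (rule ccontr)
  assume a: "a \<noteq> 0"
  \<comment> \<open>The test value t = -a/c turns the quadratic into (a/c)^2 (b - c), which is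
    negative as soon as 0 < c and b < c.\<close>
  define c where "c = \<bar>b\<bar> + 1"
  have "c > 0" "b < c" by (auto simp: c_def)
  have "0 \<le> (- a / c) * a + (- a / c)\<^sup>2 * b" by (rule assms)
  also have "\<dots> = (a / c)\<^sup>2 * (b - c)"
    using \<open>c > 0\<close> by (simp add: field_simps power2_eq_square)
  also have "\<dots> < 0" using a \<open>b < c\<close> \<open>c > 0\<close> by (intro mult_pos_neg) auto
  finally show False by simp
qed

text \<open>If the identity maximizes \<open>Q \<mapsto> tr(Q\<^sup>T S)\<close> over the orthogonal group, comparison with
  reflections gives \<open>S \<ge> 0\<close>, and comparison with products of two reflections gives symmetry.\<close>
lemma max_trace_symmetric_psd:
  fixes S :: "real^'n^'n"
  assumes max: "\<And>Q. orthogonal_matrix Q \<Longrightarrow> Q \<bullet> S \<le> mat 1 \<bullet> S"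
  shows "0 \<le> x \<bullet> (S *v x)" "x \<bullet> (S *v y) = y \<bullet> (S *v x)"
proof -
  have normed: "norm ((1 / norm u) *\<^sub>R u) = 1" if "u \<noteq> 0" for u :: "real^'n" using that by simp
  have psd: "0 \<le> u \<bullet> (S *v u)" if "norm u = 1" for u
    using max[OF orthogonal_householder[OF that]]
    by (simp add: householder_def inner_diff_left inner_outer)
  show "0 \<le> x \<bullet> (S *v x)"
  proof (cases "x = 0")
    case False
    then show ?thesis
      using psd[OF normed[OF False]] by (simp add: matrix_vector_mult_scaleR zero_le_divide_iff mult_le_0_iff)
  qed simp
  \<comment> \<open>Comparison with the product of the reflections in u and v, expanded by
    \<open>householder_mult\<close>.\<close>
  have unit: "2 * (u \<bullet> v) * (u \<bullet> (S *v v)) \<le> u \<bullet> (S *v u) + v \<bullet> (S *v v)"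
    if "norm u = 1" "norm v = 1" for u v
    using max[OF orthogonal_matrix_mul[OF orthogonal_householder[OF that(1)] orthogonal_householder[OF that(2)]]]
    by (simp add: householder_mult inner_diff_left inner_add_left inner_outer)
  \<comment> \<open>The same inequality made homogeneous, so that u may move along a line without
    normalization.\<close>
  have two: "2 * (u \<bullet> v) * (u \<bullet> (S *v v)) \<le> (u \<bullet> (S *v u)) * (v \<bullet> v) + (v \<bullet> (S *v v)) * (u \<bullet> u)" for u v
  proof (cases "u = 0 \<or> v = 0")
    case False
    define m k where "m = norm u" and "k = norm v"
    have mk: "m > 0" "k > 0" "u \<bullet> u = m\<^sup>2" "v \<bullet> v = k\<^sup>2"
      using False by (auto simp: m_def k_def dot_square_norm)
    have "2 * ((u \<bullet> v) / (m * k)) * ((u \<bullet> (S *v v)) / (m * k))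
        \<le> (u \<bullet> (S *v u)) / m\<^sup>2 + (v \<bullet> (S *v v)) / k\<^sup>2"
      using unit[OF normed normed, of u v] False
      by (simp add: matrix_vector_mult_scaleR m_def[symmetric] k_def[symmetric] power2_eq_square ac_simps)
    from mult_right_mono[OF this, of "m\<^sup>2 * k\<^sup>2"]
    have "2 * ((u \<bullet> v) / (m * k)) * ((u \<bullet> (S *v v)) / (m * k)) * (m\<^sup>2 * k\<^sup>2)
        \<le> ((u \<bullet> (S *v u)) / m\<^sup>2 + (v \<bullet> (S *v v)) / k\<^sup>2) * (m\<^sup>2 * k\<^sup>2)"
      by simp
    moreover have "2 * ((u \<bullet> v) / (m * k)) * ((u \<bullet> (S *v v)) / (m * k)) * (m\<^sup>2 * k\<^sup>2)
        = 2 * (u \<bullet> v) * (u \<bullet> (S *v v))"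
      using mk(1,2) by (simp add: power2_eq_square)
    moreover have "((u \<bullet> (S *v u)) / m\<^sup>2 + (v \<bullet> (S *v v)) / k\<^sup>2) * (m\<^sup>2 * k\<^sup>2)
        = (u \<bullet> (S *v u)) * k\<^sup>2 + (v \<bullet> (S *v v)) * m\<^sup>2"
      using mk(1,2) by (simp add: distrib_right)
    ultimately show ?thesis using mk(3,4) by simp
  qed auto
  show "x \<bullet> (S *v y) = y \<bullet> (S *v x)"
  proof (cases "x = 0")
    case False
    \<comment> \<open>For u = x + t y and v = x the inequality \<open>two\<close> is an equality at
      t = 0, so its linear term in t vanishes. That term is |x|^2 times the asserted difference;
      \<open>B\<close> is the quadratic coefficient.\<close>
    define B where "B = (y \<bullet> (S *v y)) * (x \<bullet> x) + (x \<bullet> (S *v x)) * (y \<bullet> y) - 2 * (x \<bullet> y) * (y \<bullet> (S *v x))"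
    have "0 \<le> t * ((x \<bullet> x) * (x \<bullet> (S *v y) - y \<bullet> (S *v x))) + t\<^sup>2 * B" for t
      using two[of "x + t *\<^sub>R y" x]
      by (simp add: matrix_vector_right_distrib matrix_vector_mult_scaleR inner_add_left
          inner_add_right algebra_simps power2_eq_square inner_commute[of y x] B_def)
    from linear_term_zero[OF this] show ?thesis using False by simp
  qed simp
qed

lemma compact_orthogonal: "compact {Q :: real^'n^'n. orthogonal_matrix Q}"
proof (rule compact_eq_bounded_closed[THEN iffD2], intro conjI)
  have "norm Q = sqrt (mat 1 \<bullet> (mat 1 :: real^'n^'n))" if "orthogonal_matrix Q" for Q :: "real^'n^'n"
  proof -
    have "Q \<bullet> Q = (mat 1 ** Q) \<bullet> Q" by simp
    also have "\<dots> = mat 1 \<bullet> (Q ** transpose Q)" by (rule inner_mult_right)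
    finally show ?thesis using that by (simp add: norm_eq_sqrt_inner orthogonal_matrix_def)
  qed
  then show "bounded {Q :: real^'n^'n. orthogonal_matrix Q}"
    by (intro boundedI[where B = "sqrt (mat 1 \<bullet> (mat 1 :: real^'n^'n))"]) auto
  have "closed {Q :: real^'n^'n. transpose Q ** Q = mat 1}"
    by (intro closed_Collect_eq matmul.continuous_on continuous_intros
        bounded_linear.continuous_on[OF bounded_linear_transpose])
  then show "closed {Q :: real^'n^'n. orthogonal_matrix Q}" by (simp add: orthogonal_matrix)
qed

text \<open>Maximizing over the full orthogonal group admits single reflections as competitors,
  although they have determinant -1. That the maximizer is a rotation is recovered at the end from
  the signs of det A and det S.\<close>

lemma polar_decomp_exists:
  assumes "0 < det (A :: real^'n^'n)"
  shows "\<exists>U P. polar_decomp A U P"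
proof -
  have "{Q :: real^'n^'n. orthogonal_matrix Q} \<noteq> {}" using orthogonal_matrix_id by blast
  moreover have "continuous_on {Q. orthogonal_matrix Q} (\<lambda>Q. Q \<bullet> A)"
    by (intro continuous_intros)
  ultimately obtain U where U: "orthogonal_matrix U" "\<And>Q. orthogonal_matrix Q \<Longrightarrow> Q \<bullet> A \<le> U \<bullet> A"
    using continuous_attains_sup[OF compact_orthogonal] by (metis mem_Collect_eq)
  \<comment> \<open>Left multiplication by U preserves the orthogonal group, so optimality of U for
    A becomes optimality of the identity for S.\<close>
  define S where "S = transpose U ** A"
  have A: "A = U ** S"
    using U(1) by (simp add: S_def matrix_mul_assoc orthogonal_matrix_def)
  have "Q \<bullet> S \<le> mat 1 \<bullet> S" if "orthogonal_matrix Q" for Q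
  proof -
    have "Q \<bullet> S = (U ** Q) \<bullet> A" "mat 1 \<bullet> S = U \<bullet> A"
      by (simp_all add: S_def inner_mult_left flip: inner_mult_left[of U "mat 1", simplified])
    then show ?thesis using U(2)[OF orthogonal_matrix_mul[OF U(1) that]] by simp
  qed
  note S = max_trace_symmetric_psd[OF this]
  have detS: "det S \<noteq> 0" using assms A by (auto simp: det_mul)
  have "0 < x \<bullet> (S *v x)" if "x \<noteq> 0" for x
  proof (rule ccontr)
    assume "\<not> 0 < x \<bullet> (S *v x)"
    then have 0: "x \<bullet> (S *v x) = 0" using S(1)[of x] by simp
    \<comment> \<open>A zero of a nonnegative form is critical: varying x in the direction S x
      forces S x = 0, although S is nonsingular.\<close>
    define y where "y = S *v x"
    have "0 \<le> t * (2 * (y \<bullet> (S *v x))) + t\<^sup>2 * (y \<bullet> (S *v y))" for t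
      using S(1)[of "x + t *\<^sub>R y"] 0 S(2)[of x y]
      by (simp add: matrix_vector_right_distrib matrix_vector_mult_scaleR inner_add_left
          inner_add_right algebra_simps power2_eq_square)
    from linear_term_zero[OF this] have "S *v x = 0" by (simp add: y_def)
    then show False
      using detS that by (metis invertible_det_nz invertible_left_inverse matrix_left_invertible_ker)
  qed
  then have pd: "posdef S" by (simp add: posdef_def)
  moreover have "transpose S = S"
  proof -
    have "S $ i $ j = S $ j $ i" for i j
      using S(2)[of "axis i 1" "axis j 1"] by (simp add: matrix_vector_mul_component inner_axis inner_axis' inner_commute)
    then show ?thesis by (simp add: transpose_def vec_eq_iff)
  qed
  ultimately have "sym_pos_def S" by (simp add: sym_pos_def_iff)
  moreover have "det U = 1"
  proof -
    have "0 < det U * det S" using assms A by (simp add: det_mul)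
    then have "det U > 0" using posdef_det_pos[OF pd] by (simp add: zero_less_mult_iff)
    then show ?thesis using det_orthogonal_matrix[OF U(1)] by auto
  qed
  ultimately show ?thesis
    using U(1) A by (auto simp: polar_decomp_def SO_def rotation_matrix_def)
qed

text \<open>The difference of two polar factors solves a Sylvester equation whose right-hand side is
  linear in the difference of the matrices; uniqueness and smoothness both follow.\<close>
lemma polar_sylvester:
  assumes "polar_decomp A U P" "polar_decomp B V Q"
  defines "Z \<equiv> transpose U ** (V - U)"
  shows "P ** Z + Z ** Q = transpose U ** (B - A) - transpose (B - A) ** V"
proof -
  have U: "U \<in> SO" "V \<in> SO" and A: "A = U ** P" "B = V ** Q" and s: "transpose P = P" "transpose Q = Q"
    using assms by (auto simp: polar_decomp_def sym_pos_def_def)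
  have Z: "Z = transpose U ** V - mat 1"
    using U by (simp add: Z_def matmul.diff_right SO_transpose_mult)
  show ?thesis
    \<comment> \<open>Orthogonality reduces U^T A to P, U^T B to U^T V Q, A^T V to P U^T V and B^T V
      to Q; the terms then match.\<close>
    unfolding Z A
    by (simp add: matmul.diff_right matmul.diff_left transpose_diff matrix_transpose_mul s
        matrix_mul_assoc[symmetric] SO_cancel[OF U(1)] SO_cancel[OF U(2)] SO_transpose_mult U)
qed

text \<open>Only the coercivity of P enters the constant, so the bound is uniform in B and
  Q.\<close>

lemma polar_difference_bound:
  assumes "polar_decomp A U P" "polar_decomp B V Q" "\<And>x. c * (x \<bullet> x) \<le> x \<bullet> (P *v x)"
  shows "c * norm (V - U) \<le> 2 * norm (B - A)"
proof -
  have U: "U \<in> SO" "V \<in> SO" and Q: "sym_pos_def Q" using assms by (auto simp: polar_decomp_def)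
  have "c * norm (V - U) = c * norm (transpose U ** (V - U))"
    using U by (simp add: norm_SO_mult transpose_SO)
  also have "\<dots> \<le> norm (transpose U ** (B - A) - transpose (B - A) ** V)"
    using sylvester_bound[OF assms(3) Q] polar_sylvester[OF assms(1,2)] by metis
  also have "\<dots> \<le> norm (transpose U ** (B - A)) + norm (transpose (transpose (B - A) ** V))"
    by (simp only: norm_transpose norm_triangle_ineq4)
  also have "\<dots> = 2 * norm (B - A)"
    using U by (simp add: norm_SO_mult transpose_SO matrix_transpose_mul)
  finally show ?thesis .
qed

lemma polar_decomp_unique:
  assumes "polar_decomp A U P" "polar_decomp A V Q" shows "V = U"
proof -
  obtain c where c: "0 < c" "\<And>x. c * (x \<bullet> x) \<le> x \<bullet> (P *v x)"
    using assms(1) posdef_lower_bound unfolding polar_decomp_def sym_pos_def_iff by metis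
  show ?thesis
    using polar_difference_bound[OF assms c(2)] c(1) by (simp add: mult_le_0_iff)
qed

lemma polar_proj_eqI: "polar_decomp A U P \<Longrightarrow> polar_proj A = U"
  unfolding polar_proj_def using polar_decomp_unique by blast

lemma polar_proj_decomp:
  assumes "0 < det A"
  shows "polar_decomp A (polar_proj A) (transpose (polar_proj A) ** A)"
proof -
  obtain U P where UP: "polar_decomp A U P" using polar_decomp_exists[OF assms] by blast
  then have "P = transpose U ** A" by (auto simp: polar_decomp_def SO_cancel)
  then show ?thesis using UP polar_proj_eqI by metis
qed

lemma polar_proj_SO: "0 < det A \<Longrightarrow> polar_proj A \<in> SO"
  using polar_proj_decomp by (auto simp: polar_decomp_def)

lemma polar_decomp_det_pos: "polar_decomp A U P \<Longrightarrow> 0 < det A"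
  by (auto simp: polar_decomp_def det_mul det_SO sym_pos_def_iff posdef_det_pos)

lemma polar_proj_id_SO: "g \<in> SO \<Longrightarrow> polar_decomp g g (mat 1)"
  by (simp add: polar_decomp_def sym_pos_def_def)


section \<open>The tangent map of the polar projection\<close>

text \<open>The limit of \<open>polar_sylvester\<close> as B tends to A: with polar factors U and P,
  the tangent vector D solves P D + D P = U^T E - E^T U.\<close>

definition polar_tangent :: "real^'n^'n \<Rightarrow> real^'n^'n \<Rightarrow> real^'n^'n" where
  "polar_tangent A E =
     sylvester_inv (transpose (polar_proj A) ** A) (Asym (transpose (polar_proj A) ** E))"

lemma polar_tangent_eq:
  assumes "polar_decomp A U P"
  shows "polar_tangent A E = sylvester_inv P (Asym (transpose U ** E))"
proof -
  have "polar_proj A = U" using assms by (rule polar_proj_eqI)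
  moreover have "P = transpose U ** A"
    using assms by (simp add: polar_decomp_def SO_cancel)
  ultimately show ?thesis by (simp add: polar_tangent_def)
qed

lemma linear_polar_tangent:
  assumes "0 < det A" shows "linear (polar_tangent A)"
proof -
  have P: "sym_pos_def (transpose (polar_proj A) ** A)"
    using polar_proj_decomp[OF assms] by (simp add: polar_decomp_def)
  show ?thesis
    by (rule linearI) (simp_all add: polar_tangent_def matmul.add_right scaleR_matrix_mult
        Asym_add Asym_scaleR linear_add[OF linear_sylvester_inv[OF P]]
        linear_scale[OF linear_sylvester_inv[OF P]])
qed

lemma bounded_linear_polar_tangent: "0 < det A \<Longrightarrow> bounded_linear (polar_tangent A)"
  by (simp add: linear_polar_tangent linear_conv_bounded_linear[symmetric])

lemma polar_tangent_skew: "0 < det A \<Longrightarrow> polar_tangent A E \<in> skew"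
  using polar_proj_decomp[of A] unfolding polar_tangent_def polar_decomp_def
  by (simp add: sylvester_inv_skew)

lemma eventually_det_pos:
  assumes "0 < det (A :: real^'n^'n)"
  shows "\<exists>d>0. \<forall>B. norm (B - A) < d \<longrightarrow> 0 < det B"
proof -
  have "open {B :: real^'n^'n. 0 < det B}"
    by (intro open_Collect_less continuous_on_det continuous_intros)
  then show ?thesis
    using assms unfolding open_dist by (auto simp: dist_norm)
qed

text \<open>Subtracting the Sylvester equation of the tangent vector D from the exact equation of Z
  = U^T (V - U) leaves a right-hand side of order d |B - A|. Coercivity of P0 passes this order on
  to Z - D.\<close>

lemma polar_strict_derivative:
  fixes A0 :: "real^'n^'n"
  assumes det0: "0 < det A0" and e: "0 < e"
  shows "\<exists>d>0. \<forall>A B. norm (A - A0) < d \<longrightarrow> norm (B - A0) < d \<longrightarrow> 0 < det A \<and> 0 < det B \<and>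
     norm (polar_proj B - polar_proj A - polar_proj A0 ** polar_tangent A0 (B - A)) \<le> e * norm (B - A)"
proof -
  define U0 where "U0 = polar_proj A0"
  define P0 where "P0 = transpose U0 ** A0"
  have dec0: "polar_decomp A0 U0 P0" using polar_proj_decomp[OF det0] by (simp add: U0_def P0_def)
  then have U0: "U0 \<in> SO" and P0: "sym_pos_def P0" by (auto simp: polar_decomp_def)
  obtain c where c: "0 < c" "\<And>x. c * (x \<bullet> x) \<le> x \<bullet> (P0 *v x)"
    using P0 posdef_lower_bound sym_pos_def_iff by metis
  \<comment> \<open>\<open>K\<close> is the Lipschitz constant of the rotation factor relative to
    A0, \<open>M\<close> that of the symmetric factor, and \<open>C\<close> collects the final
    error.\<close>
  define K where "K = 2 / c"
  define M where "M = 1 + K * norm A0"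
  define C where "C = (2 * K + 8 * M / c) / c + K * (2 / c)"
  have K: "K > 0" and M: "M > 0" using c(1) by (auto simp: K_def M_def intro!: add_pos_nonneg)
  then have C: "C > 0" using c(1) by (auto simp: C_def intro!: add_pos_pos divide_pos_pos)
  obtain d0 where d0: "0 < d0" "\<And>B. norm (B - A0) < d0 \<Longrightarrow> 0 < det B"
    using eventually_det_pos[OF det0] by metis
  \<comment> \<open>M d <= c/4 lets half of the coercivity absorb the change of coefficients; C d <=
    e is the required accuracy.\<close>
  define d where "d = min d0 (min (c / (4 * M)) (e / C))"
  have d: "0 < d" using d0 c M C e by (simp add: d_def)
  have dM: "M * d \<le> c / 4" and dC: "C * d \<le> e"
  proof -
    have "d \<le> c / (4 * M)" "d \<le> e / C" by (simp_all add: d_def)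
    then show "M * d \<le> c / 4" "C * d \<le> e" using M C by (simp_all add: field_simps)
  qed
  have near: "norm (polar_proj A - U0) \<le> K * d \<and> norm (P0 - transpose (polar_proj A) ** A) \<le> M * d"
    if "norm (A - A0) < d" for A
  proof
    let ?U = "polar_proj A"
    have det: "0 < det A" using that d0(2) by (simp add: d_def)
    have "c * norm (?U - U0) \<le> 2 * norm (A - A0)"
      by (rule polar_difference_bound[OF dec0 polar_proj_decomp[OF det] c(2)])
    then have 1: "norm (?U - U0) \<le> K * norm (A - A0)"
      using c(1) by (simp add: K_def field_simps)
    also have "\<dots> \<le> K * d" using that K by simp
    finally show "norm (?U - U0) \<le> K * d" .
    have "P0 - transpose ?U ** A = - (transpose ?U ** (A - A0)) - transpose (?U - U0) ** A0"
      by (simp add: P0_def matmul.diff_left matmul.diff_right transpose_diff)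
    then have "norm (P0 - transpose ?U ** A)
        \<le> norm (transpose ?U ** (A - A0)) + norm (transpose (?U - U0) ** A0)"
      using norm_triangle_ineq4[of "- (transpose ?U ** (A - A0))"] by simp
    also have "norm (transpose (?U - U0) ** A0) \<le> norm (?U - U0) * norm A0"
      using norm_matrix_mult_le[of "transpose (?U - U0)" A0] by simp
    also have "\<dots> \<le> K * norm (A - A0) * norm A0" by (intro mult_right_mono 1) simp
    also have "norm (transpose ?U ** (A - A0)) = norm (A - A0)"
      by (intro norm_SO_mult transpose_SO polar_proj_SO det)
    finally have "norm (P0 - transpose ?U ** A) \<le> M * norm (A - A0)"
      by (simp add: M_def algebra_simps)
    also have "\<dots> \<le> M * d" using that M by simp
    finally show "norm (P0 - transpose ?U ** A) \<le> M * d" .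
  qed
  show ?thesis
  proof (intro exI[of _ d] conjI d allI impI)
    fix A B assume A: "norm (A - A0) < d" and B: "norm (B - A0) < d"
    show detA: "0 < det A" and detB: "0 < det B" using A B d0(2) by (simp_all add: d_def)
    define U P V Q where "U = polar_proj A" and "P = transpose U ** A"
      and "V = polar_proj B" and "Q = transpose V ** B"
    define E Z D where "E = B - A" and "Z = transpose U ** (V - U)" and "D = polar_tangent A0 E"
    have decA: "polar_decomp A U P" and decB: "polar_decomp B V Q"
      using polar_proj_decomp[OF detA] polar_proj_decomp[OF detB] by (simp_all add: U_def V_def P_def Q_def)
    then have U: "U \<in> SO" and V: "V \<in> SO" by (auto simp: polar_decomp_def)
    have bU: "norm (U - U0) \<le> K * d" and bP: "norm (P0 - P) \<le> M * d"
      using near[OF A] by (auto simp: U_def P_def)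
    have bV: "norm (V - U0) \<le> K * d" and bQ: "norm (P0 - Q) \<le> M * d"
      using near[OF B] by (auto simp: V_def Q_def)
    have eqZ: "P ** Z + Z ** Q = transpose U ** E - transpose E ** V"
      unfolding Z_def E_def by (rule polar_sylvester[OF decA decB])
    \<comment> \<open>The error of replacing both coefficients P and Q by P0 in the exact
      equation.\<close>
    define R where "R = (P0 - P) ** Z + Z ** (P0 - Q)"
    have R: "norm R \<le> 2 * M * d * norm Z"
    proof -
      have "norm R \<le> norm (P0 - P) * norm Z + norm Z * norm (P0 - Q)"
        unfolding R_def
        using norm_triangle_ineq[of "(P0 - P) ** Z" "Z ** (P0 - Q)"]
          norm_matrix_mult_le[of "P0 - P" Z] norm_matrix_mult_le[of Z "P0 - Q"] by linarith
      also have "\<dots> \<le> (M * d) * norm Z + norm Z * (M * d)"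
        by (intro add_mono mult_right_mono mult_left_mono bP bQ) auto
      finally show ?thesis by simp
    qed
    have Z0: "P0 ** Z + Z ** P0 = transpose U ** E - transpose E ** V + R"
      unfolding eqZ[symmetric] R_def by (simp add: matmul.diff_left matmul.diff_right)
    have bZ: "norm Z \<le> 4 / c * norm E"
    proof -
      have "c * norm Z \<le> norm (transpose U ** E - transpose E ** V + R)"
        using sylvester_bound[OF c(2) P0, of Z] unfolding Z0 .
      also have "\<dots> \<le> norm (transpose U ** E) + norm (transpose (transpose E ** V)) + norm R"
        unfolding norm_transpose
        using norm_triangle_ineq[of "transpose U ** E - transpose E ** V" R]
          norm_triangle_ineq4[of "transpose U ** E" "transpose E ** V"] by linarith
      also have "\<dots> = 2 * norm E + norm R"
        using U V by (simp add: norm_SO_mult transpose_SO matrix_transpose_mul)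
      also have "\<dots> \<le> 2 * norm E + c / 2 * norm Z"
        using R mult_right_mono[OF dM, of "norm Z"] by simp
      finally show ?thesis using c(1) by (simp add: field_simps)
    qed
    have D0: "P0 ** D + D ** P0 = transpose U0 ** E - transpose E ** U0"
    proof -
      have "sylvester P0 D = Asym (transpose U0 ** E)"
        unfolding D_def polar_tangent_eq[OF dec0] by (rule sylvester_inv(1)[OF P0])
      then show ?thesis by (simp add: sylvester_def Asym_def matrix_transpose_mul)
    qed
    have bD: "norm D \<le> 2 / c * norm E"
    proof -
      have "c * norm D \<le> norm (transpose U0 ** E - transpose E ** U0)"
        using sylvester_bound[OF c(2) P0, of D] unfolding D0 .
      also have "\<dots> \<le> norm (transpose U0 ** E) + norm (transpose (transpose E ** U0))"
        unfolding norm_transpose by (rule norm_triangle_ineq4)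
      also have "\<dots> = 2 * norm E"
        using U0 by (simp add: norm_SO_mult transpose_SO matrix_transpose_mul)
      finally show ?thesis using c(1) by (simp add: field_simps)
    qed
    have bZD: "norm (Z - D) \<le> (2 * K + 8 * M / c) / c * d * norm E"
    proof -
      have "P0 ** (Z - D) + (Z - D) ** P0
          = transpose (U - U0) ** E - transpose E ** (V - U0) + R"
      proof -
        have "P0 ** (Z - D) + (Z - D) ** P0 = (P0 ** Z + Z ** P0) - (P0 ** D + D ** P0)"
          by (simp add: matmul.diff_left matmul.diff_right)
        then show ?thesis
          unfolding Z0 D0 by (simp add: matmul.diff_left matmul.diff_right transpose_diff)
      qed
      then have "c * norm (Z - D) \<le> norm (transpose (U - U0) ** E - transpose E ** (V - U0) + R)"
        using sylvester_bound[OF c(2) P0, of "Z - D"] by simp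
      also have "\<dots> \<le> norm (transpose (U - U0) ** E) + norm (transpose E ** (V - U0)) + norm R"
        using norm_triangle_ineq[of "transpose (U - U0) ** E - transpose E ** (V - U0)" R]
          norm_triangle_ineq4[of "transpose (U - U0) ** E" "transpose E ** (V - U0)"] by linarith
      also have "\<dots> \<le> norm (U - U0) * norm E + norm E * norm (V - U0) + 2 * M * d * norm Z"
        using norm_matrix_mult_le[of "transpose (U - U0)" E] norm_matrix_mult_le[of "transpose E" "V - U0"] R
        by simp
      also have "\<dots> \<le> (K * d) * norm E + norm E * (K * d) + 2 * M * d * (4 / c * norm E)"
        using M d by (intro add_mono mult_right_mono mult_left_mono bU bV bZ) auto
      also have "\<dots> = (2 * K + 8 * M / c) * d * norm E" by (simp add: algebra_simps)
      finally show ?thesis using c(1) by (simp add: field_simps)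
    qed
    \<comment> \<open>Because U Z = V - U, the error splits into Z - D and the change of base point
      from U0 to U.\<close>
    have "V - U - U0 ** D = U ** (Z - D) + (U - U0) ** D"
      using U by (simp add: Z_def matmul.diff_left matmul.diff_right SO_cancel SO_transpose_mult)
    then have "norm (V - U - U0 ** D) \<le> norm (U ** (Z - D)) + norm ((U - U0) ** D)"
      by (simp only: norm_triangle_ineq)
    also have "\<dots> \<le> norm (Z - D) + norm (U - U0) * norm D"
      using U norm_matrix_mult_le by (simp add: norm_SO_mult)
    also have "\<dots> \<le> (2 * K + 8 * M / c) / c * d * norm E + (K * d) * (2 / c * norm E)"
      using K d by (intro add_mono bZD mult_mono bU bD) auto
    also have "\<dots> = C * d * norm E" by (simp add: C_def algebra_simps)
    also have "\<dots> \<le> e * norm E" using dC by (rule mult_right_mono) simp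
    finally show "norm (polar_proj B - polar_proj A - polar_proj A0 ** polar_tangent A0 (B - A))
        \<le> e * norm (B - A)"
      by (simp add: U_def V_def U0_def D_def E_def)
  qed
qed

lemma polar_proj_has_derivative:
  assumes "0 < det A"
  shows "(polar_proj has_derivative (\<lambda>E. polar_proj A ** polar_tangent A E)) (at A)"
  unfolding has_derivative_at_alt
proof (intro conjI allI impI)
  show "bounded_linear (\<lambda>E. polar_proj A ** polar_tangent A E)"
    by (rule bounded_linear_compose[OF matmul.bounded_linear_right bounded_linear_polar_tangent[OF assms]])
  fix e :: real assume "0 < e"
  from polar_strict_derivative[OF assms this] obtain d where "d > 0"
    and d: "\<And>A' B. norm (A' - A) < d \<Longrightarrow> norm (B - A) < d \<Longrightarrow>
      norm (polar_proj B - polar_proj A' - polar_proj A ** polar_tangent A (B - A')) \<le> e * norm (B - A')"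
    by blast
  show "\<exists>d>0. \<forall>y. norm (y - A) < d \<longrightarrow>
      norm (polar_proj y - polar_proj A - polar_proj A ** polar_tangent A (y - A)) \<le> e * norm (y - A)"
  proof (intro exI[of _ d] conjI allI impI \<open>d > 0\<close>)
    fix y assume "norm (y - A) < d"
    then show "norm (polar_proj y - polar_proj A - polar_proj A ** polar_tangent A (y - A)) \<le> e * norm (y - A)"
      using \<open>d > 0\<close> by (intro d) simp_all
  qed
qed

lemma dpolar_eq:
  fixes A :: "real^'n^'n"
  assumes "0 < det A" shows "dpolar A = polar_tangent A"
proof
  fix B :: "real^'n^'n"
  let ?Q = "\<lambda>D. D \<in> skew \<and> (\<forall>\<gamma>. \<gamma> 0 = A \<longrightarrow> (\<gamma> has_vector_derivative B) (at 0) \<longrightarrow>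
        ((\<lambda>t. polar_proj (\<gamma> t)) has_vector_derivative polar_proj A ** D) (at 0))"
  have Q: "?Q (polar_tangent A B)"
  proof (intro conjI allI impI polar_tangent_skew assms)
    fix \<gamma> :: "real \<Rightarrow> real^'n^'n" assume \<gamma>: "\<gamma> 0 = A" "(\<gamma> has_vector_derivative B) (at 0)"
    show "((\<lambda>t. polar_proj (\<gamma> t)) has_vector_derivative polar_proj A ** polar_tangent A B) (at 0)"
      using has_derivative_compose[OF \<gamma>(2)[unfolded has_vector_derivative_def],
          unfolded \<gamma>(1), OF polar_proj_has_derivative[OF assms]]
      by (simp add: has_vector_derivative_def linear_scale[OF linear_polar_tangent[OF assms]]
          scaleR_matrix_mult)
  qed
  show "dpolar A B = polar_tangent A B"
    unfolding dpolar_def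
  proof (rule the_equality[of ?Q, OF Q])
    fix D assume D: "?Q D"
    \<comment> \<open>The straight line A + t B is one of the curves in the definition of
      \<open>dpolar\<close> and already determines D.\<close>
    have \<gamma>: "((\<lambda>t::real. A + t *\<^sub>R B) has_vector_derivative B) (at 0)"
      by (auto intro!: derivative_eq_intros)
    have "((\<lambda>t. polar_proj (A + t *\<^sub>R B)) has_vector_derivative polar_proj A ** D) (at 0)"
      "((\<lambda>t. polar_proj (A + t *\<^sub>R B)) has_vector_derivative polar_proj A ** polar_tangent A B) (at 0)"
      using D Q \<gamma> by auto
    then have "polar_proj A ** D = polar_proj A ** polar_tangent A B"
      by (rule vector_derivative_unique_at)
    then show "D = polar_tangent A B"
      by (metis SO_cancel(1) polar_proj_SO assms)
  qed
qed

section \<open>The adjoint of the tangent map\<close>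

lemma adjoint_on_eqI:
  assumes "x \<in> V" "\<And>v. v \<in> V \<Longrightarrow> ipV x v = ipW w (f v)"
    and "\<And>y. y \<in> V \<Longrightarrow> (\<And>v. v \<in> V \<Longrightarrow> ipV y v = ipV x v) \<Longrightarrow> y = x"
  shows "adjoint_on V ipV ipW f w = x"
  unfolding adjoint_on_def
proof (rule the_equality)
  show "x \<in> V \<and> (\<forall>v\<in>V. ipV x v = ipW w (f v))" using assms(1,2) by blast
  fix y assume y: "y \<in> V \<and> (\<forall>v\<in>V. ipV y v = ipW w (f v))"
  then have "ipV y v = ipV x v" if "v \<in> V" for v using assms(2)[OF that] that by simp
  then show "y = x" using y by (intro assms(3)) simp_all
qed

text \<open>The tangent map composes multiplication by U^T, \<open>Asym\<close> and the inverse
  Sylvester operator. The last is self-adjoint since P is symmetric, so the adjoint reads the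
  factors backwards; the factor 2 from \<open>Asym\<close> cancels the half in
  \<open>skew_inner\<close>.\<close>

lemma polar_adjoint_inner:
  assumes "polar_decomp A U P" "S \<in> skew"
  shows "(U ** sylvester_inv P S) \<bullet> B = skew_inner S (dpolar A B)"
proof -
  have P: "sym_pos_def P" using assms(1) by (simp add: polar_decomp_def)
  define X where "X = sylvester_inv P S"
  have X: "X \<in> skew" "S = sylvester P X"
    using assms P by (simp_all add: X_def sylvester_inv_skew sylvester_inv)
  have "S \<bullet> polar_tangent A B = X \<bullet> Asym (transpose U ** B)"
    using P unfolding X(2) polar_tangent_eq[OF assms(1)]
    by (subst sylvester_self_adjoint) (simp_all add: sym_pos_def_def sylvester_inv)
  also have "\<dots> = 2 * (X \<bullet> (transpose U ** B))"
    using skew_inner_Asym[OF X(1), of "transpose U ** B"] by (simp add: skew_inner_eq inner_commute)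
  finally show ?thesis
    by (simp add: dpolar_eq polar_decomp_det_pos[OF assms(1)] skew_inner_eq inner_mult_left
        flip: X_def)
qed

lemma dpolar_adj_eq:
  assumes "polar_decomp A U P" "S \<in> skew"
  shows "dpolar_adj A S = U ** sylvester_inv P S"
  unfolding dpolar_adj_def
proof (rule adjoint_on_eqI)
  fix Y assume "\<And>B. B \<in> UNIV \<Longrightarrow> mat_inner Y B = mat_inner (U ** sylvester_inv P S) B"
  then show "Y = U ** sylvester_inv P S"
    by (metis UNIV_I mat_inner_eq vector_eq_rdot)
qed (simp_all add: mat_inner_eq polar_adjoint_inner[OF assms])

lemma inner_dpolar_adj:
  assumes "0 < det A" "S \<in> skew"
  shows "dpolar_adj A S \<bullet> B = skew_inner S (dpolar A B)"
  using dpolar_adj_eq[OF polar_proj_decomp[OF assms(1)] assms(2)]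
    polar_adjoint_inner[OF polar_proj_decomp[OF assms(1)] assms(2)] by simp


section \<open>Gradients\<close>

text \<open>Within a subspace the difference quotient only sees directions of the subspace.
  \<open>has_skew_gradient\<close> asks for the functional \<open>skew_inner D\<close> on all
  matrices, whereas the derivatives computed later agree with it on skew directions.\<close>

lemma has_derivative_within_subspace_cong:
  assumes "subspace V" "x \<in> V" "(f has_derivative f') (at x within V)"
    and "bounded_linear g'" "\<And>v. v \<in> V \<Longrightarrow> g' v = f' v"
  shows "(f has_derivative g') (at x within V)"
proof -
  have "((\<lambda>y. (1 / norm (y - x)) *\<^sub>R (f y - (f x + g' (y - x)))) \<longlongrightarrow> 0) (at x within V)"
  proof (rule Lim_transform_within[where d = 1])
    show "((\<lambda>y. (1 / norm (y - x)) *\<^sub>R (f y - (f x + f' (y - x)))) \<longlongrightarrow> 0) (at x within V)"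
      using assms(3) by (simp add: has_derivative_within)
  qed (use assms(5) subspace_diff[OF assms(1) _ assms(2)] in auto)
  then show ?thesis using assms(4) by (simp add: has_derivative_within)
qed

text \<open>A Riesz representative on all matrices becomes skew under \<open>Asym\<close>; by
  \<open>skew_inner_Asym\<close> the functional on \<open>skew\<close> stays the same.\<close>

lemma skew_representation:
  fixes f :: "real^'n^'n \<Rightarrow> real"
  assumes "linear f"
  obtains D where "D \<in> skew" "\<And>v. v \<in> skew \<Longrightarrow> f v = skew_inner D v"
proof
  define E where "E = (\<Sum>b\<in>Basis. f b *\<^sub>R b)"
  show "Asym E \<in> skew" by simp
  fix v :: "real^'n^'n" assume v: "v \<in> skew"
  have "f v = f (\<Sum>b\<in>Basis. (v \<bullet> b) *\<^sub>R b)" by (simp add: euclidean_representation)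
  also have "\<dots> = E \<bullet> v"
    by (simp add: E_def linear_sum[OF assms] linear_scale[OF assms] inner_sum_left inner_commute[of v] mult.commute)
  finally show "f v = skew_inner (Asym E) v" by (simp add: skew_inner_Asym[OF v])
qed

text \<open>A derivative within \<open>skew\<close> is not unique as a map on all matrices, so the
  gradients are compared along lines x + t Z inside \<open>skew\<close>.\<close>

lemma has_skew_gradient_unique:
  fixes f :: "real^'n^'n \<Rightarrow> real"
  assumes x: "x \<in> skew" and D: "has_skew_gradient f D x" and E: "has_skew_gradient f E x"
  shows "D = E"
proof (rule skew_inner_nondegenerate)
  fix Z :: "real^'n^'n" assume Z: "Z \<in> skew"
  have line: "range (\<lambda>t::real. x + t *\<^sub>R Z) \<subseteq> skew"
    using x Z by (auto intro: skew_add skew_scaleR)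
  have d: "((\<lambda>t::real. x + t *\<^sub>R Z) has_derivative (\<lambda>t. t *\<^sub>R Z)) (at 0)"
    by (auto intro!: derivative_eq_intros)
  have *: "((\<lambda>t. f (x + t *\<^sub>R Z)) has_derivative (\<lambda>t. skew_inner F (t *\<^sub>R Z))) (at 0)"
    if "has_skew_gradient f F x" for F
  proof (rule has_derivative_in_compose[OF d])
    show "(f has_derivative skew_inner F) (at (x + 0 *\<^sub>R Z) within range (\<lambda>t. x + t *\<^sub>R Z))"
      using that has_derivative_subset[OF _ line, of f "skew_inner F" x]
      by (simp add: has_skew_gradient_def)
  qed
  show "skew_inner D Z = skew_inner E Z"
    using fun_cong[OF has_derivative_unique[OF *[OF D] *[OF E]], of 1] by simp
qed (use D E in \<open>auto simp: has_skew_gradient_def\<close>)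

lemma has_skew_gradient_iff:
  assumes "x \<in> skew" "has_skew_gradient f D x"
  shows "has_skew_gradient f E x \<longleftrightarrow> E = D"
proof
  show "E = D" if "has_skew_gradient f E x"
    by (rule has_skew_gradient_unique[OF assms(1) that assms(2)])
qed (simp add: assms(2))

lemma skew_gradient_eq: "x \<in> skew \<Longrightarrow> has_skew_gradient f D x \<Longrightarrow> skew_gradient f x = D"
  unfolding skew_gradient_def using has_skew_gradient_unique by (intro the_equality)

text \<open>Shows that \<open>has_lt_gradient\<close> is vacuous in no direction. The curve is the
  line g + t g \<eta> pulled back by \<open>polar_proj\<close>, in the role of the matrix
  exponential.\<close>

lemma SO_curve_exists:
  fixes g :: "real^'n^'n"
  assumes g: "g \<in> SO" and \<eta>: "\<eta> \<in> skew"
  obtains \<gamma> :: "real \<Rightarrow> real^'n^'n"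
    where "\<And>t. \<gamma> t \<in> SO" "\<gamma> 0 = g" "(\<gamma> has_vector_derivative g ** \<eta>) (at 0)"
proof -
  define A where "A t = g + t *\<^sub>R (g ** \<eta>)" for t :: real
  \<comment> \<open>The default g keeps the curve in \<open>SO\<close> at all times; near t = 0 the
    determinant is positive and the default does not occur.\<close>
  define \<gamma> where "\<gamma> t = (if 0 < det (A t) then polar_proj (A t) else g)" for t
  have det: "0 < det g" using g by (simp add: det_SO)
  have dec: "polar_decomp g g (mat 1)" using g by (rule polar_proj_id_SO)
  have pg: "polar_proj g = g" by (rule polar_proj_eqI[OF dec])
  \<comment> \<open>At a rotation the symmetric factor is the identity, so the Sylvester operator
    and \<open>Asym\<close> both double a skew matrix.\<close>
  have tan: "polar_tangent g (g ** \<eta>) = \<eta>"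
  proof -
    have "Asym \<eta> = sylvester (mat 1) \<eta>"
      using Asym_on_skew[OF \<eta>] by (simp add: sylvester_def scaleR_2)
    then show ?thesis
      using dec g by (simp add: polar_tangent_eq[OF dec] SO_cancel sylvester_inv polar_decomp_def)
  qed
  have "((\<lambda>t. polar_proj (A t)) has_derivative (\<lambda>t. t *\<^sub>R (g ** \<eta>))) (at 0)"
  proof -
    have "(A has_derivative (\<lambda>t. t *\<^sub>R (g ** \<eta>))) (at 0)"
      unfolding A_def by (auto intro!: derivative_eq_intros)
    then have "((\<lambda>t. polar_proj (A t)) has_derivative (\<lambda>t. g ** polar_tangent g (t *\<^sub>R (g ** \<eta>)))) (at 0)"
      using polar_proj_has_derivative[OF det] has_derivative_compose[of A _ 0 UNIV polar_proj]
      by (simp add: A_def pg)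
    then show ?thesis
      by (simp add: linear_scale[OF linear_polar_tangent[OF det]] tan scaleR_matrix_mult)
  qed
  moreover obtain d where d: "d > 0" "\<And>B. norm (B - g) < d \<Longrightarrow> 0 < det B"
    using eventually_det_pos[OF det] by metis
  have "\<forall>\<^sub>F t in at 0. polar_proj (A t) = \<gamma> t"
  proof -
    have "isCont A 0" unfolding A_def by (intro continuous_intros)
    then have "\<forall>\<^sub>F t in at 0. dist (A t) (A 0) < d"
      using d(1) tendstoD isContD by blast
    then show ?thesis
      by eventually_elim (use d(2) in \<open>simp add: \<gamma>_def A_def dist_norm\<close>)
  qed
  ultimately have "(\<gamma> has_derivative (\<lambda>t. t *\<^sub>R (g ** \<eta>))) (at 0)"
    by (rule has_derivative_transform_eventually) (simp_all add: \<gamma>_def A_def det)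
  then show ?thesis
    using g by (intro that[of \<gamma>])
      (auto simp: \<gamma>_def A_def pg polar_proj_SO has_vector_derivative_def)
qed

lemma has_lt_gradient_unique:
  fixes g :: "real^'n^'n"
  assumes "g \<in> SO" "has_lt_gradient f D g" "has_lt_gradient f E g"
  shows "D = E"
proof (rule skew_inner_nondegenerate)
  fix \<eta> :: "real^'n^'n" assume \<eta>: "\<eta> \<in> skew"
  obtain \<gamma> :: "real \<Rightarrow> real^'n^'n" where "\<And>t. \<gamma> t \<in> SO" "\<gamma> 0 = g" "(\<gamma> has_vector_derivative g ** \<eta>) (at 0)"
    using SO_curve_exists[OF assms(1) \<eta>] by blast
  then have "((\<lambda>t. f (\<gamma> t)) has_real_derivative skew_inner D \<eta>) (at 0)"
    "((\<lambda>t. f (\<gamma> t)) has_real_derivative skew_inner E \<eta>) (at 0)"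
    using assms \<eta> unfolding has_lt_gradient_def by blast+
  then show "skew_inner D \<eta> = skew_inner E \<eta>" by (rule DERIV_unique)
qed (use assms in \<open>auto simp: has_lt_gradient_def\<close>)

lemma has_lt_gradient_iff:
  assumes "g \<in> SO" "has_lt_gradient f D g"
  shows "has_lt_gradient f E g \<longleftrightarrow> E = D"
proof
  show "E = D" if "has_lt_gradient f E g"
    by (rule has_lt_gradient_unique[OF assms(1) that assms(2)])
qed (simp add: assms(2))

lemma lt_gradient_eq: "g \<in> SO \<Longrightarrow> has_lt_gradient f D g \<Longrightarrow> lt_gradient f g = D"
  unfolding lt_gradient_def using has_lt_gradient_unique by (intro the_equality)

text \<open>Near a point of \<open>SO \<times> skew\<close> a smooth function is the restriction of a differentiable function
  \<open>F\<close> on the ambient space, so that every chain rule goes through the derivative of \<open>F\<close>.\<close>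
lemma smooth_chain_rule:
  fixes L :: "real^'n^'n \<Rightarrow> real^'n^'n \<Rightarrow> real"
  assumes "smooth_on (SO \<times> skew) (\<lambda>(U, \<Omega>). L U \<Omega>)" "U \<in> SO" "W \<in> skew"
  obtains l :: "(real^'n^'n) \<times> (real^'n^'n) \<Rightarrow> real" where "bounded_linear l"
    "lt_gradient (\<lambda>Q. L Q W) U \<in> skew" "skew_gradient (L U) W \<in> skew"
    "\<And>X Y. X \<in> skew \<Longrightarrow> Y \<in> skew \<Longrightarrow>
       l (U ** X, Y) = skew_inner (lt_gradient (\<lambda>Q. L Q W) U) X + skew_inner (skew_gradient (L U) W) Y"
    "\<And>(u :: 'p::real_normed_vector \<Rightarrow> real^'n^'n) u' w w' p0 S. p0 \<in> S \<Longrightarrow> u p0 = U \<Longrightarrow> w p0 = W \<Longrightarrow>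
       (u has_derivative u') (at p0 within S) \<Longrightarrow> (w has_derivative w') (at p0 within S) \<Longrightarrow>
       (\<forall>\<^sub>F p in at p0 within S. u p \<in> SO \<and> w p \<in> skew) \<Longrightarrow>
       ((\<lambda>p. L (u p) (w p)) has_derivative (\<lambda>v. l (u' v, w' v))) (at p0 within S)"
proof -
  obtain T F where T: "open T" "(U, W) \<in> T" "\<And>k. Ck_on k T F"
    and F: "\<And>y. y \<in> (SO \<times> skew) \<inter> T \<Longrightarrow> F y = (case y of (U, \<Omega>) \<Rightarrow> L U \<Omega>)"
    using assms unfolding smooth_on_def by (metis mem_Sigma_iff)
  obtain l where l: "(F has_derivative l) (at (U, W))"
    using T(2) T(3)[of "Suc 0"] by (auto simp: differentiable_def)
  have FL: "F (U, W) = L U W" using F T(2) assms by simp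
  \<comment> \<open>The parameter space stays arbitrary: the rule is applied to curves for the
    rotation argument, to \<open>skew\<close> for the other argument, and is itself the last clause
    of the result.\<close>
  have chain: "((\<lambda>p. L (u p) (w p)) has_derivative (\<lambda>v. l (u' v, w' v))) (at p0 within S)"
    if p0: "p0 \<in> S" "u p0 = U" "w p0 = W"
      and d: "(u has_derivative u') (at p0 within S)" "(w has_derivative w') (at p0 within S)"
      and ev: "\<forall>\<^sub>F p in at p0 within S. u p \<in> SO \<and> w p \<in> skew"
    for u :: "'q::real_normed_vector \<Rightarrow> real^'n^'n" and u' w w' p0 S
  proof (rule has_derivative_transform_eventually)
    have dp: "((\<lambda>p. (u p, w p)) has_derivative (\<lambda>v. (u' v, w' v))) (at p0 within S)"
      by (rule has_derivative_Pair[OF d])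
    show "((\<lambda>p. F (u p, w p)) has_derivative (\<lambda>v. l (u' v, w' v))) (at p0 within S)"
      using has_derivative_compose[OF dp, of F l] l p0 by simp
    have "((\<lambda>p. (u p, w p)) \<longlongrightarrow> (U, W)) (at p0 within S)"
      using has_derivative_continuous[OF dp] p0 by (simp add: continuous_within)
    then have "\<forall>\<^sub>F p in at p0 within S. (u p, w p) \<in> T"
      using T(1,2) by (rule topological_tendstoD)
    with ev show "\<forall>\<^sub>F p in at p0 within S. F (u p, w p) = L (u p) (w p)"
      by eventually_elim (simp add: F)
    show "F (u p0, w p0) = L (u p0) (w p0)" "p0 \<in> S" by (simp_all add: p0 FL)
  qed
  have bl: "bounded_linear l" using l by (rule has_derivative_bounded_linear)
  \<comment> \<open>The two partial functionals of l are represented by skew matrices, which are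
    identified below with the two gradients of L.\<close>
  have "linear (\<lambda>v. l (U ** v, 0))"
    by (intro bounded_linear.linear bounded_linear_compose[OF bl] bounded_linear_Pair
        matmul.bounded_linear_right bounded_linear_zero)
  then obtain D1 where D1: "D1 \<in> skew" "\<And>v. v \<in> skew \<Longrightarrow> l (U ** v, 0) = skew_inner D1 v"
    using skew_representation by blast
  have "linear (\<lambda>v. l (0, v))"
    by (intro bounded_linear.linear bounded_linear_compose[OF bl] bounded_linear_Pair
        bounded_linear_ident bounded_linear_zero)
  then obtain D2 where D2: "D2 \<in> skew" "\<And>v. v \<in> skew \<Longrightarrow> l (0, v) = skew_inner D2 v"
    using skew_representation by blast
  have "has_lt_gradient (\<lambda>Q. L Q W) D1 U"
    unfolding has_lt_gradient_def
  proof (intro conjI allI impI D1)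
    fix \<gamma> :: "real \<Rightarrow> real^'n^'n" and \<eta> assume \<gamma>: "\<eta> \<in> skew" "\<forall>t. \<gamma> t \<in> SO" "\<gamma> 0 = U"
      "(\<gamma> has_vector_derivative U ** \<eta>) (at 0)"
    have "((\<lambda>p. L (\<gamma> p) W) has_derivative (\<lambda>v. l (v *\<^sub>R (U ** \<eta>), 0))) (at 0)"
      using \<gamma> assms by (intro chain) (auto simp: has_vector_derivative_def)
    moreover have "(\<lambda>v. l (v *\<^sub>R (U ** \<eta>), 0)) = (*) (skew_inner D1 \<eta>)"
    proof
      fix v show "l (v *\<^sub>R (U ** \<eta>), 0) = skew_inner D1 \<eta> * v"
        using linear_scale[OF bounded_linear.linear[OF bl], of v "(U ** \<eta>, 0)"] D1(2)[OF \<gamma>(1)] by simp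
    qed
    ultimately show "((\<lambda>t. L (\<gamma> t) W) has_real_derivative skew_inner D1 \<eta>) (at 0)"
      by (simp only: has_field_derivative_def)
  qed
  then have g1: "lt_gradient (\<lambda>Q. L Q W) U = D1" by (rule lt_gradient_eq[OF assms(2)])
  have "has_skew_gradient (L U) D2 W"
    unfolding has_skew_gradient_def
  proof (intro conjI D2)
    have "((\<lambda>p. L U p) has_derivative (\<lambda>v. l (0, v))) (at W within skew)"
    proof (rule chain)
      show "\<forall>\<^sub>F p in at W within skew. U \<in> SO \<and> p \<in> skew"
        using assms(2) by (simp add: eventually_at_filter)
    qed (use assms(3) in simp_all)
    then show "(L U has_derivative skew_inner D2) (at W within skew)"
      by (rule has_derivative_within_subspace_cong[OF subspace_skew assms(3)])
        (simp_all add: D2 skew_inner.bounded_linear_right)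
  qed
  then have g2: "skew_gradient (L U) W = D2" by (rule skew_gradient_eq[OF assms(3)])
  show ?thesis
  proof (rule that[OF bl D1(1)[folded g1] D2(1)[folded g2]])
    fix X Y :: "real^'n^'n" assume "X \<in> skew" "Y \<in> skew"
    then show "l (U ** X, Y) = skew_inner (lt_gradient (\<lambda>Q. L Q W) U) X + skew_inner (skew_gradient (L U) W) Y"
      unfolding g1 g2
      using linear_add[OF bounded_linear.linear[OF bl], of "(U ** X, 0)" "(0, Y)"] D1(2) D2(2) by simp
  qed (rule chain)
qed


section \<open>The linearized stage equations\<close>

locale internal_stages =
  fixes s :: nat and h :: real and a :: "nat \<Rightarrow> nat \<Rightarrow> real"
    and g0 :: "real^'n^'n" and \<Omega> U :: "nat \<Rightarrow> real^'n^'n"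
  assumes g0: "g0 \<in> SO" and \<Omega>: "\<Omega> \<in> skew_pow s"
    and U_SO: "\<And>i. i \<in> {1..s} \<Longrightarrow> U i \<in> SO"
    and det_stage: "\<And>i. i \<in> {1..s} \<Longrightarrow> 0 < det (stage_mat s h a g0 \<Omega> U i)"
    and U_eq: "\<And>i. i \<in> {1..s} \<Longrightarrow> U i = polar_proj (stage_mat s h a g0 \<Omega> U i)"
    and phi_bij: "bij_betw (phi_map s h a g0 \<Omega> U) (skew_pow s) (skew_pow s)"
begin

definition I :: "nat set" where "I = {1..s}"

lemma finite_I [simp]: "finite I" by (simp add: I_def)

definition A :: "nat \<Rightarrow> real^'n^'n" where "A = stage_mat s h a g0 \<Omega> U"

text \<open>\<open>K\<close> is \<open>phi_map\<close> without the restriction to \<open>{1..s}\<close>, and \<open>R\<close> is its inverse, meaningful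
  for tuples of skew matrices only.\<close>

definition K :: "(nat \<Rightarrow> real^'n^'n) \<Rightarrow> nat \<Rightarrow> real^'n^'n" where
  "K X i = X i - dpolar (A i) (h *\<^sub>R (\<Sum>j\<in>I. a i j *\<^sub>R (U j ** X j ** \<Omega> j)))"

definition R :: "(nat \<Rightarrow> real^'n^'n) \<Rightarrow> nat \<Rightarrow> real^'n^'n" where
  "R Z = phi_inv s h a g0 \<Omega> U (restrict Z I)"

definition \<iota> :: "nat \<Rightarrow> real^'n^'n \<Rightarrow> nat \<Rightarrow> real^'n^'n" where
  "\<iota> j Y = (\<lambda>l. if l = j then Y else 0)"

lemma det_A: "i \<in> I \<Longrightarrow> 0 < det (A i)"
  using det_stage by (simp add: A_def I_def)

lemma \<Omega>_skew: "i \<in> I \<Longrightarrow> \<Omega> i \<in> skew"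
  using \<Omega> by (auto simp: skew_pow_def I_def)

lemma bounded_linear_dpolar: "i \<in> I \<Longrightarrow> bounded_linear (dpolar (A i))"
  using bounded_linear_polar_tangent[OF det_A] dpolar_eq[OF det_A] by simp

lemma dpolar_skew: "i \<in> I \<Longrightarrow> dpolar (A i) B \<in> skew"
  using polar_tangent_skew[OF det_A] dpolar_eq[OF det_A] by simp

lemma phi_map_eq: "phi_map s h a g0 \<Omega> U X = restrict (K X) I"
  by (simp add: phi_map_def K_def A_def restrict_def I_def fun_eq_iff)

lemma K_cong:
  assumes "\<And>i. i \<in> I \<Longrightarrow> X i = Y i" "i \<in> I"
  shows "K X i = K Y i"
  using assms by (simp add: K_def cong: sum.cong)

lemma K_skew: "(\<And>i. i \<in> I \<Longrightarrow> X i \<in> skew) \<Longrightarrow> i \<in> I \<Longrightarrow> K X i \<in> skew"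
  by (simp add: K_def dpolar_skew skew_diff)

lemma skew_pow_I: "skew_pow s = (\<Pi>\<^sub>E i\<in>I. skew)"
  by (simp add: skew_pow_def I_def)

lemma restrict_skew_pow: "(\<And>i. i \<in> I \<Longrightarrow> X i \<in> skew) \<Longrightarrow> restrict X I \<in> skew_pow s"
  by (auto simp: skew_pow_I)

lemma R_in: "(\<And>i. i \<in> I \<Longrightarrow> Z i \<in> skew) \<Longrightarrow> R Z \<in> skew_pow s"
  unfolding R_def
  by (intro inv_into_into) (use phi_bij restrict_skew_pow in \<open>auto simp: bij_betw_def\<close>)

lemma R_skew: "(\<And>i. i \<in> I \<Longrightarrow> Z i \<in> skew) \<Longrightarrow> i \<in> I \<Longrightarrow> R Z i \<in> skew"
  using R_in[of Z] by (auto simp: skew_pow_I)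

lemma K_R:
  assumes "\<And>i. i \<in> I \<Longrightarrow> Z i \<in> skew" "i \<in> I"
  shows "K (R Z) i = Z i"
proof -
  have "restrict Z I \<in> phi_map s h a g0 \<Omega> U ` skew_pow s"
    using restrict_skew_pow[OF assms(1)] phi_bij by (simp add: bij_betw_def)
  then have "restrict (K (R Z)) I = restrict Z I"
    unfolding R_def phi_map_eq[symmetric] by (rule f_inv_into_f)
  then show ?thesis using assms(2) by (metis restrict_apply')
qed

text \<open>The algebra of \<open>R\<close> goes through this lemma: \<open>K\<close> is given by a
  visibly linear formula, whereas \<open>R\<close> is an \<open>inv_into\<close> on tuples padded
  with \<open>undefined\<close>.\<close>

lemma R_unique:
  assumes "\<And>i. i \<in> I \<Longrightarrow> Z i \<in> skew" "\<And>i. i \<in> I \<Longrightarrow> X i \<in> skew"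
    "\<And>i. i \<in> I \<Longrightarrow> K X i = Z i" "i \<in> I"
  shows "R Z i = X i"
proof -
  have "phi_map s h a g0 \<Omega> U (restrict X I) = phi_map s h a g0 \<Omega> U (R Z)"
    unfolding phi_map_eq
  proof (rule restrict_ext)
    fix i assume i: "i \<in> I"
    have "K (restrict X I) i = K X i" using i by (intro K_cong) auto
    then show "K (restrict X I) i = K (R Z) i" using K_R[OF assms(1) i] assms(3)[OF i] by simp
  qed
  then have "restrict X I = R Z"
    by (rule inj_onD[OF bij_betw_imp_inj_on[OF phi_bij] _ restrict_skew_pow[OF assms(2)] R_in[OF assms(1)]])
  then show ?thesis using assms(4) by (metis restrict_apply')
qed

lemma K_add: "i \<in> I \<Longrightarrow> K (\<lambda>i. X i + Y i) i = K X i + K Y i"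
  unfolding K_def
  by (simp add: matmul.add_left matmul.add_right scaleR_add_right sum.distrib
      linear_add[OF bounded_linear.linear[OF bounded_linear_dpolar]])

lemma K_scaleR: "i \<in> I \<Longrightarrow> K (\<lambda>i. c *\<^sub>R X i) i = c *\<^sub>R K X i"
proof -
  assume i: "i \<in> I"
  have "h *\<^sub>R (\<Sum>j\<in>I. a i j *\<^sub>R (U j ** (c *\<^sub>R X j) ** \<Omega> j))
      = c *\<^sub>R (h *\<^sub>R (\<Sum>j\<in>I. a i j *\<^sub>R (U j ** X j ** \<Omega> j)))"
    by (simp add: scaleR_matrix_mult scaleR_sum_right ac_simps)
  then show ?thesis
    by (simp add: K_def scaleR_diff_right linear_scale[OF bounded_linear.linear[OF bounded_linear_dpolar[OF i]]])
qed

lemma K_0: "i \<in> I \<Longrightarrow> K (\<lambda>i. 0) i = 0"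
  using K_scaleR[of i 0 "\<lambda>i. 0"] by simp

lemma K_sum:
  assumes "finite J" "i \<in> I"
  shows "K (\<lambda>i. \<Sum>j\<in>J. X j i) i = (\<Sum>j\<in>J. K (X j) i)"
  using assms by (induction J rule: finite_induct) (simp_all add: K_0 K_add)

lemma R_add:
  assumes "\<And>i. i \<in> I \<Longrightarrow> Y i \<in> skew" "\<And>i. i \<in> I \<Longrightarrow> Z i \<in> skew" "i \<in> I"
  shows "R (\<lambda>i. Y i + Z i) i = R Y i + R Z i"
  using assms by (intro R_unique) (simp_all add: K_add K_R R_skew skew_add)

lemma R_scaleR:
  assumes "\<And>i. i \<in> I \<Longrightarrow> Z i \<in> skew" "i \<in> I"
  shows "R (\<lambda>i. c *\<^sub>R Z i) i = c *\<^sub>R R Z i"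
  using assms by (intro R_unique) (simp_all add: K_scaleR K_R R_skew skew_scaleR)

lemma \<iota>_skew: "Y \<in> skew \<Longrightarrow> \<iota> j Y i \<in> skew"
  by (simp add: \<iota>_def)

lemma R_decompose:
  assumes Z: "\<And>i. i \<in> I \<Longrightarrow> Z i \<in> skew" and i: "i \<in> I"
  shows "R Z i = (\<Sum>j\<in>I. R (\<iota> j (Z j)) i)"
proof (rule R_unique[OF Z _ _ i])
  fix i assume i: "i \<in> I"
  show "(\<Sum>j\<in>I. R (\<iota> j (Z j)) i) \<in> skew"
    using i Z by (intro skew_sum R_skew \<iota>_skew)
  have "K (\<lambda>i. \<Sum>j\<in>I. R (\<iota> j (Z j)) i) i = (\<Sum>j\<in>I. K (R (\<iota> j (Z j))) i)"
    using i by (simp add: K_sum)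
  also have "\<dots> = (\<Sum>j\<in>I. \<iota> j (Z j) i)"
    using i Z by (intro sum.cong refl K_R \<iota>_skew)
  also have "\<dots> = Z i" using i by (simp add: \<iota>_def)
  finally show "K (\<lambda>i. \<Sum>j\<in>I. R (\<iota> j (Z j)) i) i = Z i" .
qed

text \<open>\<open>R\<close> is linear on skew tuples only. Inserting \<open>Asym\<close> extends
  each slot to a linear map on all matrices, at the cost of a factor 2 on skew arguments that is
  undone where the lemma is applied.\<close>

lemma linear_R_\<iota>:
  assumes "i \<in> I" shows "linear (\<lambda>Y. R (\<iota> j (Asym Y)) i)"
proof (rule linearI)
  show "R (\<iota> j (Asym (X + Y))) i = R (\<iota> j (Asym X)) i + R (\<iota> j (Asym Y)) i" for X Y
  proof -
    have "\<iota> j (Asym (X + Y)) = (\<lambda>l. \<iota> j (Asym X) l + \<iota> j (Asym Y) l)"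
      by (auto simp: \<iota>_def Asym_add)
    then show ?thesis using assms by (simp add: R_add \<iota>_skew)
  qed
  show "R (\<iota> j (Asym (c *\<^sub>R Y))) i = c *\<^sub>R R (\<iota> j (Asym Y)) i" for c Y
  proof -
    have "\<iota> j (Asym (c *\<^sub>R Y)) = (\<lambda>l. c *\<^sub>R \<iota> j (Asym Y) l)"
      by (auto simp: \<iota>_def Asym_scaleR)
    then show ?thesis using assms by (simp add: R_scaleR \<iota>_skew)
  qed
qed

lemma bounded_linear_R:
  fixes Z :: "'v::real_normed_vector \<Rightarrow> nat \<Rightarrow> real^'n^'n"
  assumes "\<And>l. l \<in> I \<Longrightarrow> bounded_linear (\<lambda>v. Z v l)" "\<And>l v. l \<in> I \<Longrightarrow> Z v l \<in> skew"
    and i: "i \<in> I"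
  shows "bounded_linear (\<lambda>v. R (Z v) i)"
proof -
  \<comment> \<open>The factor 1/2 compensates the doubling by \<open>Asym\<close> on skew
    matrices.\<close>
  have "R (Z v) i = (\<Sum>j\<in>I. R (\<iota> j (Asym ((1/2) *\<^sub>R Z v j))) i)" for v
    using R_decompose[OF assms(2) i] by (simp add: Asym_scaleR Asym_on_skew assms(2))
  moreover have "bounded_linear (\<lambda>v. \<Sum>j\<in>I. R (\<iota> j (Asym ((1/2) *\<^sub>R Z v j))) i)"
  proof (rule bounded_linear_sum)
    fix j assume "j \<in> I"
    then have "bounded_linear (\<lambda>v. (1/2) *\<^sub>R Z v j)" using assms(1) by (intro bounded_linear_const_scaleR)
    moreover have "bounded_linear (\<lambda>Y. R (\<iota> j (Asym Y)) i)"
      using linear_R_\<iota>[OF i] by (simp add: linear_conv_bounded_linear)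
    ultimately show "bounded_linear (\<lambda>v. R (\<iota> j (Asym ((1/2) *\<^sub>R Z v j))) i)"
      using bounded_linear_compose by blast
  qed
  ultimately show ?thesis by simp
qed


section \<open>Adjoints\<close>

definition K_adj :: "(nat \<Rightarrow> real^'n^'n) \<Rightarrow> nat \<Rightarrow> real^'n^'n" where
  "K_adj T j = T j - Asym (h *\<^sub>R (transpose (U j) **
     (\<Sum>l\<in>I. a l j *\<^sub>R dpolar_adj (A l) (T l)) ** transpose (\<Omega> j)))"

lemma K_adj_skew: "T j \<in> skew \<Longrightarrow> K_adj T j \<in> skew"
  by (simp add: K_adj_def skew_diff)

text \<open>After each \<open>dpolar\<close> is moved across by its adjoint, swapping the two sums
  over stages turns sums along rows of \<open>a\<close> into sums along columns: hence the
  transposed coefficients in the linear system of the theorem.\<close>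

lemma K_adjoint:
  assumes T: "\<And>i. i \<in> I \<Longrightarrow> T i \<in> skew" and X: "\<And>i. i \<in> I \<Longrightarrow> X i \<in> skew"
  shows "(\<Sum>j\<in>I. skew_inner (T j) (K X j)) = (\<Sum>j\<in>I. skew_inner (K_adj T j) (X j))"
proof -
  define q where "q l = dpolar_adj (A l) (T l)" for l
  have "(\<Sum>l\<in>I. skew_inner (T l) (dpolar (A l) (h *\<^sub>R (\<Sum>j\<in>I. a l j *\<^sub>R (U j ** X j ** \<Omega> j)))))
      = (\<Sum>l\<in>I. q l \<bullet> (h *\<^sub>R (\<Sum>j\<in>I. a l j *\<^sub>R (U j ** X j ** \<Omega> j))))"
    by (intro sum.cong refl) (simp only: q_def inner_dpolar_adj[OF det_A T])
  also have "\<dots> = (\<Sum>l\<in>I. \<Sum>j\<in>I. (h * a l j) * (q l \<bullet> (U j ** X j ** \<Omega> j)))"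
    by (simp add: inner_sum_right sum_distrib_left ac_simps)
  also have "\<dots> = (\<Sum>j\<in>I. \<Sum>l\<in>I. (h * a l j) * (q l \<bullet> (U j ** X j ** \<Omega> j)))"
    by (rule sum.swap)
  also have "\<dots> = (\<Sum>j\<in>I. skew_inner (Asym (h *\<^sub>R (transpose (U j) **
     (\<Sum>l\<in>I. a l j *\<^sub>R q l) ** transpose (\<Omega> j)))) (X j))"
  proof (intro sum.cong refl)
    fix j assume j: "j \<in> I"
    have "(\<Sum>l\<in>I. (h * a l j) * (q l \<bullet> (U j ** X j ** \<Omega> j)))
        = h * ((\<Sum>l\<in>I. a l j *\<^sub>R q l) \<bullet> (U j ** X j ** \<Omega> j))"
      by (simp add: inner_sum_left sum_distrib_left ac_simps)
    also have "(\<Sum>l\<in>I. a l j *\<^sub>R q l) \<bullet> (U j ** X j ** \<Omega> j)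
        = (transpose (U j) ** (\<Sum>l\<in>I. a l j *\<^sub>R q l) ** transpose (\<Omega> j)) \<bullet> X j"
      by (simp only: inner_commute[of "\<Sum>l\<in>I. a l j *\<^sub>R q l"] inner_mult_right[of "U j ** X j"]
          inner_mult_left[of "U j"] matrix_mul_assoc inner_commute[of "X j"])
    finally show "(\<Sum>l\<in>I. (h * a l j) * (q l \<bullet> (U j ** X j ** \<Omega> j)))
        = skew_inner (Asym (h *\<^sub>R (transpose (U j) ** (\<Sum>l\<in>I. a l j *\<^sub>R q l) ** transpose (\<Omega> j)))) (X j)"
      by (simp add: skew_inner_Asym X[OF j])
  qed
  finally show ?thesis
    by (simp add: K_def K_adj_def skew_inner.diff_left skew_inner.diff_right sum_subtractf q_def)
qed

definition adj_solution :: "nat \<Rightarrow> real^'n^'n \<Rightarrow> (nat \<Rightarrow> real^'n^'n) \<Rightarrow> bool" where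
  "adj_solution i S T \<longleftrightarrow> T \<in> skew_pow s \<and> (\<forall>j\<in>I. K_adj T j = (if i = j then S else 0))"

text \<open>The solutions of the system of the theorem are the \<open>T\<close> representing the functional
  \<open>Z \<mapsto> \<langle>S, \<pi>\<^sub>i (\<phi>\<^sup>-\<^sup>1 Z)\<rangle>\<close>, which gives existence, uniqueness and the adjoint formulas.\<close>
lemma adj_solution_iff:
  assumes S: "S \<in> skew" and i: "i \<in> I" and T: "T \<in> skew_pow s"
  shows "adj_solution i S T \<longleftrightarrow>
    (\<forall>Z. (\<forall>j\<in>I. Z j \<in> skew) \<longrightarrow> (\<Sum>j\<in>I. skew_inner (T j) (Z j)) = skew_inner S (R Z i))"
    (is "_ \<longleftrightarrow> ?rhs")
proof
  have Tj: "\<And>j. j \<in> I \<Longrightarrow> T j \<in> skew" using T by (auto simp: skew_pow_I)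
  {
    assume sol: "adj_solution i S T"
    show ?rhs
    proof (intro allI impI)
      fix Z :: "nat \<Rightarrow> real^'n^'n" assume Z: "\<forall>j\<in>I. Z j \<in> skew"
      have "(\<Sum>j\<in>I. skew_inner (T j) (Z j)) = (\<Sum>j\<in>I. skew_inner (T j) (K (R Z) j))"
        using Z by (intro sum.cong refl) (simp add: K_R)
      also have "\<dots> = (\<Sum>j\<in>I. skew_inner (K_adj T j) (R Z j))"
        using Z by (intro K_adjoint Tj R_skew) auto
      also have "\<dots> = (\<Sum>j\<in>I. if i = j then skew_inner S (R Z j) else 0)"
        using sol by (intro sum.cong refl) (auto simp: adj_solution_def skew_inner.zero_left)
      also have "\<dots> = skew_inner S (R Z i)" using i by simp
      finally show "(\<Sum>j\<in>I. skew_inner (T j) (Z j)) = skew_inner S (R Z i)" .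
    qed
  }
  assume rhs: ?rhs
  have "K_adj T j = (if i = j then S else 0)" if j: "j \<in> I" for j
  proof (rule skew_inner_nondegenerate)
    show "K_adj T j \<in> skew" using Tj j by (simp add: K_adj_skew)
    show "(if i = j then S else 0) \<in> skew" using S by simp
    fix Y :: "real^'n^'n" assume Y: "Y \<in> skew"
    \<comment> \<open>Testing with the tuple \<open>\<iota> j Y\<close> isolates slot j. This tuple
      is \<open>R\<close> of its own image under \<open>K\<close>, so the hypothesis applies to that
      image.\<close>
    have "skew_inner (K_adj T j) Y = (\<Sum>l\<in>I. if l = j then skew_inner (K_adj T l) Y else 0)"
      using j by simp
    also have "\<dots> = (\<Sum>l\<in>I. skew_inner (K_adj T l) (\<iota> j Y l))"
      by (intro sum.cong refl) (simp add: \<iota>_def skew_inner.zero_right)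
    also have "\<dots> = (\<Sum>l\<in>I. skew_inner (T l) (K (\<iota> j Y) l))"
      using Y by (intro K_adjoint[symmetric] Tj \<iota>_skew)
    also have "\<dots> = skew_inner S (R (K (\<iota> j Y)) i)"
      using rhs Y by (simp add: K_skew \<iota>_skew)
    also have "R (K (\<iota> j Y)) i = \<iota> j Y i"
      using Y i by (intro R_unique K_skew \<iota>_skew refl)
    finally show "skew_inner (K_adj T j) Y = skew_inner (if i = j then S else 0) Y"
      by (simp add: \<iota>_def skew_inner.zero_right skew_inner.zero_left split: if_splits)
  qed
  then show "adj_solution i S T" using T by (simp add: adj_solution_def)
qed

text \<open>Instead of inverting the transposed system, a solution is read off from Riesz
  representatives, slot by slot, of the functional in \<open>adj_solution_iff\<close>, which then
  returns the equations.\<close>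

lemma adj_solution_exists:
  assumes S: "S \<in> skew" and i: "i \<in> I"
  shows "\<exists>!T. adj_solution i S T"
proof -
  have "\<exists>D. D \<in> skew \<and> (\<forall>Y\<in>skew. skew_inner D Y = skew_inner S (R (\<iota> j Y) i))" for j
  proof -
    have "linear (\<lambda>Y. skew_inner S (R (\<iota> j (Asym Y)) i))"
      using linear_compose[OF linear_R_\<iota>[OF i, of j]
          bounded_linear.linear[OF skew_inner.bounded_linear_right[of S]]]
      unfolding o_def .
    then obtain D where D: "D \<in> skew" "\<And>Y. Y \<in> skew \<Longrightarrow> skew_inner S (R (\<iota> j (Asym Y)) i) = skew_inner D Y"
      using skew_representation by blast
    have "skew_inner D Y = 2 * skew_inner S (R (\<iota> j Y) i)" if "Y \<in> skew" for Y
    proof -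
      have "\<iota> j (Asym Y) = (\<lambda>l. 2 *\<^sub>R \<iota> j Y l)" using that by (auto simp: \<iota>_def Asym_on_skew)
      then show ?thesis
        using D(2)[OF that] R_scaleR[of "\<iota> j Y" i 2] that i by (simp add: \<iota>_skew skew_inner.scaleR_right)
    qed
    then show ?thesis
      using D(1) by (intro exI[of _ "(1/2) *\<^sub>R D"]) (auto simp: skew_inner.scaleR_left skew_scaleR)
  qed
  then obtain T0 where T0: "\<And>j. T0 j \<in> skew"
    "\<And>j Y. Y \<in> skew \<Longrightarrow> skew_inner (T0 j) Y = skew_inner S (R (\<iota> j Y) i)"
    by metis
  \<comment> \<open>Tuples have the value \<open>undefined\<close> outside the stages; restriction
    puts T into \<open>skew_pow s\<close> and makes uniqueness an equality of functions.\<close>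
  define T where "T = restrict T0 I"
  have T: "T \<in> skew_pow s" using T0(1) by (simp add: T_def restrict_skew_pow)
  show ?thesis
  proof (rule ex1I[of _ T])
    show "adj_solution i S T"
      unfolding adj_solution_iff[OF S i T]
    proof (intro allI impI)
      fix Z :: "nat \<Rightarrow> real^'n^'n" assume Z: "\<forall>j\<in>I. Z j \<in> skew"
      have "(\<Sum>j\<in>I. skew_inner (T j) (Z j)) = (\<Sum>j\<in>I. skew_inner S (R (\<iota> j (Z j)) i))"
        using Z by (intro sum.cong refl) (simp add: T_def T0)
      also have "\<dots> = skew_inner S (R Z i)"
        using Z i by (simp add: R_decompose[of Z i] skew_inner.sum_right)
      finally show "(\<Sum>j\<in>I. skew_inner (T j) (Z j)) = skew_inner S (R Z i)" .
    qed
    fix T' assume sol: "adj_solution i S T'"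
    then have T': "T' \<in> skew_pow s" by (simp add: adj_solution_def)
    have "T' j = T j" if j: "j \<in> I" for j
    proof (rule skew_inner_nondegenerate)
      show "T' j \<in> skew" "T j \<in> skew" using j T T' by (auto simp: skew_pow_I)
      fix Y :: "real^'n^'n" assume Y: "Y \<in> skew"
      have "skew_inner (T' j) Y = (\<Sum>l\<in>I. if l = j then skew_inner (T' l) Y else 0)" using j by simp
      also have "\<dots> = (\<Sum>l\<in>I. skew_inner (T' l) (\<iota> j Y l))"
        by (intro sum.cong refl) (simp add: \<iota>_def skew_inner.zero_right)
      also have "\<dots> = skew_inner S (R (\<iota> j Y) i)"
        using sol[unfolded adj_solution_iff[OF S i T']] Y \<iota>_skew by blast
      finally show "skew_inner (T' j) Y = skew_inner (T j) Y" using j Y by (simp add: T_def T0)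
    qed
    then show "T' = T" using T T' unfolding skew_pow_I by (intro PiE_ext)
  qed
qed

lemma skew_adjoint_eqI:
  fixes x :: "real^'n^'n"
  assumes "x \<in> skew" "\<And>v. v \<in> skew \<Longrightarrow> skew_inner x v = skew_inner S (f v)"
  shows "skew_adjoint f S = x"
proof (rule adjoint_on_eqI)
  show "x \<in> skew" by fact
  show "\<And>v. v \<in> skew \<Longrightarrow> skew_inner x v = skew_inner S (f v)" by fact
  fix y assume "y \<in> skew" "\<And>v. v \<in> skew \<Longrightarrow> skew_inner y v = skew_inner x v"
  then show "y = x" by (rule skew_inner_nondegenerate[OF _ assms(1)])
qed

lemma pi_phi_inv_psi:
  "(pi_map i \<circ> phi_inv s h a g0 \<Omega> U \<circ> psi_map s h a g0 \<Omega> U k) \<delta>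
     = R (\<lambda>l. dpolar (A l) (a l k *\<^sub>R (U k ** \<delta>))) i"
  unfolding o_def R_def psi_map_def pi_map_def A_def I_def ..

lemma pi_phi_inv_varphi:
  "(pi_map i \<circ> phi_inv s h a g0 \<Omega> U \<circ> varphi_map s h a g0 \<Omega> U) \<delta>
     = R (\<lambda>l. dpolar (A l) (g0 ** \<delta>)) i"
  unfolding o_def R_def varphi_map_def pi_map_def A_def I_def ..

text \<open>Both \<open>psi_map\<close> and \<open>varphi_map\<close> apply \<open>dpolar\<close> at
  each stage to some direction B l, so this one identity yields both adjoint formulas.\<close>

lemma adj_solution_dpolar:
  assumes "S \<in> skew" "i \<in> I" "adj_solution i S T"
  shows "skew_inner S (R (\<lambda>l. dpolar (A l) (B l)) i) = (\<Sum>l\<in>I. dpolar_adj (A l) (T l) \<bullet> B l)"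
proof -
  have T: "T \<in> skew_pow s" using assms(3) by (simp add: adj_solution_def)
  have "skew_inner S (R (\<lambda>l. dpolar (A l) (B l)) i) = (\<Sum>l\<in>I. skew_inner (T l) (dpolar (A l) (B l)))"
    using assms(3)[unfolded adj_solution_iff[OF assms(1,2) T]] dpolar_skew by simp
  also have "\<dots> = (\<Sum>l\<in>I. dpolar_adj (A l) (T l) \<bullet> B l)"
  proof (intro sum.cong refl)
    fix l assume l: "l \<in> I"
    then have "T l \<in> skew" using T by (auto simp: skew_pow_I)
    then show "skew_inner (T l) (dpolar (A l) (B l)) = dpolar_adj (A l) (T l) \<bullet> B l"
      using inner_dpolar_adj[OF det_A[OF l]] by simp
  qed
  finally show ?thesis .
qed

lemma skew_adjoint_psi:
  assumes "S \<in> skew" "i \<in> I" "adj_solution i S T"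
  shows "skew_adjoint (pi_map i \<circ> phi_inv s h a g0 \<Omega> U \<circ> psi_map s h a g0 \<Omega> U k) S
    = Asym (transpose (U k) ** (\<Sum>l\<in>I. a l k *\<^sub>R dpolar_adj (A l) (T l)))"
proof (rule skew_adjoint_eqI[OF Asym_skew])
  fix v :: "real^'n^'n" assume v: "v \<in> skew"
  have "skew_inner (Asym (transpose (U k) ** (\<Sum>l\<in>I. a l k *\<^sub>R dpolar_adj (A l) (T l)))) v
      = (\<Sum>l\<in>I. a l k *\<^sub>R dpolar_adj (A l) (T l)) \<bullet> (U k ** v)"
    by (simp add: skew_inner_Asym[OF v] inner_mult_left)
  also have "\<dots> = (\<Sum>l\<in>I. dpolar_adj (A l) (T l) \<bullet> (a l k *\<^sub>R (U k ** v)))"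
    by (simp add: inner_sum_left)
  finally show "skew_inner (Asym (transpose (U k) ** (\<Sum>l\<in>I. a l k *\<^sub>R dpolar_adj (A l) (T l)))) v
      = skew_inner S ((pi_map i \<circ> phi_inv s h a g0 \<Omega> U \<circ> psi_map s h a g0 \<Omega> U k) v)"
    unfolding pi_phi_inv_psi adj_solution_dpolar[OF assms] .
qed

lemma skew_adjoint_varphi:
  assumes "S \<in> skew" "i \<in> I" "adj_solution i S T"
  shows "skew_adjoint (pi_map i \<circ> phi_inv s h a g0 \<Omega> U \<circ> varphi_map s h a g0 \<Omega> U) S
    = Asym (transpose g0 ** (\<Sum>l\<in>I. dpolar_adj (A l) (T l)))"
proof (rule skew_adjoint_eqI[OF Asym_skew])
  fix v :: "real^'n^'n" assume v: "v \<in> skew"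
  have "skew_inner (Asym (transpose g0 ** (\<Sum>l\<in>I. dpolar_adj (A l) (T l)))) v
      = (\<Sum>l\<in>I. dpolar_adj (A l) (T l) \<bullet> (g0 ** v))"
    by (simp add: skew_inner_Asym[OF v] inner_mult_left inner_sum_left)
  then show "skew_inner (Asym (transpose g0 ** (\<Sum>l\<in>I. dpolar_adj (A l) (T l)))) v
      = skew_inner S ((pi_map i \<circ> phi_inv s h a g0 \<Omega> U \<circ> varphi_map s h a g0 \<Omega> U) v)"
    unfolding pi_phi_inv_varphi adj_solution_dpolar[OF assms] .
qed

text \<open>\<open>skew_adjoint\<close> is a definite description; its adjoint property is certified
  by the element that an \<open>adj_solution\<close> exhibits. The gradient computations use this
  form, from which T has disappeared.\<close>

lemma skew_adjoint_psi_inner: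
  assumes "S \<in> skew" "i \<in> I" "\<delta> \<in> skew"
  shows "skew_inner (skew_adjoint (pi_map i \<circ> phi_inv s h a g0 \<Omega> U \<circ> psi_map s h a g0 \<Omega> U k) S) \<delta>
    = skew_inner S (R (\<lambda>l. dpolar (A l) (a l k *\<^sub>R (U k ** \<delta>))) i)"
proof -
  obtain T where T: "adj_solution i S T" using adj_solution_exists[OF assms(1,2)] by blast
  show ?thesis
    unfolding skew_adjoint_psi[OF assms(1,2) T] adj_solution_dpolar[OF assms(1,2) T]
    by (simp add: skew_inner_Asym[OF assms(3)] inner_mult_left inner_sum_left)
qed

lemma skew_adjoint_varphi_inner:
  assumes "S \<in> skew" "i \<in> I" "\<delta> \<in> skew"
  shows "skew_inner (skew_adjoint (pi_map i \<circ> phi_inv s h a g0 \<Omega> U \<circ> varphi_map s h a g0 \<Omega> U) S) \<delta>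
    = skew_inner S (R (\<lambda>l. dpolar (A l) (g0 ** \<delta>)) i)"
proof -
  obtain T where T: "adj_solution i S T" using adj_solution_exists[OF assms(1,2)] by blast
  show ?thesis
    unfolding skew_adjoint_varphi[OF assms(1,2) T] adj_solution_dpolar[OF assms(1,2) T]
    by (simp add: skew_inner_Asym[OF assms(3)] inner_mult_left inner_sum_left)
qed

lemma skew_adjoint_skew:
  assumes "S \<in> skew" "i \<in> I"
  shows "skew_adjoint (pi_map i \<circ> phi_inv s h a g0 \<Omega> U \<circ> psi_map s h a g0 \<Omega> U k) S \<in> skew" (is ?G1)
    "skew_adjoint (pi_map i \<circ> phi_inv s h a g0 \<Omega> U \<circ> varphi_map s h a g0 \<Omega> U) S \<in> skew" (is ?G2)
proof -
  obtain T where "adj_solution i S T" using adj_solution_exists[OF assms] by blast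
  note skew_adjoint_psi[OF assms this, of k] skew_adjoint_varphi[OF assms this]
  then show ?G1 ?G2 by simp_all
qed

end


section \<open>Solving the stage equations near a given solution\<close>

lemma finite_common_radius:
  assumes "finite I" "\<And>i. i \<in> I \<Longrightarrow> \<exists>d>0::real. P i d" "\<And>i d e. P i d \<Longrightarrow> 0 < e \<Longrightarrow> e \<le> d \<Longrightarrow> P i e"
  shows "\<exists>d>0. \<forall>i\<in>I. P i d"
  using assms(1,2)
proof (induction I rule: finite_induct)
  case empty
  show ?case by (intro exI[of _ 1]) simp
next
  case (insert i I)
  obtain d where d: "d > 0" "\<forall>i\<in>I. P i d" using insert.IH insert.prems by auto
  obtain e where e: "e > 0" "P i e" using insert.prems by blast
  have "P j (min d e)" if "j \<in> insert i I" for j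
    using that d e assms(3)[of j d "min d e"] assms(3)[of j e "min d e"] by auto
  moreover have "min d e > 0" using d e by simp
  ultimately show ?case by blast
qed

text \<open>Banach's iteration, carried out by hand because the distance \<open>D\<close> sees only
  indices in I and is merely a pseudometric on functions. With contraction factor 1/2 and first step
  at most r/2 the step lengths sum to at most r, so the iteration never leaves the ball.\<close>

lemma tuple_fixed_point:
  fixes T :: "('i \<Rightarrow> 'b::banach) \<Rightarrow> 'i \<Rightarrow> 'b"
  assumes I: "finite I" and r: "0 \<le> r"
    and contr: "\<And>x y. (\<Sum>i\<in>I. norm (x i - x0 i)) \<le> r \<Longrightarrow> (\<Sum>i\<in>I. norm (y i - x0 i)) \<le> r \<Longrightarrow>
      (\<Sum>i\<in>I. norm (T x i - T y i)) \<le> (\<Sum>i\<in>I. norm (x i - y i)) / 2"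
    and start: "(\<Sum>i\<in>I. norm (T x0 i - x0 i)) \<le> r / 2"
  obtains x where "(\<Sum>i\<in>I. norm (x i - x0 i)) \<le> r" "\<And>i. i \<in> I \<Longrightarrow> T x i = x i"
proof -
  define D where "D x y = (\<Sum>i\<in>I. norm (x i - y i))" for x y :: "'i \<Rightarrow> 'b"
  have D_tri: "D x z \<le> D x y + D y z" for x y z
  proof -
    have "norm (x i - z i) \<le> norm (x i - y i) + norm (y i - z i)" for i
      using norm_triangle_ineq[of "x i - y i" "y i - z i"] by simp
    then have "D x z \<le> (\<Sum>i\<in>I. norm (x i - y i) + norm (y i - z i))"
      unfolding D_def by (intro sum_mono)
    then show ?thesis by (simp add: D_def sum.distrib)
  qed
  have D_comm: "D x y = D y x" for x y by (simp add: D_def norm_minus_commute)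
  have D_contr: "D (T x) (T y) \<le> D x y / 2" if "D x x0 \<le> r" "D y x0 \<le> r" for x y
    using contr that unfolding D_def by blast
  define X where "X n = (T ^^ n) x0" for n
  have XS: "X (Suc n) = T (X n)" for n by (simp add: X_def)
  \<comment> \<open>Partial sums of r/2 + r/4 + ... The two bounds are proved together because
    contracting the next step requires the iterates to lie in the ball.\<close>
  have X: "D (X n) x0 \<le> r * (1 - (1/2) ^ n) \<and> D (X (Suc n)) (X n) \<le> r / 2 * (1/2) ^ n" for n
  proof (induction n)
    case 0
    show ?case using start r by (simp add: X_def D_def)
  next
    case (Suc n)
    have 1: "D (X (Suc n)) x0 \<le> r * (1 - (1/2) ^ Suc n)"
      using D_tri[of "X (Suc n)" x0 "X n"] Suc by (simp add: algebra_simps)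
    have le: "r * (1 - (1/2) ^ k) \<le> r" for k :: nat
      using r by (simp add: mult_left_le)
    have "D (X (Suc (Suc n))) (X (Suc n)) \<le> D (X (Suc n)) (X n) / 2"
      unfolding XS[of "Suc n"] XS[of n]
      using D_contr[of "T (X n)" "X n"] 1 Suc le[of "Suc n"] le[of n] by (simp add: XS)
    then show ?case using 1 Suc by simp
  qed
  have X_in: "D (X n) x0 \<le> r" for n
    using X[of n] r by (smt (verit) mult_left_le zero_le_power divide_nonneg_nonneg)
  have "\<exists>l. (\<lambda>n. X n i) \<longlonglongrightarrow> l" if i: "i \<in> I" for i
  proof -
    have "norm (X (Suc n) i - X n i) \<le> r / 2 * (1/2) ^ n" for n
    proof -
      have "norm (X (Suc n) i - X n i) \<le> D (X (Suc n)) (X n)"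
        unfolding D_def using i I by (intro member_le_sum) auto
      then show ?thesis using X[of n] by linarith
    qed
    note le = this
    have "summable (\<lambda>n. r / 2 * (1/2) ^ n)"
      by (rule summable_mult, rule summable_geometric) simp
    then have "summable (\<lambda>n. X (Suc n) i - X n i)"
      by (rule summable_comparison_test') (rule le)
    then have "(\<lambda>n. \<Sum>k<n. X (Suc k) i - X k i) \<longlonglongrightarrow> (\<Sum>k. X (Suc k) i - X k i)"
      by (rule summable_LIMSEQ)
    then have "(\<lambda>n. X n i - X 0 i) \<longlonglongrightarrow> (\<Sum>k. X (Suc k) i - X k i)"
      by (simp only: sum_lessThan_telescope[of "\<lambda>k. X k i"])
    from tendsto_add[OF this tendsto_const[of "X 0 i"]] show ?thesis by auto
  qed
  then obtain x where x: "\<And>i. i \<in> I \<Longrightarrow> (\<lambda>n. X n i) \<longlonglongrightarrow> x i" by metis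
  have lim0: "(\<lambda>n. D (X n) y) \<longlonglongrightarrow> D x y" for y
    unfolding D_def by (intro tendsto_intros x)
  have lim: "(\<lambda>n. D (X n) x) \<longlonglongrightarrow> 0" using lim0[of x] by (simp add: D_def)
  have x_in: "D x x0 \<le> r"
    using lim0[of x0] X_in by (intro LIMSEQ_le_const2) auto
  \<comment> \<open>Contractivity stands in for continuity of T: the detour through T (X n) bounds
    the defect by quantities tending to 0.\<close>
  have "D (T x) x \<le> D (X n) x / 2 + D (X (Suc n)) x" for n
    using D_tri[of "T x" x "T (X n)"] D_contr[OF x_in X_in[of n]] D_comm[of x "X n"] by (simp add: XS)
  moreover have "(\<lambda>n. D (X n) x / 2 + D (X (Suc n)) x) \<longlonglongrightarrow> 0 / 2 + 0"
    by (intro tendsto_intros lim LIMSEQ_Suc[OF lim]) simp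
  ultimately have "D (T x) x \<le> 0"
    by (intro LIMSEQ_le_const) auto
  then have "T x i = x i" if "i \<in> I" for i
    using that I sum_nonneg_0[OF I, of "\<lambda>i. norm (T x i - x i)" i]
      sum_nonneg[of I "\<lambda>i. norm (T x i - x i)"] by (simp add: D_def)
  with x_in show ?thesis using that by (simp add: D_def)
qed

lemma isCont_polar_proj: "0 < det A \<Longrightarrow> isCont polar_proj A"
  using polar_proj_has_derivative has_derivative_continuous by blast

text \<open>Tuples carry the product topology; componentwise convergence is what brings parameters
  into the neighbourhood in \<open>stage_solution\<close>.\<close>

lemma tendsto_funI:
  fixes f :: "'p \<Rightarrow> 'i \<Rightarrow> 'b::topological_space"
  assumes "\<And>j. ((\<lambda>p. f p j) \<longlongrightarrow> l j) F" shows "(f \<longlongrightarrow> l) F"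
proof -
  have "limitin (product_topology (\<lambda>i. euclidean) UNIV) f l F"
    unfolding limitin_componentwise using assms by simp
  then show ?thesis by (simp add: euclidean_product_topology)
qed

context internal_stages
begin

section \<open>The Newton map of the stage equations\<close>

definition tnorm :: "(nat \<Rightarrow> real^'n^'n) \<Rightarrow> real" where
  "tnorm Z = (\<Sum>k\<in>I. norm (Z k))"

text \<open>Bilinear in \<open>W\<close> and \<open>x\<close>, so that it serves for variations of
  the Omega_j as well as of the U_j.\<close>

definition lin :: "(nat \<Rightarrow> real^'n^'n) \<Rightarrow> nat \<Rightarrow> (nat \<Rightarrow> real^'n^'n) \<Rightarrow> real^'n^'n" where
  "lin W i x = h *\<^sub>R (\<Sum>j\<in>I. a i j *\<^sub>R (x j ** W j))"

definition residual :: "real^'n^'n \<Rightarrow> (nat \<Rightarrow> real^'n^'n) \<Rightarrow> (nat \<Rightarrow> real^'n^'n) \<Rightarrow> nat \<Rightarrow> real^'n^'n" where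
  "residual g W x i = x i - polar_proj (g + lin W i x)"

text \<open>\<open>newton\<close> inverts \<open>linearized\<close>, the derivative of \<open>residual\<close> at the given solution on arbitrary
  matrices rather than tangent vectors \<open>U\<^sub>i X\<^sub>i\<close>: the correction to the identity takes values in
  \<open>U\<^sub>i skew\<close>, where \<open>R\<close> applies.\<close>

definition newton :: "(nat \<Rightarrow> real^'n^'n) \<Rightarrow> nat \<Rightarrow> real^'n^'n" where
  "newton Z i = Z i + U i ** R (\<lambda>l. dpolar (A l) (lin \<Omega> l Z)) i"

lemma stage_mat_eq: "stage_mat s h a g W x i = g + lin W i x"
  by (simp add: stage_mat_def lin_def I_def)

lemma A_eq: "A i = g0 + lin \<Omega> i U"
  by (simp add: A_def stage_mat_eq)

lemma polar_A: "i \<in> I \<Longrightarrow> polar_proj (A i) = U i"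
  using U_eq by (simp add: A_def I_def)

lemma U_in_SO: "i \<in> I \<Longrightarrow> U i \<in> SO"
  using U_SO by (simp add: I_def)

lemma K_eq: "K X i = X i - dpolar (A i) (lin \<Omega> i (\<lambda>j. U j ** X j))"
  by (simp add: K_def lin_def)

lemma tnorm_nonneg: "0 \<le> tnorm Z"
  by (simp add: tnorm_def sum_nonneg)

lemma tnorm_cong: "(\<And>i. i \<in> I \<Longrightarrow> X i = Y i) \<Longrightarrow> tnorm X = tnorm Y"
  by (simp add: tnorm_def)

lemma norm_le_tnorm: "i \<in> I \<Longrightarrow> norm (Z i) \<le> tnorm Z"
  unfolding tnorm_def by (intro member_le_sum) auto

lemma tnorm_triangle: "tnorm (\<lambda>i. X i + Y i) \<le> tnorm X + tnorm Y"
  unfolding tnorm_def sum.distrib[symmetric] by (intro sum_mono norm_triangle_ineq)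

lemma lin_diff: "lin W i (\<lambda>j. x j - y j) = lin W i x - lin W i y"
  by (simp add: lin_def matmul.diff_left scaleR_diff_right sum_subtractf)

lemma lin_add: "lin W i (\<lambda>j. x j + y j) = lin W i x + lin W i y"
  by (simp add: lin_def matmul.add_left scaleR_add_right sum.distrib)

lemma lin_diff_left: "lin (\<lambda>j. V j - W j) i x = lin V i x - lin W i x"
  by (simp add: lin_def matmul.diff_right scaleR_diff_right sum_subtractf)

lemma lin_cong: "(\<And>j. j \<in> I \<Longrightarrow> x j = y j) \<Longrightarrow> lin W i x = lin W i y"
  by (simp add: lin_def)

lemma lin_bound:
  obtains c where "0 \<le> c" "\<And>W i x. i \<in> I \<Longrightarrow> norm (lin W i x) \<le> c * tnorm W * tnorm x"
proof
  define c where "c = \<bar>h\<bar> * (\<Sum>i\<in>I. \<Sum>j\<in>I. \<bar>a i j\<bar>)"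
  show "0 \<le> c" by (simp add: c_def sum_nonneg)
  fix W i x assume i: "i \<in> I"
  have "norm (a i j *\<^sub>R (x j ** W j)) \<le> \<bar>a i j\<bar> * (tnorm W * tnorm x)" if "j \<in> I" for j
  proof -
    have "norm (x j ** W j) \<le> norm (x j) * norm (W j)" by (rule norm_matrix_mult_le)
    also have "\<dots> \<le> tnorm x * tnorm W"
      using that by (intro mult_mono norm_le_tnorm tnorm_nonneg) auto
    finally show ?thesis by (simp add: mult_left_mono mult.commute)
  qed
  then have "norm (\<Sum>j\<in>I. a i j *\<^sub>R (x j ** W j)) \<le> (\<Sum>j\<in>I. \<bar>a i j\<bar> * (tnorm W * tnorm x))"
    by (intro sum_norm_le)
  also have "\<dots> = (\<Sum>j\<in>I. \<bar>a i j\<bar>) * (tnorm W * tnorm x)" by (simp add: sum_distrib_right)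
  also have "\<dots> \<le> (\<Sum>i\<in>I. \<Sum>j\<in>I. \<bar>a i j\<bar>) * (tnorm W * tnorm x)"
    using i by (intro mult_right_mono member_le_sum[of i I "\<lambda>i. \<Sum>j\<in>I. \<bar>a i j\<bar>"])
      (auto intro!: sum_nonneg mult_nonneg_nonneg tnorm_nonneg)
  finally show "norm (lin W i x) \<le> c * tnorm W * tnorm x"
    by (simp add: lin_def c_def mult_left_mono mult.assoc)
qed

lemma dpolar_add: "i \<in> I \<Longrightarrow> dpolar (A i) (X + Y) = dpolar (A i) X + dpolar (A i) Y"
  by (rule linear_add[OF bounded_linear.linear[OF bounded_linear_dpolar]])

lemma dpolar_diff: "i \<in> I \<Longrightarrow> dpolar (A i) (X - Y) = dpolar (A i) X - dpolar (A i) Y"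
  by (rule linear_diff[OF bounded_linear.linear[OF bounded_linear_dpolar]])

lemma R_cong:
  assumes "\<And>i. i \<in> I \<Longrightarrow> Y i = Z i" shows "R Y = R Z"
proof -
  have "restrict Y I = restrict Z I" using assms by (rule restrict_ext)
  then show ?thesis by (simp add: R_def)
qed

lemma newton_cong:
  assumes "\<And>i. i \<in> I \<Longrightarrow> Y i = Z i" "i \<in> I" shows "newton Y i = newton Z i"
  unfolding newton_def using lin_cong[OF assms(1)] assms by simp

lemma newton_add:
  assumes "i \<in> I" shows "newton (\<lambda>i. Y i + Z i) i = newton Y i + newton Z i"
proof -
  have "R (\<lambda>l. dpolar (A l) (lin \<Omega> l (\<lambda>i. Y i + Z i))) i
      = R (\<lambda>l. dpolar (A l) (lin \<Omega> l Y) + dpolar (A l) (lin \<Omega> l Z)) i"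
    by (rule fun_cong[OF R_cong]) (simp add: lin_add dpolar_add)
  also have "\<dots> = R (\<lambda>l. dpolar (A l) (lin \<Omega> l Y)) i + R (\<lambda>l. dpolar (A l) (lin \<Omega> l Z)) i"
    using assms by (intro R_add dpolar_skew)
  finally show ?thesis by (simp add: newton_def matmul.add_right)
qed

lemma newton_0: "i \<in> I \<Longrightarrow> newton (\<lambda>i. 0) i = 0"
  using newton_add[of i "\<lambda>i. 0" "\<lambda>i. 0"] by simp

lemma newton_diff:
  assumes "i \<in> I" shows "newton (\<lambda>i. Y i - Z i) i = newton Y i - newton Z i"
  using newton_add[OF assms, of "\<lambda>i. Y i - Z i" Z] by simp

lemma newton_sum:
  assumes "finite J" "i \<in> I"
  shows "newton (\<lambda>i. \<Sum>k\<in>J. Z k i) i = (\<Sum>k\<in>J. newton (Z k) i)"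
  using assms by (induction J rule: finite_induct) (simp_all add: newton_0 newton_add)

lemma bounded_linear_\<iota>: "bounded_linear (\<lambda>Y. \<iota> k Y i)"
  by (cases "i = k") (simp_all add: \<iota>_def bounded_linear_ident bounded_linear_zero)

lemma bounded_linear_newton_\<iota>:
  assumes "i \<in> I" shows "bounded_linear (\<lambda>Y. newton (\<iota> k Y) i)"
  unfolding newton_def
proof (intro bounded_linear_add bounded_linear_\<iota> bounded_linear_compose[OF matmul.bounded_linear_right]
    bounded_linear_R assms dpolar_skew)
  fix l assume "l \<in> I"
  then show "bounded_linear (\<lambda>Y. dpolar (A l) (lin \<Omega> l (\<iota> k Y)))"
    unfolding lin_def
    by (intro bounded_linear_compose[OF bounded_linear_dpolar] bounded_linear_const_scaleR
        bounded_linear_sum bounded_linear_compose[OF matmul.bounded_linear_left] bounded_linear_\<iota>)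
qed

lemma newton_bound:
  obtains C where "0 < C" "\<And>Z. tnorm (newton Z) \<le> C * tnorm Z"
proof -
  have "\<exists>c\<ge>0. \<forall>Y. norm (newton (\<iota> k Y) i) \<le> c * norm Y" if "i \<in> I" for i k
    using bounded_linear.nonneg_bounded[OF bounded_linear_newton_\<iota>[OF that, of k]]
    by (auto simp: mult.commute)
  then obtain c where c: "\<And>i k. i \<in> I \<Longrightarrow> c i k \<ge> 0"
    "\<And>i k Y. i \<in> I \<Longrightarrow> norm (newton (\<iota> k Y) i) \<le> c i k * norm Y"
    by metis
  define C where "C = (\<Sum>i\<in>I. \<Sum>k\<in>I. c i k) + 1"
  have C: "C > 0" unfolding C_def using c(1) by (intro add_nonneg_pos sum_nonneg) auto
  moreover have "tnorm (newton Z) \<le> C * tnorm Z" for Z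
  proof -
    have "norm (newton Z i) \<le> (\<Sum>k\<in>I. c i k) * tnorm Z" if i: "i \<in> I" for i
    proof -
      have "newton Z i = newton (\<lambda>i. \<Sum>k\<in>I. \<iota> k (Z k) i) i"
        by (rule newton_cong[OF _ i]) (simp add: \<iota>_def)
      also have "\<dots> = (\<Sum>k\<in>I. newton (\<iota> k (Z k)) i)" using i by (simp add: newton_sum)
      finally have "norm (newton Z i) \<le> (\<Sum>k\<in>I. c i k * tnorm Z)"
        using c i norm_le_tnorm[of _ Z]
        by (auto intro!: sum_norm_le order_trans[OF c(2)] mult_left_mono)
      then show ?thesis by (simp add: sum_distrib_right)
    qed
    then have "tnorm (newton Z) \<le> (\<Sum>i\<in>I. (\<Sum>k\<in>I. c i k) * tnorm Z)"
      unfolding tnorm_def[of "newton Z"] by (intro sum_mono)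
    also have "\<dots> \<le> C * tnorm Z"
      using tnorm_nonneg[of Z] by (simp add: C_def distrib_right flip: sum_distrib_right)
    finally show ?thesis .
  qed
  ultimately show ?thesis using that by blast
qed

definition linearized :: "(nat \<Rightarrow> real^'n^'n) \<Rightarrow> nat \<Rightarrow> real^'n^'n" where
  "linearized z i = z i - U i ** dpolar (A i) (lin \<Omega> i z)"

text \<open>With B X = U X and D x = \<open>dpolar\<close> of \<open>lin \<Omega>\<close> at x,
  \<open>linearized\<close> is 1 - B D and \<open>K\<close> is 1 - D B. \<open>newton\<close> is the
  push-through (Woodbury) formula 1 + B (1 - D B)^-1 D for the inverse of 1 - B D.\<close>

lemma newton_linearized:
  assumes "i \<in> I" shows "newton (linearized z) i = z i"
proof -
  define V where "V l = dpolar (A l) (lin \<Omega> l z)" for l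
  have V: "\<And>l. l \<in> I \<Longrightarrow> V l \<in> skew" by (simp add: V_def dpolar_skew)
  have "R (\<lambda>l. dpolar (A l) (lin \<Omega> l (linearized z))) i = R (K V) i"
  proof (rule fun_cong[OF R_cong])
    fix l assume l: "l \<in> I"
    have "linearized z = (\<lambda>i. z i - U i ** V i)" by (simp add: linearized_def V_def fun_eq_iff)
    then show "dpolar (A l) (lin \<Omega> l (linearized z)) = K V l"
      using l by (simp add: K_eq lin_diff dpolar_diff V_def)
  qed
  also have "\<dots> = V i" using V assms by (intro R_unique K_skew) auto
  finally show ?thesis by (simp add: newton_def linearized_def V_def)
qed

lemma linearized_newton:
  assumes "i \<in> I" shows "linearized (newton Z) i = Z i"
proof -
  define V where "V = (\<lambda>l. dpolar (A l) (lin \<Omega> l Z))"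
  have V: "\<And>l. l \<in> I \<Longrightarrow> V l \<in> skew" by (simp add: V_def dpolar_skew)
  have "K (R V) i = V i" using K_R[OF V assms] .
  then have "R V i = V i + dpolar (A i) (lin \<Omega> i (\<lambda>j. U j ** R V j))" by (simp add: K_eq algebra_simps)
  moreover have "newton Z = (\<lambda>i. Z i + U i ** R V i)"
    by (simp add: newton_def V_def fun_eq_iff)
  ultimately show ?thesis
    using assms by (simp add: linearized_def lin_add dpolar_add V_def matmul.add_right)
qed

text \<open>The ball in x is closed because the limit of the fixed point iteration must stay in
  it.\<close>

definition near :: "real \<Rightarrow> real^'n^'n \<Rightarrow> (nat \<Rightarrow> real^'n^'n) \<Rightarrow> (nat \<Rightarrow> real^'n^'n) \<Rightarrow> bool" where
  "near r g W x \<longleftrightarrow>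
     norm (g - g0) < r \<and> tnorm (\<lambda>j. W j - \<Omega> j) < r \<and> tnorm (\<lambda>j. x j - U j) \<le> r"

text \<open>The linearization stays at (g0, Omega, U) while g, W, x, y vary. Two errors arise, the
  strict error of \<open>polar_proj\<close> and that of writing Omega for W in \<open>lin\<close>;
  each receives half of e.\<close>

lemma residual_strict:
  assumes e: "0 < e"
  obtains r where "0 < r"
    "\<And>g W x y i. near r g W x \<Longrightarrow> near r g W y \<Longrightarrow> i \<in> I \<Longrightarrow> 0 < det (g + lin W i x) \<and>
       norm (residual g W x i - residual g W y i - linearized (\<lambda>j. x j - y j) i) \<le> e * tnorm (\<lambda>j. x j - y j)"
proof -
  obtain ca where ca: "0 \<le> ca" "\<And>W i x. i \<in> I \<Longrightarrow> norm (lin W i x) \<le> ca * tnorm W * tnorm x"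
    using lin_bound by blast
  have "\<exists>c\<ge>0. \<forall>B. norm (dpolar (A i) B) \<le> c * norm B" if "i \<in> I" for i
    using bounded_linear.nonneg_bounded[OF bounded_linear_dpolar[OF that]] by (auto simp: mult.commute)
  then obtain cd where cd: "\<And>i. i \<in> I \<Longrightarrow> cd i \<ge> 0" "\<And>i B. i \<in> I \<Longrightarrow> norm (dpolar (A i) B) \<le> cd i * norm B"
    by metis
  define cD where "cD = (\<Sum>i\<in>I. cd i)"
  have cD: "0 \<le> cD" "norm (dpolar (A i) B) \<le> cD * norm B" if "i \<in> I" for i B
  proof -
    show "0 \<le> cD" using cd(1) by (simp add: cD_def sum_nonneg)
    have "cd i \<le> cD" unfolding cD_def using cd(1) that by (intro member_le_sum) auto
    then show "norm (dpolar (A i) B) \<le> cD * norm B"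
      using cd(2)[OF that, of B] mult_right_mono[of "cd i" cD "norm B"] by simp
  qed
  define t where "t = tnorm \<Omega> + 1"
  have t: "0 < t" using tnorm_nonneg[of \<Omega>] by (simp add: t_def)
  \<comment> \<open>Since radii are at most 1, \<open>t\<close> bounds \<open>tnorm W\<close>; the
    strict error is then at most e1 ca t <= e/2 per unit of x - y. The summand 1 avoids division by
    zero.\<close>
  define e1 where "e1 = e / (2 * (ca * t + 1))"
  have cat: "0 < ca * t + 1" using ca t by (simp add: add_nonneg_pos)
  have e1: "0 < e1" "e1 * (ca * t) \<le> e / 2"
  proof -
    show "0 < e1" using e cat by (simp add: e1_def)
    have "e * (ca * t) \<le> e * (ca * t + 1)" using e by (simp add: mult_left_mono)
    then show "e1 * (ca * t) \<le> e / 2" using cat by (simp add: e1_def field_simps)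
  qed
  let ?P = "\<lambda>i d. \<forall>X Y. norm (X - A i) < d \<longrightarrow> norm (Y - A i) < d \<longrightarrow> 0 < det X \<and> 0 < det Y \<and>
     norm (polar_proj Y - polar_proj X - polar_proj (A i) ** polar_tangent (A i) (Y - X)) \<le> e1 * norm (Y - X)"
  have "\<exists>d>0. \<forall>i\<in>I. ?P i d"
  proof (rule finite_common_radius[OF finite_I])
    show "\<exists>d>0. ?P i d" if "i \<in> I" for i
      by (rule polar_strict_derivative[OF det_A[OF that] e1(1)])
    show "?P i d'" if "?P i d" "d' \<le> d" for i d d'
    proof (intro allI impI)
      fix X Y assume "norm (X - A i) < d'" "norm (Y - A i) < d'"
      then have "norm (X - A i) < d" "norm (Y - A i) < d" using that(2) by simp_all
      then show "0 < det X \<and> 0 < det Y \<and>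
        norm (polar_proj Y - polar_proj X - polar_proj (A i) ** polar_tangent (A i) (Y - X)) \<le> e1 * norm (Y - X)"
        using that(1) by blast
    qed
  qed
  then obtain d where d: "d > 0" "\<And>i. i \<in> I \<Longrightarrow> ?P i d" by blast
  \<comment> \<open>Moving g, W and x by r moves a stage matrix by at most c2 r; replacing W by
    Omega costs at most c3 r per unit of x - y, with \<open>c3\<close> below.\<close>
  define c2 where "c2 = 1 + ca * t + ca * tnorm U"
  have c2: "0 < c2" using ca(1) t tnorm_nonneg[of U] by (simp add: c2_def add_pos_nonneg)
  define c3 where "c3 = cD * ca + 1"
  have c3: "0 < c3" if "I \<noteq> {}"
  proof -
    obtain i where "i \<in> I" using \<open>I \<noteq> {}\<close> by blast
    then show ?thesis using cD(1) ca(1) by (auto simp: c3_def intro!: add_nonneg_pos)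
  qed
  define r where "r = (if I = {} then 1 else min 1 (min (d / (2 * c2)) (e / (2 * c3))))"
  have r: "0 < r" using d c2 c3 e by (simp add: r_def)
  show ?thesis
  proof (rule that[OF r])
    fix g W x y i
    assume "near r g W x" "near r g W y" and i: "i \<in> I"
    then have g: "norm (g - g0) < r" and W: "tnorm (\<lambda>j. W j - \<Omega> j) < r"
      and x: "tnorm (\<lambda>j. x j - U j) \<le> r" and y: "tnorm (\<lambda>j. y j - U j) \<le> r"
      by (simp_all add: near_def)
    have "r \<le> d / (2 * c2)" "r \<le> e / (2 * c3)" and r1: "r \<le> 1" using i by (auto simp: r_def)
    moreover have "0 < c3" using c3 i by blast
    ultimately have "c2 * r \<le> d / 2" and re: "c3 * r \<le> e / 2"
      using c2 by (simp_all add: field_simps)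
    then have rd: "c2 * r < d" using d(1) by simp
    have tW: "tnorm W \<le> t"
    proof -
      have "tnorm W \<le> tnorm (\<lambda>j. W j - \<Omega> j) + tnorm \<Omega>"
        using tnorm_triangle[of "\<lambda>j. W j - \<Omega> j" \<Omega>] by simp
      then show ?thesis using W r1 by (simp add: t_def)
    qed
    have close: "norm (g + lin W i z - A i) < d" if z: "tnorm (\<lambda>j. z j - U j) \<le> r" for z
    proof -
      \<comment> \<open>Bilinearity splits the change into one of x at fixed W and one of W at fixed
        U.\<close>
      have "g + lin W i z - A i = (g - g0) + lin W i (\<lambda>j. z j - U j) + lin (\<lambda>j. W j - \<Omega> j) i U"
        by (simp add: A_eq lin_diff lin_diff_left)
      then have "norm (g + lin W i z - A i)
          \<le> norm (g - g0) + norm (lin W i (\<lambda>j. z j - U j)) + norm (lin (\<lambda>j. W j - \<Omega> j) i U)"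
        using norm_triangle_ineq[of "(g - g0) + lin W i (\<lambda>j. z j - U j)"]
          norm_triangle_ineq[of "g - g0" "lin W i (\<lambda>j. z j - U j)"] by (smt (verit))
      also have "\<dots> \<le> r + ca * t * r + ca * r * tnorm U"
      proof (intro add_mono)
        show "norm (g - g0) \<le> r" using g by simp
        have "norm (lin W i (\<lambda>j. z j - U j)) \<le> ca * tnorm W * tnorm (\<lambda>j. z j - U j)" using ca(2) i .
        also have "\<dots> \<le> ca * t * r"
          using ca(1) t tW z by (intro mult_mono mult_left_mono) (auto intro: tnorm_nonneg)
        finally show "norm (lin W i (\<lambda>j. z j - U j)) \<le> ca * t * r" .
        have "norm (lin (\<lambda>j. W j - \<Omega> j) i U) \<le> ca * tnorm (\<lambda>j. W j - \<Omega> j) * tnorm U" using ca(2) i .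
        also have "\<dots> \<le> ca * r * tnorm U"
          using ca(1) W by (intro mult_right_mono mult_left_mono) (auto intro: tnorm_nonneg)
        finally show "norm (lin (\<lambda>j. W j - \<Omega> j) i U) \<le> ca * r * tnorm U" .
      qed
      also have "\<dots> = c2 * r" by (simp add: c2_def algebra_simps)
      finally show ?thesis using rd by simp
    qed
    show "0 < det (g + lin W i x) \<and>
       norm (residual g W x i - residual g W y i - linearized (\<lambda>j. x j - y j) i) \<le> e * tnorm (\<lambda>j. x j - y j)"
    proof
      define z where "z = (\<lambda>j. x j - y j)"
      define err where "err = polar_proj (g + lin W i x) - polar_proj (g + lin W i y) - U i ** dpolar (A i) (lin W i z)"
      note P = d(2)[OF i, rule_format, OF close[OF y] close[OF x]]
      show "0 < det (g + lin W i x)" using P by blast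
      have diff: "(g + lin W i x) - (g + lin W i y) = lin W i z" by (simp add: z_def lin_diff)
      have tz: "0 \<le> tnorm z" by (rule tnorm_nonneg)
      have "norm err \<le> e1 * norm (lin W i z)"
        using P unfolding diff by (simp add: err_def polar_A[OF i] dpolar_eq[OF det_A[OF i]])
      also have "\<dots> \<le> e1 * (ca * t * tnorm z)"
      proof (rule mult_left_mono)
        have "norm (lin W i z) \<le> ca * tnorm W * tnorm z" using ca(2) i .
        also have "\<dots> \<le> ca * t * tnorm z"
          using ca(1) tW tz by (intro mult_right_mono mult_left_mono) auto
        finally show "norm (lin W i z) \<le> ca * t * tnorm z" .
      qed (use e1 in simp)
      also have "\<dots> \<le> e / 2 * tnorm z"
        using mult_right_mono[OF e1(2) tz] by (simp add: mult.assoc)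
      finally have err: "norm err \<le> e / 2 * tnorm z" .
      have "norm (U i ** dpolar (A i) (lin (\<lambda>j. W j - \<Omega> j) i z)) \<le> cD * norm (lin (\<lambda>j. W j - \<Omega> j) i z)"
        using cD(2)[OF i] by (simp add: norm_SO_mult U_in_SO[OF i])
      also have "\<dots> \<le> cD * (ca * tnorm (\<lambda>j. W j - \<Omega> j) * tnorm z)"
        using cD(1)[OF i] ca(2)[OF i] by (intro mult_left_mono)
      also have "\<dots> \<le> cD * (ca * r * tnorm z)"
        using cD(1)[OF i] ca(1) W tz by (intro mult_right_mono mult_left_mono) auto
      also have "\<dots> \<le> c3 * r * tnorm z"
        using r tz by (simp add: c3_def algebra_simps)
      also have "\<dots> \<le> e / 2 * tnorm z" using re tz by (rule mult_right_mono)
      finally have err2: "norm (U i ** dpolar (A i) (lin (\<lambda>j. W j - \<Omega> j) i z)) \<le> e / 2 * tnorm z" .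
      have "residual g W x i - residual g W y i - linearized z i
          = - err - U i ** dpolar (A i) (lin (\<lambda>j. W j - \<Omega> j) i z)"
        by (simp add: residual_def linearized_def err_def z_def lin_diff lin_diff_left
            dpolar_diff[OF i] matmul.diff_right)
      then have "norm (residual g W x i - residual g W y i - linearized z i)
          \<le> norm err + norm (U i ** dpolar (A i) (lin (\<lambda>j. W j - \<Omega> j) i z))"
        using norm_triangle_ineq4[of "- err"] by simp
      then show "norm (residual g W x i - residual g W y i - linearized (\<lambda>j. x j - y j) i)
          \<le> e * tnorm (\<lambda>j. x j - y j)"
        using err err2 by (simp add: z_def)
    qed
  qed
qed


lemma linearized_cong:
  assumes "\<And>i. i \<in> I \<Longrightarrow> y i = z i" "i \<in> I" shows "linearized y i = linearized z i"
  unfolding linearized_def using lin_cong[OF assms(1)] assms by simp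

text \<open>The difference of two Newton iterates is \<open>newton\<close> of the strict error,
  hence small. Writing x - y as this difference plus the difference of the Newton corrections gives
  the last estimate, the stability bound behind continuity and differentiability of
  solutions.\<close>

lemma residual_contraction:
  obtains r C where "0 < r" "0 < C" "\<And>Z. tnorm (newton Z) \<le> C * tnorm Z"
    "\<And>g W x i. near r g W x \<Longrightarrow> i \<in> I \<Longrightarrow> 0 < det (g + lin W i x)"
    "\<And>g W x y. near r g W x \<Longrightarrow> near r g W y \<Longrightarrow>
       tnorm (\<lambda>i. (x i - newton (residual g W x) i) - (y i - newton (residual g W y) i))
         \<le> tnorm (\<lambda>j. x j - y j) / 2"
    "\<And>g W x y. near r g W x \<Longrightarrow> near r g W y \<Longrightarrow>
       tnorm (\<lambda>j. x j - y j) \<le> 2 * C * tnorm (\<lambda>i. residual g W x i - residual g W y i)"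
proof -
  obtain C where C: "0 < C" "\<And>Z. tnorm (newton Z) \<le> C * tnorm Z" using newton_bound by blast
  define m where "m = real (card I)"
  \<comment> \<open>Errors of size e at m stages, sent through \<open>newton\<close>, cost C m e,
    which this choice keeps at most 1/2.\<close>
  define e where "e = 1 / (2 * C * (m + 1))"
  have m: "0 \<le> m" by (simp add: m_def)
  have e: "0 < e" using C m by (simp add: e_def)
  obtain r where r: "0 < r" and strict:
    "\<And>g W x y i. near r g W x \<Longrightarrow> near r g W y \<Longrightarrow> i \<in> I \<Longrightarrow> 0 < det (g + lin W i x) \<and>
       norm (residual g W x i - residual g W y i - linearized (\<lambda>j. x j - y j) i) \<le> e * tnorm (\<lambda>j. x j - y j)"
    using residual_strict[OF e] by blast
  have contr: "tnorm (\<lambda>i. (x i - newton (residual g W x) i) - (y i - newton (residual g W y) i))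
         \<le> tnorm (\<lambda>j. x j - y j) / 2"
    if H: "near r g W x" "near r g W y" for g W x y
  proof -
    define z where "z = (\<lambda>j. x j - y j)"
    define E where "E = (\<lambda>i. linearized z i - (residual g W x i - residual g W y i))"
    have "(x i - newton (residual g W x) i) - (y i - newton (residual g W y) i) = newton E i"
      if i: "i \<in> I" for i
    proof -
      have "newton E i = newton (linearized z) i - (newton (residual g W x) i - newton (residual g W y) i)"
        unfolding E_def by (simp add: newton_diff[OF i])
      then show ?thesis using newton_linearized[OF i, of z] by (simp add: z_def)
    qed
    then have "tnorm (\<lambda>i. (x i - newton (residual g W x) i) - (y i - newton (residual g W y) i)) = tnorm (newton E)"
      by (rule tnorm_cong)
    also have "\<dots> \<le> C * tnorm E" by (rule C(2))
    also have "tnorm E \<le> (\<Sum>i\<in>I. e * tnorm z)"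
      unfolding tnorm_def[of E]
    proof (rule sum_mono)
      fix i assume "i \<in> I"
      then show "norm (E i) \<le> e * tnorm z"
        using strict[OF H] by (simp add: E_def z_def norm_minus_commute)
    qed
    also have "C * (\<Sum>i\<in>I. e * tnorm z) = (C * m * e) * tnorm z" by (simp add: m_def)
    also have "C * m * e \<le> 1 / 2"
    proof -
      have "2 * C * (m + 1) * e = 1" using C(1) m by (simp add: e_def)
      then have "2 * (C * m * e) + 2 * (C * e) = 1" by (simp add: algebra_simps)
      moreover have "0 \<le> C * e" using C(1) e by simp
      ultimately show ?thesis by linarith
    qed
    finally show ?thesis
      using C tnorm_nonneg[of z] by (simp add: z_def mult_right_mono)
  qed
  have "tnorm (\<lambda>j. x j - y j) \<le> 2 * C * tnorm (\<lambda>i. residual g W x i - residual g W y i)"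
    if H: "near r g W x" "near r g W y" for g W x y
  proof -
    let ?n = "\<lambda>i. newton (residual g W x) i - newton (residual g W y) i"
    let ?T = "\<lambda>i. (x i - newton (residual g W x) i) - (y i - newton (residual g W y) i)"
    have "tnorm (\<lambda>j. x j - y j) = tnorm (\<lambda>i. ?T i + ?n i)" by (simp add: algebra_simps)
    also have "\<dots> \<le> tnorm ?T + tnorm ?n" by (rule tnorm_triangle)
    also have "tnorm ?n = tnorm (newton (\<lambda>i. residual g W x i - residual g W y i))"
      by (rule tnorm_cong) (simp add: newton_diff)
    also have "\<dots> \<le> C * tnorm (\<lambda>i. residual g W x i - residual g W y i)" by (rule C(2))
    finally show ?thesis using contr[OF H] by simp
  qed
  note stable = this
  show ?thesis
  proof (rule that[OF r C])
    show "0 < det (g + lin W i x)" if "near r g W x" "i \<in> I" for g W x i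
      using strict[OF that(1) that(1) that(2)] by blast
  qed (rule contr stable; assumption)+
qed

section \<open>A continuous solution of the stage equations\<close>

lemma residual_base: "i \<in> I \<Longrightarrow> residual g0 \<Omega> U i = 0"
  by (simp add: residual_def polar_A flip: A_eq)

lemma residual_cong:
  "(\<And>j. j \<in> I \<Longrightarrow> x j = y j) \<Longrightarrow> i \<in> I \<Longrightarrow> residual g W x i = residual g W y i"
  using lin_cong[of x y W i] by (simp add: residual_def)

lemma isCont_snd_apply:
  fixes q0 :: "(real^'n^'n) \<times> (nat \<Rightarrow> real^'n^'n)"
  shows "isCont (\<lambda>q. snd q j) q0"
proof -
  have "continuous_on UNIV (\<lambda>q :: (real^'n^'n) \<times> (nat \<Rightarrow> real^'n^'n). snd q j)"
    by (rule continuous_on_product_then_coordinatewise) (intro continuous_intros)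
  then show ?thesis using continuous_on_eq_continuous_at[OF open_UNIV] by blast
qed

lemma isCont_residual:
  assumes "0 < det (fst q0 + lin (snd q0) i x)"
  shows "isCont (\<lambda>q. residual (fst q) (snd q) x i) q0"
proof -
  have "isCont (\<lambda>q. fst q + lin (snd q) i x) q0"
    unfolding lin_def by (intro continuous_intros matmul.continuous isCont_snd_apply)
  then have "isCont (\<lambda>q. polar_proj (fst q + lin (snd q) i x)) q0"
    by (rule isCont_o2) (rule isCont_polar_proj[OF assms])
  then show ?thesis unfolding residual_def by (intro continuous_intros)
qed

lemma stage_solution_exists: "\<exists>\<U>. stage_solution s h a g0 \<Omega> U \<U>"
proof -
  obtain r C where r: "0 < r" and C: "0 < C" "\<And>Z. tnorm (newton Z) \<le> C * tnorm Z"
    and det: "\<And>g W x i. near r g W x \<Longrightarrow> i \<in> I \<Longrightarrow> 0 < det (g + lin W i x)"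
    and contr: "\<And>g W x y. near r g W x \<Longrightarrow> near r g W y \<Longrightarrow>
       tnorm (\<lambda>i. (x i - newton (residual g W x) i) - (y i - newton (residual g W y) i))
         \<le> tnorm (\<lambda>j. x j - y j) / 2"
    and stable: "\<And>g W x y. near r g W x \<Longrightarrow> near r g W y \<Longrightarrow>
       tnorm (\<lambda>j. x j - y j) \<le> 2 * C * tnorm (\<lambda>i. residual g W x i - residual g W y i)"
    by (rule residual_contraction) blast
  \<comment> \<open>The third condition bounds the first Newton step from U by r/2, as
    \<open>tuple_fixed_point\<close> demands. It holds near (g0, Omega), where the residual of U is
    continuous and starts from 0.\<close>
  define Q where "Q q \<longleftrightarrow> norm (fst q - g0) < r \<and> tnorm (\<lambda>j. snd q j - \<Omega> j) < r \<and>
    C * tnorm (residual (fst q) (snd q) U) < r / 2" for q :: "(real^'n^'n) \<times> (nat \<Rightarrow> real^'n^'n)"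
  have Q0: "Q (g0, \<Omega>)"
    using r C by (simp add: Q_def tnorm_def residual_base)
  have "\<exists>N. open N \<and> (g0, \<Omega>) \<in> N \<and> (\<forall>q\<in>N. Q q)"
  proof -
    have "isCont (\<lambda>q. tnorm (\<lambda>j. snd q j - \<Omega> j)) (g0, \<Omega>)"
      unfolding tnorm_def by (intro continuous_intros isCont_snd_apply)
    moreover have "isCont (\<lambda>q. norm (fst q - g0)) (g0, \<Omega>)" by (intro continuous_intros)
    moreover have "isCont (\<lambda>q. C * tnorm (residual (fst q) (snd q) U)) (g0, \<Omega>)"
      unfolding tnorm_def by (intro continuous_intros isCont_residual) (simp add: det_A flip: A_eq)
    moreover have "\<forall>\<^sub>F q in nhds (g0, \<Omega>). f q < c"
      if "isCont f (g0, \<Omega>)" "f (g0, \<Omega>) < c" for f and c :: real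
      using that unfolding isCont_def tendsto_at_iff_tendsto_nhds by (rule order_tendstoD(2))
    ultimately have "\<forall>\<^sub>F q in nhds (g0, \<Omega>). Q q"
      using Q0 unfolding Q_def by (intro eventually_conj) auto
    then show ?thesis unfolding eventually_nhds by blast
  qed
  then obtain N where N: "open N" "(g0, \<Omega>) \<in> N" "\<And>q. q \<in> N \<Longrightarrow> Q q" by blast
  have "\<exists>x. tnorm (\<lambda>j. x j - U j) \<le> r \<and> (\<forall>i\<in>I. residual (fst q) (snd q) x i = 0)" if "q \<in> N" for q
  proof -
    have q: "norm (fst q - g0) < r" "tnorm (\<lambda>j. snd q j - \<Omega> j) < r"
      "C * tnorm (residual (fst q) (snd q) U) < r / 2" using N(3)[OF that] by (auto simp: Q_def)
    let ?T = "\<lambda>x i. x i - newton (residual (fst q) (snd q) x) i"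
    obtain x where x: "(\<Sum>i\<in>I. norm (x i - U i)) \<le> r" "\<And>i. i \<in> I \<Longrightarrow> ?T x i = x i"
    proof (rule tuple_fixed_point[OF finite_I, of r U ?T])
      show "(\<Sum>i\<in>I. norm (?T U i - U i)) \<le> r / 2"
        using C(2)[of "residual (fst q) (snd q) U"] q(3) by (simp add: tnorm_def)
      show "(\<Sum>i\<in>I. norm (?T x i - ?T y i)) \<le> (\<Sum>i\<in>I. norm (x i - y i)) / 2"
        if "(\<Sum>i\<in>I. norm (x i - U i)) \<le> r" "(\<Sum>i\<in>I. norm (y i - U i)) \<le> r" for x y
        using contr[of "fst q" "snd q" x y] that q by (simp add: near_def tnorm_def)
    qed (use r in auto)
    \<comment> \<open>A fixed point only says that the Newton correction vanishes;
      \<open>linearized\<close> recovers the residual from it.\<close>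
    have "residual (fst q) (snd q) x i = 0" if i: "i \<in> I" for i
    proof -
      have "residual (fst q) (snd q) x i = linearized (newton (residual (fst q) (snd q) x)) i"
        by (simp add: linearized_newton[OF i])
      also have "\<dots> = linearized (newton (\<lambda>i. 0)) i"
        using x(2) by (intro linearized_cong[OF _ i]) (simp add: newton_0)
      also have "\<dots> = 0" by (rule linearized_newton[OF i])
      finally show ?thesis .
    qed
    then show ?thesis using x(1) by (auto simp: tnorm_def)
  qed
  then have "\<forall>q\<in>N. \<exists>x. tnorm (\<lambda>j. x j - U j) \<le> r \<and> (\<forall>i\<in>I. residual (fst q) (snd q) x i = 0)"
    by blast
  from bchoice[OF this] obtain X where X: "\<And>q. q \<in> N \<Longrightarrow> tnorm (\<lambda>j. X q j - U j) \<le> r"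
    "\<And>q i. q \<in> N \<Longrightarrow> i \<in> I \<Longrightarrow> residual (fst q) (snd q) (X q) i = 0" by blast
  have near: "near r (fst q) (snd q) x" if "q \<in> N" "tnorm (\<lambda>j. x j - U j) \<le> r" for q x
    using N(3)[OF that(1)] that(2) by (auto simp: Q_def near_def)
  \<comment> \<open>Stability against the exact zero X q leaves only the residual of the competitor
    x. With x = U this gives the value at the base point, with x = X q0 continuity at q0.\<close>
  have bound: "norm (x i - X q i) \<le> 2 * C * tnorm (residual (fst q) (snd q) x)"
    if q: "q \<in> N" and x: "tnorm (\<lambda>j. x j - U j) \<le> r" and i: "i \<in> I" for q x i
  proof -
    have "norm (x i - X q i) \<le> tnorm (\<lambda>j. x j - X q j)" using i by (rule norm_le_tnorm)
    also have "\<dots> \<le> 2 * C * tnorm (\<lambda>i. residual (fst q) (snd q) x i - residual (fst q) (snd q) (X q) i)"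
      using q x by (intro stable near X)
    also have "tnorm (\<lambda>i. residual (fst q) (snd q) x i - residual (fst q) (snd q) (X q) i)
        = tnorm (residual (fst q) (snd q) x)"
      by (rule tnorm_cong) (simp add: X q)
    finally show ?thesis .
  qed
  have "stage_solution s h a g0 \<Omega> U (\<lambda>g W. X (g, W))"
    unfolding stage_solution_def I_def[symmetric]
  proof (intro conjI ballI exI[of _ N] N)
    fix i assume i: "i \<in> I"
    have "norm (U i - X (g0, \<Omega>) i) \<le> 2 * C * tnorm (residual g0 \<Omega> U)"
      using bound[OF N(2) _ i, of U] r by (simp add: tnorm_def)
    also have "tnorm (residual g0 \<Omega> U) = 0" by (simp add: tnorm_def residual_base)
    finally show "X (g0, \<Omega>) i = U i" by simp
    have "continuous_on N (\<lambda>q. X q i)"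
      unfolding continuous_on_def
    proof
      fix q0 assume q0: "q0 \<in> N"
      have "isCont (\<lambda>q. 2 * C * tnorm (residual (fst q) (snd q) (X q0))) q0"
        unfolding tnorm_def
        by (intro continuous_intros isCont_residual det near X q0)
      then have "((\<lambda>q. 2 * C * tnorm (residual (fst q) (snd q) (X q0)))
          \<longlongrightarrow> 2 * C * tnorm (residual (fst q0) (snd q0) (X q0))) (at q0 within N)"
        by (rule tendsto_within_subset[OF isContD]) simp
      moreover have "tnorm (residual (fst q0) (snd q0) (X q0)) = 0"
        by (simp add: tnorm_def X q0)
      ultimately have lim: "((\<lambda>q. 2 * C * tnorm (residual (fst q) (snd q) (X q0))) \<longlongrightarrow> 0) (at q0 within N)"
        by simp
      have "((\<lambda>q. X q0 i - X q i) \<longlongrightarrow> 0) (at q0 within N)"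
      proof (rule Lim_null_comparison[OF _ lim])
        show "\<forall>\<^sub>F q in at q0 within N. norm (X q0 i - X q i) \<le> 2 * C * tnorm (residual (fst q) (snd q) (X q0))"
          unfolding eventually_at_filter
          using bound[OF _ X(1)[OF q0] i] by (intro always_eventually) blast
      qed
      from tendsto_diff[OF tendsto_const[of "X q0 i"] this]
      show "((\<lambda>q. X q i) \<longlongrightarrow> X q0 i) (at q0 within N)" by simp
    qed
    then show "continuous_on (N \<inter> SO \<times> skew_pow s) (\<lambda>(g, W). X (g, W) i)"
      unfolding case_prod_beta prod.collapse by (rule continuous_on_subset) blast
  next
    fix q assume "q \<in> N \<inter> SO \<times> skew_pow s"
    then have q: "q \<in> N" by blast
    show "case q of (g, W) \<Rightarrow> \<forall>i\<in>I. 0 < det (stage_mat s h a g W (X (g, W)) i) \<and>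
      X (g, W) i = polar_proj (stage_mat s h a g W (X (g, W)) i)"
      unfolding case_prod_beta prod.collapse stage_mat_eq
    proof (intro ballI conjI)
      fix i assume i: "i \<in> I"
      show "0 < det (fst q + lin (snd q) i (X q))" by (intro det near X q i)
      show "X q i = polar_proj (fst q + lin (snd q) i (X q))"
        using X(2)[OF q i] by (simp add: residual_def)
    qed
  qed
  then show ?thesis by blast
qed

section \<open>Differentiability of every continuous solution\<close>

lemma bounded_linear_lin: 
  assumes "\<And>j. j \<in> I \<Longrightarrow> bounded_linear (\<lambda>v. W v j)"
  shows "bounded_linear (\<lambda>v. lin (W v) i x)"
  unfolding lin_def
  by (intro bounded_linear_const_scaleR bounded_linear_sum
      bounded_linear_compose[OF matmul.bounded_linear_right] assms)

text \<open>The residual of \<open>U + z(p - p0)\<close>, with \<open>z\<close> the expected derivative, is \<open>o(|p - p0|)\<close>, and it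
  bounds the distance of \<open>U + z(p - p0)\<close> from any solution close to \<open>U\<close>.\<close>
lemma stage_solution_derivative:
  fixes G :: "'p::real_normed_vector \<Rightarrow> real^'n^'n" and W :: "'p \<Rightarrow> nat \<Rightarrow> real^'n^'n"
  assumes sol: "stage_solution s h a g0 \<Omega> U \<U>"
    and p0: "p0 \<in> S" "G p0 = g0" "W p0 = \<Omega>"
    and S: "\<And>p. p \<in> S \<Longrightarrow> G p \<in> SO" "\<And>p. p \<in> S \<Longrightarrow> W p \<in> skew_pow s"
    and G': "(G has_derivative G') (at p0 within S)"
    and W': "\<And>j. j \<in> I \<Longrightarrow> ((\<lambda>p. W p j) has_derivative (\<lambda>v. W' v j)) (at p0 within S)"
    and i: "i \<in> I"
  shows "((\<lambda>p. \<U> (G p) (W p) i) has_derivative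
      (\<lambda>v. U i ** R (\<lambda>l. dpolar (A l) (G' v + lin (W' v) l U)) i)) (at p0 within S)" (is ?thesis1)
    and "\<forall>\<^sub>F p in at p0 within S. \<U> (G p) (W p) i \<in> SO" (is ?thesis2)
proof -
  obtain r C where r: "0 < r" and C: "0 < C"
    and stable: "\<And>g W x y. near r g W x \<Longrightarrow> near r g W y \<Longrightarrow>
       tnorm (\<lambda>j. x j - y j) \<le> 2 * C * tnorm (\<lambda>i. residual g W x i - residual g W y i)"
    by (rule residual_contraction) blast
  obtain N where N: "open N" "(g0, \<Omega>) \<in> N"
    and cont: "\<And>i. i \<in> I \<Longrightarrow> continuous_on (N \<inter> SO \<times> skew_pow s) (\<lambda>(g, \<Omega>). \<U> g \<Omega> i)"
    and eqn: "\<And>g W i. (g, W) \<in> N \<inter> SO \<times> skew_pow s \<Longrightarrow> i \<in> I \<Longrightarrow>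
      0 < det (g + lin W i (\<U> g W)) \<and> \<U> g W i = polar_proj (g + lin W i (\<U> g W))"
    and base: "\<And>i. i \<in> I \<Longrightarrow> \<U> g0 \<Omega> i = U i"
    using sol unfolding stage_solution_def stage_mat_eq I_def[symmetric] by blast
  define u where "u p = \<U> (G p) (W p)" for p
  have u0: "\<And>i. i \<in> I \<Longrightarrow> u p0 i = U i" by (simp add: u_def p0 base)
  let ?F = "at p0 within S"
  have inS: "\<forall>\<^sub>F p in ?F. p \<in> S" by (simp add: eventually_at_filter)
  have G_lim: "(G \<longlongrightarrow> g0) ?F"
    using has_derivative_continuous[OF G'] p0 by (simp add: continuous_within)
  have W_lim: "((\<lambda>p. W p j) \<longlongrightarrow> \<Omega> j) ?F" for j
  proof (cases "j \<in> I")
    case True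
    then show ?thesis
      using has_derivative_continuous[OF W'[OF True]] p0 by (simp add: continuous_within)
  next
    case False
    \<comment> \<open>Outside the stages both tuples take the value \<open>undefined\<close>, so
      these components are constant.\<close>
    have "W p j = \<Omega> j" if "p \<in> S" for p
      using S(2)[OF that] \<Omega> False by (auto simp: skew_pow_I PiE_def extensional_def)
    then have "\<forall>\<^sub>F p in ?F. \<Omega> j = W p j"
      using inS by (auto elim: eventually_mono)
    then show ?thesis by (rule Lim_transform_eventually[OF tendsto_const])
  qed
  have q_lim: "((\<lambda>p. (G p, W p)) \<longlongrightarrow> (g0, \<Omega>)) ?F"
    by (intro tendsto_Pair G_lim tendsto_funI W_lim)
  have q_in: "\<forall>\<^sub>F p in ?F. (G p, W p) \<in> N \<inter> SO \<times> skew_pow s"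
    using topological_tendstoD[OF q_lim N] inS by eventually_elim (use S in auto)
  \<comment> \<open>Continuity of the given solution puts it, for p near p0, into the ball where the
    stability bound holds.\<close>
  have u_lim: "((\<lambda>p. u p i) \<longlongrightarrow> U i) ?F" if "i \<in> I" for i
    using continuous_on_tendsto_compose[OF cont[OF that] q_lim _ q_in] N g0 \<Omega>
    by (simp add: u_def base that)
  show ?thesis2
    using q_in
  proof eventually_elim
    case (elim p)
    then show ?case using eqn[OF elim i] polar_proj_SO by metis
  qed
  \<comment> \<open>The derivative predicted by differentiating the stage equations: its tangent
    part solves K X = Y, with Y the partial derivative in the parameters.\<close>
  define z where "z v i = U i ** R (\<lambda>l. dpolar (A l) (G' v + lin (W' v) l U)) i" for v i
  have blG: "bounded_linear G'" using G' by (rule has_derivative_bounded_linear)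
  have blW: "bounded_linear (\<lambda>v. W' v j)" if "j \<in> I" for j
    using W'[OF that] by (rule has_derivative_bounded_linear)
  have blz: "bounded_linear (\<lambda>v. z v i)" if "i \<in> I" for i
    unfolding z_def
    by (intro bounded_linear_compose[OF matmul.bounded_linear_right] bounded_linear_R that dpolar_skew
        bounded_linear_compose[OF bounded_linear_dpolar] bounded_linear_add blG bounded_linear_lin blW)
  have z_lim: "((\<lambda>p. z (p - p0) i) \<longlongrightarrow> 0) ?F" if "i \<in> I" for i
  proof -
    have "((\<lambda>p. z (p - p0) i) \<longlongrightarrow> z (p0 - p0) i) ?F"
      by (intro bounded_linear.tendsto[OF blz[OF that]] tendsto_intros)
    then show ?thesis using linear_0[OF bounded_linear.linear[OF blz[OF that]]] by simp
  qed
  define \<rho> where "\<rho> p i = residual (G p) (W p) (\<lambda>j. U j + z (p - p0) j) i" for p i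
  have z0: "z (p0 - p0) j = 0" if "j \<in> I" for j
    using linear_0[OF bounded_linear.linear[OF blz[OF that]]] by simp
  have \<rho>0: "\<rho> p0 i = 0" if "i \<in> I" for i
  proof -
    have "\<rho> p0 i = residual g0 \<Omega> U i"
      unfolding \<rho>_def p0 using z0 by (intro residual_cong that) simp
    then show ?thesis by (simp add: residual_base that)
  qed
  have \<rho>': "((\<lambda>p. \<rho> p i) has_derivative (\<lambda>v. 0)) ?F" if i: "i \<in> I" for i
  proof -
    have dz: "((\<lambda>p. z (p - p0) j) has_derivative (\<lambda>v. z v j)) ?F" if "j \<in> I" for j
      by (rule bounded_linear.has_derivative[OF blz[OF that]]) (auto intro!: derivative_eq_intros)
    have du: "((\<lambda>p. U j + z (p - p0) j) has_derivative (\<lambda>v. z v j)) ?F" if "j \<in> I" for j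
      using has_derivative_add[OF has_derivative_const dz[OF that]] by simp
    have dm: "((\<lambda>p. (U j + z (p - p0) j) ** W p j) has_derivative
        (\<lambda>v. U j ** W' v j + z v j ** \<Omega> j)) ?F" if "j \<in> I" for j
      using matmul.FDERIV[OF du[OF that] W'[OF that]] p0 z0[OF that] by simp
    have dlin: "((\<lambda>p. lin (W p) i (\<lambda>j. U j + z (p - p0) j)) has_derivative
        (\<lambda>v. h *\<^sub>R (\<Sum>j\<in>I. a i j *\<^sub>R (U j ** W' v j + z v j ** \<Omega> j)))) ?F"
      unfolding lin_def by (intro has_derivative_scaleR_right has_derivative_sum dm)
    have lin_eq: "h *\<^sub>R (\<Sum>j\<in>I. a i j *\<^sub>R (U j ** W' v j + z v j ** \<Omega> j))
        = lin (W' v) i U + lin \<Omega> i (z v)" for v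
      by (simp add: lin_def scaleR_add_right sum.distrib)
    have dA: "((\<lambda>p. G p + lin (W p) i (\<lambda>j. U j + z (p - p0) j)) has_derivative
        (\<lambda>v. G' v + (lin (W' v) i U + lin \<Omega> i (z v)))) ?F"
      using has_derivative_add[OF G' dlin] unfolding lin_eq .
    have A0: "G p0 + lin (W p0) i (\<lambda>j. U j + z (p0 - p0) j) = A i"
    proof -
      have "lin \<Omega> i (\<lambda>j. U j + z (p0 - p0) j) = lin \<Omega> i U" by (rule lin_cong) (simp add: z0[simplified])
      then show ?thesis by (simp add: p0 A_eq)
    qed
    have "((\<lambda>p. polar_proj (G p + lin (W p) i (\<lambda>j. U j + z (p - p0) j))) has_derivative
        (\<lambda>v. U i ** dpolar (A i) (G' v + (lin (W' v) i U + lin \<Omega> i (z v))))) ?F"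
      using has_derivative_compose[OF dA, of polar_proj] polar_proj_has_derivative[OF det_A[OF i]]
      unfolding A0 polar_A[OF i] dpolar_eq[OF det_A[OF i]] by blast
    from has_derivative_diff[OF has_derivative_add[OF has_derivative_const[of "U i"] dz[OF i]] this]
    have "((\<lambda>p. \<rho> p i) has_derivative
        (\<lambda>v. 0 + z v i - U i ** dpolar (A i) (G' v + (lin (W' v) i U + lin \<Omega> i (z v))))) ?F"
      unfolding \<rho>_def residual_def .
    \<comment> \<open>This cancellation is K (R Y) = Y, that is, the differentiated stage
      equation.\<close>
    moreover have "0 + z v i - U i ** dpolar (A i) (G' v + (lin (W' v) i U + lin \<Omega> i (z v))) = 0" for v
    proof -
      define Y where "Y = (\<lambda>l. dpolar (A l) (G' v + lin (W' v) l U))"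
      have "K (R Y) i = Y i" by (rule K_R[OF _ i]) (simp add: Y_def dpolar_skew)
      moreover have "z v = (\<lambda>j. U j ** R Y j)" by (simp add: z_def Y_def fun_eq_iff)
      ultimately have "R Y i = Y i + dpolar (A i) (lin \<Omega> i (z v))"
        by (simp add: K_eq algebra_simps)
      also have "\<dots> = dpolar (A i) (G' v + (lin (W' v) i U + lin \<Omega> i (z v)))"
        by (simp add: Y_def dpolar_add[OF i])
      finally show ?thesis by (simp add: z_def Y_def)
    qed
    ultimately show ?thesis by simp
  qed
  have tnorm_lim: "((\<lambda>p. tnorm (f p)) \<longlongrightarrow> 0) ?F" if "\<And>j. j \<in> I \<Longrightarrow> ((\<lambda>p. f p j) \<longlongrightarrow> 0) ?F" for f
    unfolding tnorm_def by (intro tendsto_null_sum tendsto_norm_zero that)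
  have close: "\<forall>\<^sub>F p in ?F. norm (u p i - U i - z (p - p0) i) \<le> 2 * C * tnorm (\<rho> p)"
  proof -
    have "\<forall>\<^sub>F p in ?F. norm (G p - g0) < r"
      using order_tendstoD(2)[OF tendsto_norm_zero[OF LIM_zero[OF G_lim]] r] .
    moreover have "\<forall>\<^sub>F p in ?F. tnorm (\<lambda>j. W p j - \<Omega> j) < r"
      by (rule order_tendstoD(2)[OF tnorm_lim r]) (intro LIM_zero W_lim)
    moreover have "\<forall>\<^sub>F p in ?F. tnorm (\<lambda>j. u p j - U j) < r"
      by (rule order_tendstoD(2)[OF tnorm_lim r]) (intro LIM_zero u_lim)
    moreover have "\<forall>\<^sub>F p in ?F. tnorm (z (p - p0)) < r"
      by (rule order_tendstoD(2)[OF tnorm_lim r]) (rule z_lim)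
    ultimately show ?thesis
      using q_in
    proof eventually_elim
      case (elim p)
      let ?w = "\<lambda>j. U j + z (p - p0) j"
      have "norm (u p i - U i - z (p - p0) i) = norm (?w i - u p i)"
        by (simp add: norm_minus_commute algebra_simps)
      also have "\<dots> \<le> tnorm (\<lambda>j. ?w j - u p j)" using i by (rule norm_le_tnorm)
      also have "\<dots> \<le> 2 * C * tnorm (\<lambda>i. residual (G p) (W p) ?w i - residual (G p) (W p) (u p) i)"
        using elim by (intro stable) (simp_all add: near_def)
      also have "tnorm (\<lambda>i. residual (G p) (W p) ?w i - residual (G p) (W p) (u p) i) = tnorm (\<rho> p)"
      proof (rule tnorm_cong)
        fix j assume "j \<in> I"
        then show "residual (G p) (W p) ?w j - residual (G p) (W p) (u p) j = \<rho> p j"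
          using eqn[OF elim(5)] by (simp add: \<rho>_def residual_def u_def)
      qed
      finally show ?case .
    qed
  qed
  then obtain d where d: "d > 0" "\<And>p. p \<in> S \<Longrightarrow> p \<noteq> p0 \<Longrightarrow> dist p p0 < d \<Longrightarrow>
      norm (u p i - U i - z (p - p0) i) \<le> 2 * C * tnorm (\<rho> p)"
    unfolding eventually_at by blast
  have "((\<lambda>p. u p i) has_derivative (\<lambda>v. z v i)) ?F"
  proof (rule has_derivativeI_sandwich[OF d(1) blz[OF i]])
    show "norm (u p i - u p0 i - z (p - p0) i) / norm (p - p0) \<le> 2 * C * (\<Sum>j\<in>I. norm (\<rho> p j) / norm (p - p0))"
      if "p \<in> S" "p \<noteq> p0" "dist p p0 < d" for p
      using divide_right_mono[OF d(2)[OF that], of "norm (p - p0)"]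
      by (simp add: u0[OF i] tnorm_def flip: sum_divide_distrib)
    have "((\<lambda>p. norm (\<rho> p j) / norm (p - p0)) \<longlongrightarrow> 0) ?F" if "j \<in> I" for j
      using \<rho>'[OF that] \<rho>0[OF that] by (simp add: has_derivative_iff_norm)
    then show "((\<lambda>p. 2 * C * (\<Sum>j\<in>I. norm (\<rho> p j) / norm (p - p0))) \<longlongrightarrow> 0) ?F"
      by (intro tendsto_mult_right_zero tendsto_null_sum)
  qed
  then show ?thesis1 by (simp add: u_def z_def)
qed


section \<open>Derivatives of the discrete action\<close>

text \<open>The arguments of the adjoints in (1) and (3), and the second bracket of (1)\<close>

definition \<mu> :: "(real^'n^'n \<Rightarrow> real^'n^'n \<Rightarrow> real) \<Rightarrow> real^'n^'n \<Rightarrow> real^'n^'n \<Rightarrow> nat \<Rightarrow> real^'n^'n" where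
  "\<mu> L g1 \<Lambda> i = lt_gradient (\<lambda>Q. L Q (\<Omega> i)) (U i) + Asym (transpose (U i) ** g1 ** \<Lambda> ** transpose (\<Omega> i))"

definition \<nu> :: "(real^'n^'n \<Rightarrow> real^'n^'n \<Rightarrow> real) \<Rightarrow> real^'n^'n \<Rightarrow> real^'n^'n \<Rightarrow> nat \<Rightarrow> real^'n^'n" where
  "\<nu> L g1 \<Lambda> k = skew_gradient (\<lambda>X. L (U k) X) (\<Omega> k) + Asym (transpose (U k) ** g1 ** \<Lambda>)"

text \<open>With \<Lambda> moved next to g1, the constraint term is a plain Frobenius product,
  linear in the end matrix and in g1.\<close>

lemma F_tilde_eq:
  assumes "\<Lambda> \<in> skew"
  shows "F_tilde s h b L \<U> g g1 W \<Lambda> = h * (\<Sum>i\<in>I. b i * L (\<U> g W i) (W i)) +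
    (g + h *\<^sub>R (\<Sum>i\<in>I. b i *\<^sub>R (\<U> g W i ** W i))) \<bullet> (g1 ** \<Lambda>)"
  using skew_inner_Asym[OF assms, of "transpose g1 ** end_mat s h b g W (\<U> g W)"]
  by (simp add: F_tilde_def end_mat_def I_def skew_inner_commute[of \<Lambda>] inner_mult_left)

lemma \<mu>_\<nu>_skew:
  assumes "smooth_on (SO \<times> skew) (\<lambda>(U, \<Omega>). L U \<Omega>)" "i \<in> I"
  shows "\<mu> L g1 \<Lambda> i \<in> skew" "\<nu> L g1 \<Lambda> i \<in> skew"
  using smooth_chain_rule[OF assms(1) U_in_SO[OF assms(2)] \<Omega>_skew[OF assms(2)]]
  unfolding \<mu>_def \<nu>_def by (metis skew_add Asym_skew)+

text \<open>One chain rule for a parameter p entering g and Omega together: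
  \<open>gradient_stage\<close> uses it on \<open>skew\<close>, \<open>gradient_start\<close> along
  curves in \<open>SO\<close>. The formula for F' is confined to skew variations of Omega because
  the gradients of L represent the derivative only there.\<close>

lemma F_tilde_derivative:
  fixes G :: "'p::real_normed_vector \<Rightarrow> real^'n^'n" and W :: "'p \<Rightarrow> nat \<Rightarrow> real^'n^'n"
  assumes L: "smooth_on (SO \<times> skew) (\<lambda>(U, \<Omega>). L U \<Omega>)" and \<Lambda>: "\<Lambda> \<in> skew"
    and sol: "stage_solution s h a g0 \<Omega> U \<U>"
    and p0: "p0 \<in> S" "G p0 = g0" "W p0 = \<Omega>"
    and S: "\<And>p. p \<in> S \<Longrightarrow> G p \<in> SO" "\<And>p. p \<in> S \<Longrightarrow> W p \<in> skew_pow s"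
    and G': "(G has_derivative G') (at p0 within S)"
    and W': "\<And>j. j \<in> I \<Longrightarrow> ((\<lambda>p. W p j) has_derivative (\<lambda>v. W' v j)) (at p0 within S)"
  obtains F' where
    "((\<lambda>p. F_tilde s h b L \<U> (G p) g1 (W p) \<Lambda>) has_derivative F') (at p0 within S)"
    "\<And>v. (\<And>j. j \<in> I \<Longrightarrow> W' v j \<in> skew) \<Longrightarrow> F' v =
      h * (\<Sum>i\<in>I. b i * (skew_inner (\<mu> L g1 \<Lambda> i) (R (\<lambda>l. dpolar (A l) (G' v + lin (W' v) l U)) i)
                        + skew_inner (\<nu> L g1 \<Lambda> i) (W' v i))) + G' v \<bullet> (g1 ** \<Lambda>)"
proof -
  let ?F = "at p0 within S"
  define X where "X v = R (\<lambda>l. dpolar (A l) (G' v + lin (W' v) l U))" for v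
  have du: "((\<lambda>p. \<U> (G p) (W p) i) has_derivative (\<lambda>v. U i ** X v i)) ?F"
    "\<forall>\<^sub>F p in ?F. \<U> (G p) (W p) i \<in> SO" if "i \<in> I" for i
    unfolding X_def
    by (rule stage_solution_derivative[where G = G and W = W and G' = G' and W' = W' and S = S,
          OF sol p0 _ _ G' _ that], fact S, fact S, fact W')+
  have u0: "\<U> (G p0) (W p0) i = U i" if "i \<in> I" for i
    using sol that by (simp add: stage_solution_def p0 I_def)
  have X_skew: "X v i \<in> skew" if "i \<in> I" for v i
    unfolding X_def using that by (intro R_skew dpolar_skew)
  have "\<forall>i\<in>I. \<exists>l. ((\<lambda>p. L (\<U> (G p) (W p) i) (W p i)) has_derivative (\<lambda>v. l (U i ** X v i, W' v i))) ?F \<and>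
    (\<forall>X\<in>skew. \<forall>Y\<in>skew. l (U i ** X, Y) = skew_inner (lt_gradient (\<lambda>Q. L Q (\<Omega> i)) (U i)) X
       + skew_inner (skew_gradient (L (U i)) (\<Omega> i)) Y)"
  proof
    fix i assume i: "i \<in> I"
    show "\<exists>l. ((\<lambda>p. L (\<U> (G p) (W p) i) (W p i)) has_derivative (\<lambda>v. l (U i ** X v i, W' v i))) ?F \<and>
    (\<forall>X\<in>skew. \<forall>Y\<in>skew. l (U i ** X, Y) = skew_inner (lt_gradient (\<lambda>Q. L Q (\<Omega> i)) (U i)) X
       + skew_inner (skew_gradient (L (U i)) (\<Omega> i)) Y)"
    proof (rule smooth_chain_rule[OF L U_in_SO[OF i] \<Omega>_skew[OF i], where ?'p = 'p])
      fix l
      assume l: "\<And>X Y. X \<in> skew \<Longrightarrow> Y \<in> skew \<Longrightarrow> l (U i ** X, Y) =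
          skew_inner (lt_gradient (\<lambda>Q. L Q (\<Omega> i)) (U i)) X + skew_inner (skew_gradient (L (U i)) (\<Omega> i)) Y"
        and chain: "\<And>(u :: 'p \<Rightarrow> real^'n^'n) u' w w' p0 S. p0 \<in> S \<Longrightarrow> u p0 = U i \<Longrightarrow> w p0 = \<Omega> i \<Longrightarrow>
         (u has_derivative u') (at p0 within S) \<Longrightarrow> (w has_derivative w') (at p0 within S) \<Longrightarrow>
         (\<forall>\<^sub>F p in at p0 within S. u p \<in> SO \<and> w p \<in> skew) \<Longrightarrow>
         ((\<lambda>p. L (u p) (w p)) has_derivative (\<lambda>v. l (u' v, w' v))) (at p0 within S)"
      have "\<forall>\<^sub>F p in ?F. p \<in> S" by (simp add: eventually_at_filter)
      with du(2)[OF i] have "\<forall>\<^sub>F p in ?F. \<U> (G p) (W p) i \<in> SO \<and> W p i \<in> skew"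
        by eventually_elim (use S(2) i in \<open>auto simp: skew_pow_I\<close>)
      with du(1)[OF i] W'[OF i] u0[OF i] p0
      have "((\<lambda>p. L (\<U> (G p) (W p) i) (W p i)) has_derivative (\<lambda>v. l (U i ** X v i, W' v i))) ?F"
        by (intro chain) simp_all
      then show ?thesis using l by blast
    qed
  qed
  from bchoice[OF this] obtain l where
    dL: "\<And>i. i \<in> I \<Longrightarrow> ((\<lambda>p. L (\<U> (G p) (W p) i) (W p i)) has_derivative (\<lambda>v. l i (U i ** X v i, W' v i))) ?F"
    and l: "\<And>i X Y. i \<in> I \<Longrightarrow> X \<in> skew \<Longrightarrow> Y \<in> skew \<Longrightarrow> l i (U i ** X, Y) =
      skew_inner (lt_gradient (\<lambda>Q. L Q (\<Omega> i)) (U i)) X + skew_inner (skew_gradient (L (U i)) (\<Omega> i)) Y"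
    by blast
  have dUW: "((\<lambda>p. \<U> (G p) (W p) i ** W p i) has_derivative
      (\<lambda>v. U i ** W' v i + U i ** X v i ** \<Omega> i)) ?F" if "i \<in> I" for i
    using matmul.FDERIV[OF du(1)[OF that] W'[OF that]] by (simp add: u0[OF that, unfolded p0] p0)
  define F' where "F' v = h * (\<Sum>i\<in>I. b i * l i (U i ** X v i, W' v i)) +
    (G' v + h *\<^sub>R (\<Sum>i\<in>I. b i *\<^sub>R (U i ** W' v i + U i ** X v i ** \<Omega> i))) \<bullet> (g1 ** \<Lambda>)" for v
  show ?thesis
  proof (rule that)
    show "((\<lambda>p. F_tilde s h b L \<U> (G p) g1 (W p) \<Lambda>) has_derivative F') ?F"
      unfolding F_tilde_eq[OF \<Lambda>] F'_def
      by (intro has_derivative_add has_derivative_mult_right has_derivative_sum has_derivative_inner_left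
          has_derivative_scaleR_right G' dL dUW)
    fix v assume v: "\<And>j. j \<in> I \<Longrightarrow> W' v j \<in> skew"
    \<comment> \<open>At each stage the multiplier contributes to the variation of U i and to that
      of Omega i; moving factors across the trace merges these with the derivatives of L into
      \<open>\<mu>\<close> and \<open>\<nu>\<close>.\<close>
    have "b i * l i (U i ** X v i, W' v i) + b i * ((U i ** W' v i + U i ** X v i ** \<Omega> i) \<bullet> (g1 ** \<Lambda>))
        = b i * (skew_inner (\<mu> L g1 \<Lambda> i) (X v i) + skew_inner (\<nu> L g1 \<Lambda> i) (W' v i))" if i: "i \<in> I" for i
    proof -
      have "(U i ** X v i ** \<Omega> i) \<bullet> (g1 ** \<Lambda>) = X v i \<bullet> (transpose (U i) ** g1 ** \<Lambda> ** transpose (\<Omega> i))"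
        by (simp only: inner_mult_right[of "U i ** X v i"] inner_mult_left[of "U i"] matrix_mul_assoc)
      also have "\<dots> = skew_inner (Asym (transpose (U i) ** g1 ** \<Lambda> ** transpose (\<Omega> i))) (X v i)"
        by (simp add: skew_inner_Asym X_skew[OF i] inner_commute)
      finally have 1: "(U i ** X v i ** \<Omega> i) \<bullet> (g1 ** \<Lambda>) = \<dots>" .
      have "(U i ** W' v i) \<bullet> (g1 ** \<Lambda>) = W' v i \<bullet> (transpose (U i) ** g1 ** \<Lambda>)"
        by (simp only: inner_mult_left[of "U i"] matrix_mul_assoc)
      also have "\<dots> = skew_inner (Asym (transpose (U i) ** g1 ** \<Lambda>)) (W' v i)"
        by (simp add: skew_inner_Asym v[OF i] inner_commute)
      finally have 2: "(U i ** W' v i) \<bullet> (g1 ** \<Lambda>) = \<dots>" .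
      show ?thesis
        unfolding inner_add_left 1 2 l[OF i X_skew[OF i] v[OF i]] \<mu>_def \<nu>_def skew_inner.add_left
        by (simp add: algebra_simps)
    qed
    then have "(\<Sum>i\<in>I. b i * l i (U i ** X v i, W' v i)) + (\<Sum>i\<in>I. b i * ((U i ** W' v i + U i ** X v i ** \<Omega> i) \<bullet> (g1 ** \<Lambda>)))
      = (\<Sum>i\<in>I. b i * (skew_inner (\<mu> L g1 \<Lambda> i) (X v i) + skew_inner (\<nu> L g1 \<Lambda> i) (W' v i)))"
      unfolding sum.distrib[symmetric] by (rule sum.cong[OF refl])
    moreover have "F' v = h * ((\<Sum>i\<in>I. b i * l i (U i ** X v i, W' v i))
        + (\<Sum>i\<in>I. b i * ((U i ** W' v i + U i ** X v i ** \<Omega> i) \<bullet> (g1 ** \<Lambda>)))) + G' v \<bullet> (g1 ** \<Lambda>)"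
      unfolding F'_def inner_add_left[of "G' v"] inner_scaleR_left inner_sum_left distrib_left by simp
    ultimately show "F' v = h * (\<Sum>i\<in>I. b i * (skew_inner (\<mu> L g1 \<Lambda> i) (R (\<lambda>l. dpolar (A l) (G' v + lin (W' v) l U)) i)
                        + skew_inner (\<nu> L g1 \<Lambda> i) (W' v i))) + G' v \<bullet> (g1 ** \<Lambda>)"
      by (simp add: X_def)
  qed
qed

text \<open>The stage matrices contribute one factor h and the weights of the action another, so the
  gradient is h times the right-hand side of (1).\<close>

lemma gradient_stage:
  assumes L: "smooth_on (SO \<times> skew) (\<lambda>(U, \<Omega>). L U \<Omega>)" and \<Lambda>: "\<Lambda> \<in> skew"
    and sol: "stage_solution s h a g0 \<Omega> U \<U>" and k: "k \<in> I"
  shows "has_skew_gradient (\<lambda>X. F_tilde s h b L \<U> g0 g1 (fun_upd \<Omega> k X) \<Lambda>)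
    (h *\<^sub>R (h *\<^sub>R (\<Sum>i\<in>I. b i *\<^sub>R
        skew_adjoint (pi_map i \<circ> phi_inv s h a g0 \<Omega> U \<circ> psi_map s h a g0 \<Omega> U k) (\<mu> L g1 \<Lambda> i))
      + b k *\<^sub>R \<nu> L g1 \<Lambda> k)) (\<Omega> k)"
proof -
  let ?adj = "\<lambda>i. skew_adjoint (pi_map i \<circ> phi_inv s h a g0 \<Omega> U \<circ> psi_map s h a g0 \<Omega> U k) (\<mu> L g1 \<Lambda> i)"
  let ?D = "h *\<^sub>R (h *\<^sub>R (\<Sum>i\<in>I. b i *\<^sub>R ?adj i) + b k *\<^sub>R \<nu> L g1 \<Lambda> k)"
  note skew = \<mu>_\<nu>_skew[OF L]
  have D: "?D \<in> skew"
    using k skew_adjoint_skew(1)[OF skew(1)]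
    by (intro skew_scaleR skew_add skew_sum skew) auto
  obtain F' where F': "((\<lambda>X. F_tilde s h b L \<U> g0 g1 (fun_upd \<Omega> k X) \<Lambda>) has_derivative F') (at (\<Omega> k) within skew)"
    and F'_eq: "\<And>v. (\<And>j. j \<in> I \<Longrightarrow> (if j = k then v else 0) \<in> skew) \<Longrightarrow> F' v =
      h * (\<Sum>i\<in>I. b i * (skew_inner (\<mu> L g1 \<Lambda> i) (R (\<lambda>l. dpolar (A l) (0 + lin (\<lambda>j. if j = k then v else 0) l U)) i)
                        + skew_inner (\<nu> L g1 \<Lambda> i) (if i = k then v else 0))) + 0 \<bullet> (g1 ** \<Lambda>)"
  proof (rule F_tilde_derivative[OF L \<Lambda> sol, where ?p0.0 = "\<Omega> k" and S = skew and G = "\<lambda>_. g0"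
        and G' = "\<lambda>_. 0" and W = "\<lambda>X. fun_upd \<Omega> k X" and W' = "\<lambda>v j. if j = k then v else 0"
        and b = b and ?g1.0 = g1])
    show "fun_upd \<Omega> k X \<in> skew_pow s" if "X \<in> skew" for X
      using that k \<Omega> by (auto simp: skew_pow_I PiE_def extensional_def)
    show "((\<lambda>X. fun_upd \<Omega> k X j) has_derivative (\<lambda>v. if j = k then v else 0)) (at (\<Omega> k) within skew)" for j
      by (cases "j = k") (simp_all add: has_derivative_ident)
  qed (use g0 \<Omega>_skew[OF k] in auto)
  have "F' v = skew_inner ?D v" if v: "v \<in> skew" for v
  proof -
    have "lin (\<lambda>j. if j = k then v else 0) l U = h *\<^sub>R (a l k *\<^sub>R (U k ** v))" for l
    proof -
      have "(\<Sum>j\<in>I. a l j *\<^sub>R (U j ** (if j = k then v else 0))) = (\<Sum>j\<in>I. if j = k then a l j *\<^sub>R (U j ** v) else 0)"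
        by (intro sum.cong refl) (simp add: matmul.zero_right)
      then show ?thesis using k by (simp add: lin_def)
    qed
    then have 1: "R (\<lambda>l. dpolar (A l) (0 + lin (\<lambda>j. if j = k then v else 0) l U)) i
        = h *\<^sub>R R (\<lambda>l. dpolar (A l) (a l k *\<^sub>R (U k ** v))) i" if i: "i \<in> I" for i
    proof -
      have "R (\<lambda>l. dpolar (A l) (h *\<^sub>R (a l k *\<^sub>R (U k ** v)))) i
          = R (\<lambda>l. h *\<^sub>R dpolar (A l) (a l k *\<^sub>R (U k ** v))) i"
        by (rule fun_cong[OF R_cong]) (rule linear_scale[OF bounded_linear.linear[OF bounded_linear_dpolar]])
      then show ?thesis using i by (simp add: \<open>\<And>l. lin _ l U = _\<close> R_scaleR dpolar_skew)
    qed
    have "F' v = h * (\<Sum>i\<in>I. b i * (skew_inner (\<mu> L g1 \<Lambda> i) (h *\<^sub>R R (\<lambda>l. dpolar (A l) (a l k *\<^sub>R (U k ** v))) i)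
        + skew_inner (\<nu> L g1 \<Lambda> i) (if i = k then v else 0)))"
      using F'_eq[of v] v 1 by simp
    also have "\<dots> = h * ((\<Sum>i\<in>I. h * (b i * skew_inner (?adj i) v)) + (\<Sum>i\<in>I. if i = k then b i * skew_inner (\<nu> L g1 \<Lambda> i) v else 0))"
      unfolding sum.distrib[symmetric]
    proof (intro arg_cong[where f = "\<lambda>x. h * x"] sum.cong refl)
      fix i assume i: "i \<in> I"
      show "b i * (skew_inner (\<mu> L g1 \<Lambda> i) (h *\<^sub>R R (\<lambda>l. dpolar (A l) (a l k *\<^sub>R (U k ** v))) i)
          + skew_inner (\<nu> L g1 \<Lambda> i) (if i = k then v else 0))
        = h * (b i * skew_inner (?adj i) v) + (if i = k then b i * skew_inner (\<nu> L g1 \<Lambda> i) v else 0)"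
        unfolding skew_adjoint_psi_inner[OF skew(1)[OF i] i v]
        by (simp add: skew_inner.scaleR_right skew_inner.zero_right algebra_simps)
    qed
    also have "\<dots> = skew_inner ?D v"
      using k by (simp add: skew_inner.scaleR_left skew_inner.add_left skew_inner.sum_left
          sum_distrib_left distrib_left)
    finally show ?thesis .
  qed
  then have "((\<lambda>X. F_tilde s h b L \<U> g0 g1 (fun_upd \<Omega> k X) \<Lambda>) has_derivative skew_inner ?D) (at (\<Omega> k) within skew)"
    using has_derivative_within_subspace_cong[OF subspace_skew \<Omega>_skew[OF k] F' skew_inner.bounded_linear_right]
    by simp
  with D show ?thesis by (simp add: has_skew_gradient_def)
qed

lemma gradient_multiplier:
  assumes "\<Lambda> \<in> skew"
  shows "has_skew_gradient (\<lambda>M. F_tilde s h b L \<U> g0 g1 \<Omega> M)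
    (Asym (transpose g1 ** end_mat s h b g0 \<Omega> (\<U> g0 \<Omega>))) \<Lambda>"
  unfolding has_skew_gradient_def F_tilde_def
proof (intro conjI Asym_skew)
  define E where "E = Asym (transpose g1 ** end_mat s h b g0 \<Omega> (\<U> g0 \<Omega>))"
  define c where "c = h * (\<Sum>i = 1..s. b i * L (\<U> g0 \<Omega> i) (\<Omega> i))"
  have "((\<lambda>M. c + skew_inner M E) has_derivative (\<lambda>v. 0 + skew_inner v E)) (at \<Lambda> within skew)"
    by (intro has_derivative_add has_derivative_const
        bounded_linear.has_derivative[OF skew_inner.bounded_linear_left] has_derivative_ident)
  then show "((\<lambda>M. c + skew_inner M E) has_derivative skew_inner E) (at \<Lambda> within skew)"
    by (simp add: skew_inner_commute[of _ E])
qed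

text \<open>Along a curve in g the Omega_j are constant, so the \<open>\<nu>\<close> terms drop out;
  F' is linear on the reals and determined by F' 1.\<close>

lemma gradient_start:
  assumes L: "smooth_on (SO \<times> skew) (\<lambda>(U, \<Omega>). L U \<Omega>)" and \<Lambda>: "\<Lambda> \<in> skew"
    and sol: "stage_solution s h a g0 \<Omega> U \<U>"
  shows "has_lt_gradient (\<lambda>g. F_tilde s h b L \<U> g g1 \<Omega> \<Lambda>)
    (h *\<^sub>R (\<Sum>i\<in>I. b i *\<^sub>R
        skew_adjoint (pi_map i \<circ> phi_inv s h a g0 \<Omega> U \<circ> varphi_map s h a g0 \<Omega> U) (\<mu> L g1 \<Lambda> i))
      + Asym (transpose g0 ** g1 ** \<Lambda>)) g0"
proof -
  let ?adj = "\<lambda>i. skew_adjoint (pi_map i \<circ> phi_inv s h a g0 \<Omega> U \<circ> varphi_map s h a g0 \<Omega> U) (\<mu> L g1 \<Lambda> i)"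
  let ?D = "h *\<^sub>R (\<Sum>i\<in>I. b i *\<^sub>R ?adj i) + Asym (transpose g0 ** g1 ** \<Lambda>)"
  note skew = \<mu>_\<nu>_skew[OF L]
  have D: "?D \<in> skew"
    using skew_adjoint_skew(2)[OF skew(1)]
    by (intro skew_scaleR skew_add skew_sum Asym_skew) auto
  show ?thesis
    unfolding has_lt_gradient_def
  proof (intro conjI D allI impI)
    fix \<gamma> :: "real \<Rightarrow> real^'n^'n" and \<eta>
    assume \<eta>: "\<eta> \<in> skew" and \<gamma>: "\<forall>t. \<gamma> t \<in> SO" "\<gamma> 0 = g0" "(\<gamma> has_vector_derivative g0 ** \<eta>) (at 0)"
    obtain F' where F': "((\<lambda>t. F_tilde s h b L \<U> (\<gamma> t) g1 \<Omega> \<Lambda>) has_derivative F') (at 0)"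
      and F'_eq: "\<And>v. (\<And>j. j \<in> I \<Longrightarrow> (0 :: real^'n^'n) \<in> skew) \<Longrightarrow> F' v =
      h * (\<Sum>i\<in>I. b i * (skew_inner (\<mu> L g1 \<Lambda> i) (R (\<lambda>l. dpolar (A l) (v *\<^sub>R (g0 ** \<eta>) + lin (\<lambda>j. 0) l U)) i)
                        + skew_inner (\<nu> L g1 \<Lambda> i) 0)) + (v *\<^sub>R (g0 ** \<eta>)) \<bullet> (g1 ** \<Lambda>)"
      by (rule F_tilde_derivative[OF L \<Lambda> sol, where ?p0.0 = "0::real" and S = UNIV and G = \<gamma>
          and G' = "\<lambda>t. t *\<^sub>R (g0 ** \<eta>)" and W = "\<lambda>_. \<Omega>" and W' = "\<lambda>v j. 0" and b = b and ?g1.0 = g1])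
        (use \<gamma> \<Omega> in \<open>auto simp: has_vector_derivative_def\<close>)
    have "lin (\<lambda>j. 0) l U = 0" for l by (simp add: lin_def matmul.zero_right)
    then have "F' 1 = h * (\<Sum>i\<in>I. b i * skew_inner (\<mu> L g1 \<Lambda> i) (R (\<lambda>l. dpolar (A l) (g0 ** \<eta>)) i))
        + (g0 ** \<eta>) \<bullet> (g1 ** \<Lambda>)"
      by (simp add: F'_eq skew_inner.zero_right)
    also have "(\<Sum>i\<in>I. b i * skew_inner (\<mu> L g1 \<Lambda> i) (R (\<lambda>l. dpolar (A l) (g0 ** \<eta>)) i))
        = (\<Sum>i\<in>I. b i * skew_inner (?adj i) \<eta>)"
      by (intro sum.cong refl) (simp only: skew_adjoint_varphi_inner[OF skew(1) _ \<eta>])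
    also have "(g0 ** \<eta>) \<bullet> (g1 ** \<Lambda>) = skew_inner (Asym (transpose g0 ** g1 ** \<Lambda>)) \<eta>"
      by (simp add: skew_inner_Asym[OF \<eta>] inner_mult_left[of g0] matrix_mul_assoc inner_commute)
    finally have F'1: "F' 1 = skew_inner ?D \<eta>"
      by (simp only: skew_inner.add_left skew_inner.scaleR_left skew_inner.sum_left real_scaleR_def)
    have "F' = (*) (skew_inner ?D \<eta>)"
    proof
      fix t show "F' t = skew_inner ?D \<eta> * t"
        using linear_scale[OF bounded_linear.linear[OF has_derivative_bounded_linear[OF F']], of t 1]
        unfolding F'1 by simp
    qed
    with F' show "((\<lambda>t. F_tilde s h b L \<U> (\<gamma> t) g1 \<Omega> \<Lambda>) has_real_derivative skew_inner ?D \<eta>) (at 0)"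
      by (simp only: has_field_derivative_def)
  qed
qed

text \<open>The stages do not depend on g1: the action sum is constant, and the multiplier term is
  linear in g1.\<close>

lemma gradient_end:
  assumes \<Lambda>: "\<Lambda> \<in> skew"
  shows "has_lt_gradient (\<lambda>g. F_tilde s h b L \<U> g0 g \<Omega> \<Lambda>)
    (Asym (transpose g1 ** end_mat s h b g0 \<Omega> (\<U> g0 \<Omega>) ** transpose \<Lambda>)) g1"
  unfolding has_lt_gradient_def
proof (intro conjI Asym_skew allI impI)
  fix \<gamma> :: "real \<Rightarrow> real^'n^'n" and \<eta>
  assume \<eta>: "\<eta> \<in> skew" and \<gamma>: "\<gamma> 0 = g1" "(\<gamma> has_vector_derivative g1 ** \<eta>) (at 0)"
  define E where "E = end_mat s h b g0 \<Omega> (\<U> g0 \<Omega>)"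
  define c where "c = h * (\<Sum>i\<in>I. b i * L (\<U> g0 \<Omega> i) (\<Omega> i))"
  have F: "F_tilde s h b L \<U> g0 g \<Omega> \<Lambda> = c + E \<bullet> (g ** \<Lambda>)" for g
    by (simp add: F_tilde_eq[OF \<Lambda>] c_def E_def end_mat_def I_def)
  have "((\<lambda>t. c + E \<bullet> (\<gamma> t ** \<Lambda>)) has_derivative (\<lambda>t. 0 + E \<bullet> ((t *\<^sub>R (g1 ** \<eta>)) ** \<Lambda>))) (at 0)"
    by (intro has_derivative_add has_derivative_const has_derivative_inner_right
        bounded_linear.has_derivative[OF matmul.bounded_linear_left] \<gamma>(2)[unfolded has_vector_derivative_def])
  moreover have "(\<lambda>t. 0 + E \<bullet> ((t *\<^sub>R (g1 ** \<eta>)) ** \<Lambda>))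
      = (*) (skew_inner (Asym (transpose g1 ** E ** transpose \<Lambda>)) \<eta>)"
  proof
    fix t :: real
    have "(transpose g1 ** E ** transpose \<Lambda>) \<bullet> \<eta> = (transpose g1 ** E) \<bullet> (\<eta> ** \<Lambda>)"
      by (simp add: inner_mult_right[of "transpose g1 ** E"])
    also have "\<dots> = E \<bullet> (g1 ** \<eta> ** \<Lambda>)"
      by (simp add: inner_mult_left[of "transpose g1"] matrix_mul_assoc)
    finally show "0 + E \<bullet> ((t *\<^sub>R (g1 ** \<eta>)) ** \<Lambda>) = skew_inner (Asym (transpose g1 ** E ** transpose \<Lambda>)) \<eta> * t"
      by (simp add: skew_inner_Asym[OF \<eta>] scaleR_matrix_mult)
  qed
  ultimately show "((\<lambda>t. F_tilde s h b L \<U> g0 (\<gamma> t) \<Omega> \<Lambda>) has_real_derivative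
      skew_inner (Asym (transpose g1 ** end_mat s h b g0 \<Omega> (\<U> g0 \<Omega>) ** transpose \<Lambda>)) \<eta>) (at 0)"
    unfolding F has_field_derivative_def by (simp only: E_def)
qed

end

text \<open>A vanishing \<open>Asym\<close> says only that g^T E is symmetric. Together with
  positivity, E = g (g^T E) is a polar decomposition, and its uniqueness identifies g.\<close>

lemma Asym_eq_0_iff_polar_proj:
  fixes E :: "real^'n^'n"
  assumes "g \<in> SO" "posdef (transpose g ** E)"
  shows "Asym (transpose g ** E) = 0 \<longleftrightarrow> g = polar_proj E"
proof
  have E: "E = g ** (transpose g ** E)" using assms(1) by (simp add: SO_cancel)
  {
    assume "Asym (transpose g ** E) = 0"
    then have "sym_pos_def (transpose g ** E)" using assms(2) by (simp add: sym_pos_def_iff Asym_def)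
    then have "polar_decomp E g (transpose g ** E)" using assms(1) E by (simp add: polar_decomp_def)
    then show "g = polar_proj E" using polar_proj_eqI by metis
  }
  have "0 < det g * det (transpose g ** E)"
    using posdef_det_pos[OF assms(2)] det_SO[OF assms(1)] by simp
  then have "0 < det E" using E det_mul by metis
  moreover assume "g = polar_proj E"
  ultimately have "transpose (transpose g ** E) = transpose g ** E"
    using polar_proj_decomp[of E] by (simp add: polar_decomp_def sym_pos_def_def)
  then show "Asym (transpose g ** E) = 0" by (simp add: Asym_def)
qed


section \<open>Assembling the equations of the theorem\<close>

context internal_stages
begin

text \<open>Gradients are unique, so prescribing one means equating it with the computed gradient.
  The equivalence then holds equation by equation.\<close>

lemma variational_equations_iff:
  assumes h: "0 < h" and L: "smooth_on (SO \<times> skew) (\<lambda>(U, \<Omega>). L U \<Omega>)"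
    and g1: "g1 \<in> SO" and \<Lambda>: "\<Lambda> \<in> skew"
    and pd: "posdef (transpose g1 ** end_mat s h b g0 \<Omega> U)"
    and sol: "stage_solution s h a g0 \<Omega> U \<U>"
  shows "((\<forall>k\<in>{1..s}. has_skew_gradient (\<lambda>X. F_tilde s h b L \<U> g0 g1 (fun_upd \<Omega> k X) \<Lambda>) 0 (\<Omega> k)) \<and>
          has_skew_gradient (\<lambda>M. F_tilde s h b L \<U> g0 g1 \<Omega> M) 0 \<Lambda> \<and>
          has_lt_gradient (\<lambda>g. F_tilde s h b L \<U> g g1 \<Omega> \<Lambda>) (- p0) g0 \<and>
          has_lt_gradient (\<lambda>g. F_tilde s h b L \<U> g0 g \<Omega> \<Lambda>) p1 g1)
         \<longleftrightarrow>
         ((\<forall>k\<in>{1..s}.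
             0 = h *\<^sub>R (\<Sum>i=1..s. b i *\<^sub>R
                   skew_adjoint (pi_map i \<circ> phi_inv s h a g0 \<Omega> U \<circ> psi_map s h a g0 \<Omega> U k)
                     (lt_gradient (\<lambda>Q. L Q (\<Omega> i)) (U i)
                      + Asym (transpose (U i) ** g1 ** \<Lambda> ** transpose (\<Omega> i))))
                 + b k *\<^sub>R (skew_gradient (\<lambda>X. L (U k) X) (\<Omega> k)
                            + Asym (transpose (U k) ** g1 ** \<Lambda>))) \<and>
          g1 = polar_proj (end_mat s h b g0 \<Omega> U) \<and>
          - p0 = h *\<^sub>R (\<Sum>i=1..s. b i *\<^sub>R
                   skew_adjoint (pi_map i \<circ> phi_inv s h a g0 \<Omega> U \<circ> varphi_map s h a g0 \<Omega> U)
                     (lt_gradient (\<lambda>Q. L Q (\<Omega> i)) (U i)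
                      + Asym (transpose (U i) ** g1 ** \<Lambda> ** transpose (\<Omega> i))))
                 + Asym (transpose g0 ** g1 ** \<Lambda>) \<and>
          p1 = Asym (transpose g1 ** end_mat s h b g0 \<Omega> U ** transpose \<Lambda>))"
  unfolding I_def[symmetric] \<mu>_def[symmetric] \<nu>_def[symmetric]
proof (intro conj_cong ball_cong refl)
  fix k assume k: "k \<in> I"
  define D where "D = h *\<^sub>R (\<Sum>i\<in>I. b i *\<^sub>R
        skew_adjoint (pi_map i \<circ> phi_inv s h a g0 \<Omega> U \<circ> psi_map s h a g0 \<Omega> U k) (\<mu> L g1 \<Lambda> i))
      + b k *\<^sub>R \<nu> L g1 \<Lambda> k"
  have "has_skew_gradient (\<lambda>X. F_tilde s h b L \<U> g0 g1 (fun_upd \<Omega> k X) \<Lambda>) (h *\<^sub>R D) (\<Omega> k)"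
    unfolding D_def by (rule gradient_stage[OF L \<Lambda> sol k])
  then have "has_skew_gradient (\<lambda>X. F_tilde s h b L \<U> g0 g1 (fun_upd \<Omega> k X) \<Lambda>) 0 (\<Omega> k) \<longleftrightarrow> 0 = h *\<^sub>R D"
    by (rule has_skew_gradient_iff[OF \<Omega>_skew[OF k]])
  \<comment> \<open>Cancels the extra factor h of \<open>gradient_stage\<close>.\<close>
  also have "\<dots> \<longleftrightarrow> 0 = D" using h by auto
  finally show "has_skew_gradient (\<lambda>X. F_tilde s h b L \<U> g0 g1 (fun_upd \<Omega> k X) \<Lambda>) 0 (\<Omega> k) \<longleftrightarrow>
     0 = h *\<^sub>R (\<Sum>i\<in>I. b i *\<^sub>R
        skew_adjoint (pi_map i \<circ> phi_inv s h a g0 \<Omega> U \<circ> psi_map s h a g0 \<Omega> U k) (\<mu> L g1 \<Lambda> i))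
      + b k *\<^sub>R \<nu> L g1 \<Lambda> k"
    unfolding D_def .
next
  have E: "end_mat s h b g0 \<Omega> (\<U> g0 \<Omega>) = end_mat s h b g0 \<Omega> U"
    using sol by (simp add: end_mat_def stage_solution_def)
  have "has_skew_gradient (\<lambda>M. F_tilde s h b L \<U> g0 g1 \<Omega> M) 0 \<Lambda>
      \<longleftrightarrow> 0 = Asym (transpose g1 ** end_mat s h b g0 \<Omega> U)"
    unfolding E[symmetric] by (rule has_skew_gradient_iff[OF \<Lambda> gradient_multiplier[OF \<Lambda>]])
  then show "has_skew_gradient (\<lambda>M. F_tilde s h b L \<U> g0 g1 \<Omega> M) 0 \<Lambda>
      \<longleftrightarrow> g1 = polar_proj (end_mat s h b g0 \<Omega> U)"
    using Asym_eq_0_iff_polar_proj[OF g1 pd] by (simp add: eq_commute[of 0])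
  show "has_lt_gradient (\<lambda>g. F_tilde s h b L \<U> g0 g \<Omega> \<Lambda>) p1 g1 \<longleftrightarrow>
      p1 = Asym (transpose g1 ** end_mat s h b g0 \<Omega> U ** transpose \<Lambda>)"
    unfolding E[symmetric] by (rule has_lt_gradient_iff[OF g1 gradient_end[OF \<Lambda>]])
  show "has_lt_gradient (\<lambda>g. F_tilde s h b L \<U> g g1 \<Omega> \<Lambda>) (- p0) g0 \<longleftrightarrow>
      - p0 = h *\<^sub>R (\<Sum>i\<in>I. b i *\<^sub>R
        skew_adjoint (pi_map i \<circ> phi_inv s h a g0 \<Omega> U \<circ> varphi_map s h a g0 \<Omega> U) (\<mu> L g1 \<Lambda> i))
      + Asym (transpose g0 ** g1 ** \<Lambda>)"
    by (rule has_lt_gradient_iff[OF g0 gradient_start[OF L \<Lambda> sol]])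
qed

lemma adjoint_formulas:
  assumes S: "S \<in> skew" and i: "i \<in> {1..s}"
  shows "let A = stage_mat s h a g0 \<Omega> U;
             is_sol = (\<lambda>T. T \<in> skew_pow s \<and>
               (\<forall>j\<in>{1..s}.
                  T j - Asym (h *\<^sub>R (transpose (U j) **
                           (\<Sum>l=1..s. a l j *\<^sub>R dpolar_adj (A l) (T l)) ** transpose (\<Omega> j)))
                  = (if i = j then S else 0)))
         in (\<exists>!T. is_sol T) \<and>
            (\<forall>T. is_sol T \<longrightarrow>
               skew_adjoint (pi_map i \<circ> phi_inv s h a g0 \<Omega> U \<circ> psi_map s h a g0 \<Omega> U k) S
                 = Asym (transpose (U k) ** (\<Sum>l=1..s. a l k *\<^sub>R dpolar_adj (A l) (T l))) \<and>
               skew_adjoint (pi_map i \<circ> phi_inv s h a g0 \<Omega> U \<circ> varphi_map s h a g0 \<Omega> U) S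
                 = Asym (transpose g0 ** (\<Sum>l=1..s. dpolar_adj (A l) (T l))))"
  unfolding Let_def
  unfolding A_def[symmetric] I_def[symmetric] K_adj_def[symmetric] adj_solution_def[symmetric]
  by (intro conjI allI impI adj_solution_exists skew_adjoint_psi skew_adjoint_varphi S
      i[folded I_def])

lemma dpolar_adj_sylvester:
  assumes l: "l \<in> {1..s}"
  shows "\<exists>P. polar_decomp (stage_mat s h a g0 \<Omega> U l) (U l) P \<and>
     (\<forall>S\<in>skew. \<exists>X. P ** X + X ** P = S \<and> (\<forall>Y. P ** Y + Y ** P = S \<longrightarrow> Y = X) \<and>
        dpolar_adj (stage_mat s h a g0 \<Omega> U l) S = U l ** X)"
proof -
  define P where "P = transpose (U l) ** A l"
  have l': "l \<in> I" using l by (simp add: I_def)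
  have dec: "polar_decomp (A l) (U l) P"
    using polar_proj_decomp[OF det_A[OF l']] by (simp add: polar_A[OF l'] P_def)
  then have P: "sym_pos_def P" by (simp add: polar_decomp_def)
  have "\<exists>X. sylvester P X = S \<and> (\<forall>Y. sylvester P Y = S \<longrightarrow> Y = X) \<and> dpolar_adj (A l) S = U l ** X"
    if "S \<in> skew" for S
    using sylvester_inv[OF P] dpolar_adj_eq[OF dec that] by (intro exI[of _ "sylvester_inv P S"]) auto
  with dec show ?thesis unfolding sylvester_def A_def by blast
qed

end

theorem mainTheorem1:
  shows "\<exists>V :: (real^'n^'n) set. open V \<and> mat 1 \<in> V \<and>
    (\<forall>(s::nat) (h::real) (a :: nat \<Rightarrow> nat \<Rightarrow> real) (b :: nat \<Rightarrow> real)
       (L :: real^'n^'n \<Rightarrow> real^'n^'n \<Rightarrow> real).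
     1 \<le> s \<longrightarrow> 0 < h \<longrightarrow> smooth_on (SO \<times> skew) (\<lambda>(U, \<Omega>). L U \<Omega>) \<longrightarrow>
    (\<forall>(g0 :: real^'n^'n) g1 \<Omega> \<Lambda> p0 p1 U.
     g0 \<in> SO \<longrightarrow> g1 \<in> SO \<longrightarrow> \<Omega> \<in> skew_pow s \<longrightarrow> \<Lambda> \<in> skew \<longrightarrow> p0 \<in> skew \<longrightarrow> p1 \<in> skew \<longrightarrow>
     (\<forall>i\<in>{1..s}. U i \<in> SO) \<longrightarrow>
     (\<forall>i\<in>{1..s}. 0 < det (stage_mat s h a g0 \<Omega> U i)) \<longrightarrow>
     (\<forall>i\<in>{1..s}. U i = polar_proj (stage_mat s h a g0 \<Omega> U i)) \<longrightarrow>
     bij_betw (phi_map s h a g0 \<Omega> U) (skew_pow s) (skew_pow s) \<longrightarrow>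
     transpose g1 ** end_mat s h b g0 \<Omega> U \<in> V \<longrightarrow>
       (\<exists>\<U>. stage_solution s h a g0 \<Omega> U \<U>) \<and>
       (\<forall>\<U>. stage_solution s h a g0 \<Omega> U \<U> \<longrightarrow>
        (((\<forall>k\<in>{1..s}. has_skew_gradient (\<lambda>X. F_tilde s h b L \<U> g0 g1 (fun_upd \<Omega> k X) \<Lambda>) 0 (\<Omega> k)) \<and>
          has_skew_gradient (\<lambda>M. F_tilde s h b L \<U> g0 g1 \<Omega> M) 0 \<Lambda> \<and>
          has_lt_gradient (\<lambda>g. F_tilde s h b L \<U> g g1 \<Omega> \<Lambda>) (- p0) g0 \<and>
          has_lt_gradient (\<lambda>g. F_tilde s h b L \<U> g0 g \<Omega> \<Lambda>) p1 g1)
         \<longleftrightarrow>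
         ((\<forall>k\<in>{1..s}.
             0 = h *\<^sub>R (\<Sum>i=1..s. b i *\<^sub>R
                   skew_adjoint (pi_map i \<circ> phi_inv s h a g0 \<Omega> U \<circ> psi_map s h a g0 \<Omega> U k)
                     (lt_gradient (\<lambda>Q. L Q (\<Omega> i)) (U i)
                      + Asym (transpose (U i) ** g1 ** \<Lambda> ** transpose (\<Omega> i))))
                 + b k *\<^sub>R (skew_gradient (\<lambda>X. L (U k) X) (\<Omega> k)
                            + Asym (transpose (U k) ** g1 ** \<Lambda>))) \<and>
          g1 = polar_proj (end_mat s h b g0 \<Omega> U) \<and>
          - p0 = h *\<^sub>R (\<Sum>i=1..s. b i *\<^sub>R
                   skew_adjoint (pi_map i \<circ> phi_inv s h a g0 \<Omega> U \<circ> varphi_map s h a g0 \<Omega> U)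
                     (lt_gradient (\<lambda>Q. L Q (\<Omega> i)) (U i)
                      + Asym (transpose (U i) ** g1 ** \<Lambda> ** transpose (\<Omega> i))))
                 + Asym (transpose g0 ** g1 ** \<Lambda>) \<and>
          p1 = Asym (transpose g1 ** end_mat s h b g0 \<Omega> U ** transpose \<Lambda>)))) \<and>
       (\<forall>S\<in>skew. \<forall>i\<in>{1..s}. \<forall>k\<in>{1..s}.
         let A = stage_mat s h a g0 \<Omega> U;
             is_sol = (\<lambda>T. T \<in> skew_pow s \<and>
               (\<forall>j\<in>{1..s}.
                  T j - Asym (h *\<^sub>R (transpose (U j) **
                           (\<Sum>l=1..s. a l j *\<^sub>R dpolar_adj (A l) (T l)) ** transpose (\<Omega> j)))
                  = (if i = j then S else 0)))
         in (\<exists>!T. is_sol T) \<and>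
            (\<forall>T. is_sol T \<longrightarrow>
               skew_adjoint (pi_map i \<circ> phi_inv s h a g0 \<Omega> U \<circ> psi_map s h a g0 \<Omega> U k) S
                 = Asym (transpose (U k) ** (\<Sum>l=1..s. a l k *\<^sub>R dpolar_adj (A l) (T l))) \<and>
               skew_adjoint (pi_map i \<circ> phi_inv s h a g0 \<Omega> U \<circ> varphi_map s h a g0 \<Omega> U) S
                 = Asym (transpose g0 ** (\<Sum>l=1..s. dpolar_adj (A l) (T l))))) \<and>
       (\<forall>l\<in>{1..s}. \<exists>P. polar_decomp (stage_mat s h a g0 \<Omega> U l) (U l) P \<and>
          (\<forall>S\<in>skew. \<exists>X. P ** X + X ** P = S \<and> (\<forall>Y. P ** Y + Y ** P = S \<longrightarrow> Y = X) \<and>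
             dpolar_adj (stage_mat s h a g0 \<Omega> U l) S = U l ** X))))"
proof (rule exI[of _ "ball (mat 1) 1"], rule conjI[OF open_ball conjI], simp,
    intro allI impI)
  fix s h a b and L :: "real^'n^'n \<Rightarrow> real^'n^'n \<Rightarrow> real" and g0 g1 \<Lambda> p0 p1 :: "real^'n^'n"
    and \<Omega> U :: "nat \<Rightarrow> real^'n^'n"
  assume h: "0 < h" and L: "smooth_on (SO \<times> skew) (\<lambda>(U, \<Omega>). L U \<Omega>)"
    and g: "g0 \<in> SO" "g1 \<in> SO" and \<Omega>: "\<Omega> \<in> skew_pow s" and \<Lambda>: "\<Lambda> \<in> skew"
    and U: "\<forall>i\<in>{1..s}. U i \<in> SO"
      "\<forall>i\<in>{1..s}. 0 < det (stage_mat s h a g0 \<Omega> U i)"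
      "\<forall>i\<in>{1..s}. U i = polar_proj (stage_mat s h a g0 \<Omega> U i)"
    and phi: "bij_betw (phi_map s h a g0 \<Omega> U) (skew_pow s) (skew_pow s)"
    and V: "transpose g1 ** end_mat s h b g0 \<Omega> U \<in> ball (mat 1) 1"
  interpret internal_stages s h a g0 \<Omega> U
    using g \<Omega> U phi by unfold_locales (fact | blast)+
  \<comment> \<open>Lying in the unit ball about the identity supplies the positivity that turns
    symmetry into equation (2).\<close>
  have pd: "posdef (transpose g1 ** end_mat s h b g0 \<Omega> U)"
    using V by (intro near_identity_posdef) (simp add: dist_norm norm_minus_commute)
  show "(\<exists>\<U>. stage_solution s h a g0 \<Omega> U \<U>) \<and>
       (\<forall>\<U>. stage_solution s h a g0 \<Omega> U \<U> \<longrightarrow>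
        (((\<forall>k\<in>{1..s}. has_skew_gradient (\<lambda>X. F_tilde s h b L \<U> g0 g1 (fun_upd \<Omega> k X) \<Lambda>) 0 (\<Omega> k)) \<and>
          has_skew_gradient (\<lambda>M. F_tilde s h b L \<U> g0 g1 \<Omega> M) 0 \<Lambda> \<and>
          has_lt_gradient (\<lambda>g. F_tilde s h b L \<U> g g1 \<Omega> \<Lambda>) (- p0) g0 \<and>
          has_lt_gradient (\<lambda>g. F_tilde s h b L \<U> g0 g \<Omega> \<Lambda>) p1 g1)
         \<longleftrightarrow>
         ((\<forall>k\<in>{1..s}.
             0 = h *\<^sub>R (\<Sum>i=1..s. b i *\<^sub>R
                   skew_adjoint (pi_map i \<circ> phi_inv s h a g0 \<Omega> U \<circ> psi_map s h a g0 \<Omega> U k)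
                     (lt_gradient (\<lambda>Q. L Q (\<Omega> i)) (U i)
                      + Asym (transpose (U i) ** g1 ** \<Lambda> ** transpose (\<Omega> i))))
                 + b k *\<^sub>R (skew_gradient (\<lambda>X. L (U k) X) (\<Omega> k)
                            + Asym (transpose (U k) ** g1 ** \<Lambda>))) \<and>
          g1 = polar_proj (end_mat s h b g0 \<Omega> U) \<and>
          - p0 = h *\<^sub>R (\<Sum>i=1..s. b i *\<^sub>R
                   skew_adjoint (pi_map i \<circ> phi_inv s h a g0 \<Omega> U \<circ> varphi_map s h a g0 \<Omega> U)
                     (lt_gradient (\<lambda>Q. L Q (\<Omega> i)) (U i)
                      + Asym (transpose (U i) ** g1 ** \<Lambda> ** transpose (\<Omega> i))))
                 + Asym (transpose g0 ** g1 ** \<Lambda>) \<and>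
          p1 = Asym (transpose g1 ** end_mat s h b g0 \<Omega> U ** transpose \<Lambda>)))) \<and>
       (\<forall>S\<in>skew. \<forall>i\<in>{1..s}. \<forall>k\<in>{1..s}.
         let A = stage_mat s h a g0 \<Omega> U;
             is_sol = (\<lambda>T. T \<in> skew_pow s \<and>
               (\<forall>j\<in>{1..s}.
                  T j - Asym (h *\<^sub>R (transpose (U j) **
                           (\<Sum>l=1..s. a l j *\<^sub>R dpolar_adj (A l) (T l)) ** transpose (\<Omega> j)))
                  = (if i = j then S else 0)))
         in (\<exists>!T. is_sol T) \<and>
            (\<forall>T. is_sol T \<longrightarrow>
               skew_adjoint (pi_map i \<circ> phi_inv s h a g0 \<Omega> U \<circ> psi_map s h a g0 \<Omega> U k) S
                 = Asym (transpose (U k) ** (\<Sum>l=1..s. a l k *\<^sub>R dpolar_adj (A l) (T l))) \<and>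
               skew_adjoint (pi_map i \<circ> phi_inv s h a g0 \<Omega> U \<circ> varphi_map s h a g0 \<Omega> U) S
                 = Asym (transpose g0 ** (\<Sum>l=1..s. dpolar_adj (A l) (T l))))) \<and>
       (\<forall>l\<in>{1..s}. \<exists>P. polar_decomp (stage_mat s h a g0 \<Omega> U l) (U l) P \<and>
          (\<forall>S\<in>skew. \<exists>X. P ** X + X ** P = S \<and> (\<forall>Y. P ** Y + Y ** P = S \<longrightarrow> Y = X) \<and>
             dpolar_adj (stage_mat s h a g0 \<Omega> U l) S = U l ** X))"
    by (intro conjI allI impI ballI stage_solution_exists adjoint_formulas dpolar_adj_sylvester
        variational_equations_iff[OF h L g(2) \<Lambda> pd])
qed

end
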